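(* Let $G$ be a permutation group on $n$ points ($n$ finite), containing a normal cyclic subgroup of order $n$ acting regularly. Let $n$ have prime factorization $\prod_i p_i^{a_i}$ (with distinct primes $p_i$ and each $a_i\ge 1$). Then $G$ is join-coherent if and only if there exists for each $i$ a transitive permutation group $G_i$ on $p_i^{a_i}$ points, such that: (i) if $a_i>1$ then $G_i$ is either cyclic or the extension of a cyclic group of order $p_i^{a_i}$ by the automorphism $x\mapsto x^r$ where $r = p_i^{a_i-1}+1$; (ii) if $a_i=1$ then $G_i$ is a subgroup of the Frobenius group of order $p_i(p_i-1)$; (iii) the orders of the groups $G_i$ are mutually coprime; (iv) $G$ is permutation isomorphic to the direct product of the groups $G_i$ in its product action.
   Context: For a permutation group $G$ on a set $\Omega$ and $g\in G$, $\pi(g)$ denotes the partition of $\Omega$ into the orbits of $g$, and $\pi(G)=\{\pi(g)\mid g\in G\}$. Partitions are ordered by refinement, and $\vee$ denotes the supremum (join) of two partitions. $G$ is join-coherent if $\pi(G)$ is closed under $\vee$. In (i), the extension of a cyclic group $K$ of order $p_i^{a_i}$ by the automorphism $f:x\mapsto x^r$ is the semidirect product $K\rtimes\langle f\rangle$, acting on the $p_i^{a_i}$ points of $K$ with $K$ acting by translation and $f$ as an automorphism. In (ii), the Frobenius group of order $p_i(p_i-1)$ is the affine group $\mathrm{AGL}_1(\mathbf{F}_{p_i})$ of maps $x\mapsto ax+b$ acting on $\mathbf{F}_{p_i}$ (of order $2$ when $p_i=2$). The product action of $\prod_i G_i$, with $G_i$ acting on $X_i$, is the coordinatewise action on $\prod_i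 X_i$. Two permutation groups are permutation isomorphic if there is a bijection of the underlying sets and an isomorphism of the groups that intertwine the actions. *)

theory Defs
  imports
    "HOL-Algebra.Algebra"
    "HOL-Number_Theory.Number_Theory"
    "HOL-Library.Disjoint_Sets"
begin

text \<open>
  A permutation group on \<open>\<Omega>\<close> is a set \<open>G\<close> with \<open>subgroup G (BijGroup \<Omega>)\<close>; its natural action is
  the identity map \<open>\<lambda>g. g\<close>.
\<close>

definition perm_group :: "'a set \<Rightarrow> ('a \<Rightarrow> 'a) set \<Rightarrow> ('a \<Rightarrow> 'a) monoid"
  where "perm_group \<Omega> G = BijGroup \<Omega> \<lparr>carrier := G\<rparr>"

definition transitive_perm_group :: "'a set \<Rightarrow> ('a \<Rightarrow> 'a) set \<Rightarrow> bool"
  where "transitive_perm_group \<Omega> G \<longleftrightarrow>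
    subgroup G (BijGroup \<Omega>) \<and> transitive_action (perm_group \<Omega> G) \<Omega> (\<lambda>g. g)"

definition regular_perm_group :: "'a set \<Rightarrow> ('a \<Rightarrow> 'a) set \<Rightarrow> bool"
  where "regular_perm_group \<Omega> G \<longleftrightarrow>
    transitive_perm_group \<Omega> G \<and>
    (\<forall>x\<in>\<Omega>. stabilizer (perm_group \<Omega> G) (\<lambda>g. g) x = {\<one>\<^bsub>perm_group \<Omega> G\<^esub>})"

definition partition_order :: "'a set \<Rightarrow> 'a set set gorder"
  where "partition_order \<Omega> = \<lparr>carrier = {P. partition_on \<Omega> P}, eq = (=), le = refines \<Omega>\<rparr>"

definition orbit_partition :: "'a set \<Rightarrow> ('a \<Rightarrow> 'a) \<Rightarrow> 'a set set"
  where "orbit_partition \<Omega> g = orbits (subgroup_generated (BijGroup \<Omega>) {g}) \<Omega> (\<lambda>h. h)"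

definition join_coherent :: "'a set \<Rightarrow> ('a \<Rightarrow> 'a) set \<Rightarrow> bool"
  where "join_coherent \<Omega> G \<longleftrightarrow>
    (\<forall>P \<in> orbit_partition \<Omega> ` G. \<forall>Q \<in> orbit_partition \<Omega> ` G.
       P \<squnion>\<^bsub>partition_order \<Omega>\<^esub> Q \<in> orbit_partition \<Omega> ` G)"

definition action_isomorphic ::
  "('g, 'm) monoid_scheme \<Rightarrow> 'a set \<Rightarrow> ('g \<Rightarrow> 'a \<Rightarrow> 'a) \<Rightarrow>
   ('h, 'n) monoid_scheme \<Rightarrow> 'b set \<Rightarrow> ('h \<Rightarrow> 'b \<Rightarrow> 'b) \<Rightarrow> bool"
  where "action_isomorphic G \<Omega> \<phi> H \<Delta> \<psi> \<longleftrightarrow>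
    (\<exists>b f. bij_betw b \<Omega> \<Delta> \<and> f \<in> iso G H \<and>
      (\<forall>g\<in>carrier G. \<forall>x\<in>\<Omega>. b (\<phi> g x) = \<psi> (f g) (b x)))"

text \<open>The split extension \<open>K \<rtimes> A\<close>, where \<open>A\<close> is a group of automorphisms of \<open>K\<close>.\<close>

definition semidirect_product ::
  "('a, 'm) monoid_scheme \<Rightarrow> ('a \<Rightarrow> 'a, 'n) monoid_scheme \<Rightarrow> ('a \<times> ('a \<Rightarrow> 'a)) monoid"
  where "semidirect_product K A =
    \<lparr>carrier = carrier K \<times> carrier A,
     monoid.mult = (\<lambda>(k, s) (l, t). (k \<otimes>\<^bsub>K\<^esub> s l, s \<otimes>\<^bsub>A\<^esub> t)),
     one = (\<one>\<^bsub>K\<^esub>, \<one>\<^bsub>A\<^esub>)\<rparr>"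

definition semidirect_action ::
  "('a, 'm) monoid_scheme \<Rightarrow> 'a \<times> ('a \<Rightarrow> 'a) \<Rightarrow> 'a \<Rightarrow> 'a"
  where "semidirect_action K = (\<lambda>(k, s). \<lambda>x\<in>carrier K. k \<otimes>\<^bsub>K\<^esub> s x)"

text \<open>
  \<open>subgroup_generated\<close> discards generators outside the carrier, so this is the extension by the
  \<open>r\<close>-th power map only if that map is an automorphism of \<open>K\<close>.
\<close>

definition power_extension ::
  "('a, 'm) monoid_scheme \<Rightarrow> nat \<Rightarrow> ('a \<times> ('a \<Rightarrow> 'a)) monoid"
  where "power_extension K r =
    semidirect_product K (subgroup_generated (AutoGroup K) {\<lambda>x\<in>carrier K. x [^]\<^bsub>K\<^esub> r})"

definition AGL1 :: "('a, 'm) ring_scheme \<Rightarrow> ('a \<Rightarrow> 'a) set"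
  where "AGL1 F =
    {\<lambda>x\<in>carrier F. a \<otimes>\<^bsub>F\<^esub> x \<oplus>\<^bsub>F\<^esub> b | a b. a \<in> Units F \<and> b \<in> carrier F}"

definition product_action ::
  "'i set \<Rightarrow> ('i \<Rightarrow> 'a set) \<Rightarrow> ('i \<Rightarrow> 'a \<Rightarrow> 'a) \<Rightarrow> ('i \<Rightarrow> 'a) \<Rightarrow> ('i \<Rightarrow> 'a)"
  where "product_action I D g = (\<lambda>x \<in> Pi\<^sub>E I D. \<lambda>i\<in>I. g i (x i))"


text \<open>Joins of partitions exist, so the choice operator inside \<^const>\<open>Lattice.join\<close> is harmless.\<close>

lemma partition_order_complete_lattice: "complete_lattice (partition_order \<Omega>)"
proof (rule partial_order.complete_lattice_criterion1)
  show po: "partial_order (partition_order \<Omega>)"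
    by unfold_locales
      (auto simp: partition_order_def intro: refines_refl refines_trans dest: refines_asym1)
  show "\<exists>g. greatest (partition_order \<Omega>) g (carrier (partition_order \<Omega>))"
  proof
    show "greatest (partition_order \<Omega>) ({\<Omega>} - {{}}) (carrier (partition_order \<Omega>))"
      by (auto simp: greatest_def partition_order_def refines_def partition_on_def disjoint_def)
  qed
  fix A assume A: "A \<subseteq> carrier (partition_order \<Omega>)" "A \<noteq> {}"
  define B where "B x = {y \<in> \<Omega>. \<forall>P\<in>A. \<exists>p\<in>P. x \<in> p \<and> y \<in> p}" for x
  have part: "partition_on \<Omega> P" if "P \<in> A" for P
    using A that by (auto simp: partition_order_def)
  have un: "p = q" if "P \<in> A" "p \<in> P" "q \<in> P" "x \<in> p" "x \<in> q" for P p q x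
    using part[OF that(1)] that(2-5) by (auto simp: partition_on_def disjoint_def)
  have cov: "\<exists>p\<in>P. x \<in> p" if "P \<in> A" "x \<in> \<Omega>" for P x
    using part[OF that(1)] that(2) by (auto simp: partition_on_def)
  have self: "x \<in> B x" if "x \<in> \<Omega>" for x
    using that cov by (auto simp: B_def)
  have link: "\<exists>p\<in>P. x \<in> p \<and> z \<in> p"
    if "P \<in> A" "\<exists>p\<in>P. x \<in> p \<and> y \<in> p" "\<exists>p\<in>P. y \<in> p \<and> z \<in> p" for P x y z
  proof -
    from that obtain p q where pq: "p \<in> P" "x \<in> p" "y \<in> p" "q \<in> P" "y \<in> q" "z \<in> q"
      by blast
    then have "p = q" using un[OF that(1)] by blast
    with pq show ?thesis by blast
  qed
  have Bsub: "B x \<subseteq> B y" if z: "z \<in> B x" "z \<in> B y" for x y z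
  proof
    fix w assume w: "w \<in> B x"
    have "\<exists>p\<in>P. y \<in> p \<and> w \<in> p" if P: "P \<in> A" for P
    proof (rule link[OF P])
      show "\<exists>p\<in>P. y \<in> p \<and> z \<in> p" using z(2) P by (auto simp: B_def)
      show "\<exists>p\<in>P. z \<in> p \<and> w \<in> p"
      proof (rule link[OF P])
        show "\<exists>p\<in>P. z \<in> p \<and> x \<in> p" using z(1) P unfolding B_def by blast
        show "\<exists>p\<in>P. x \<in> p \<and> w \<in> p" using w P by (auto simp: B_def)
      qed
    qed
    with w show "w \<in> B y" by (auto simp: B_def)
  qed
  have Beq: "B x = B y" if "z \<in> B x" "z \<in> B y" for x y z
    using Bsub[OF that] Bsub[OF that(2,1)] by (rule equalityI)
  have Bpart: "partition_on \<Omega> (B ` \<Omega>)"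
  proof (rule partition_onI)
    show "\<Union> (B ` \<Omega>) = \<Omega>" using self by (auto simp: B_def)
    show "disjnt p q" if "p \<in> B ` \<Omega>" "q \<in> B ` \<Omega>" "p \<noteq> q" for p q
      using that Beq by (auto simp: disjnt_def)
    show "{} \<notin> B ` \<Omega>" using self by fastforce
  qed
  have lower: "refines \<Omega> (B ` \<Omega>) P" if P: "P \<in> A" for P
  proof -
    have "\<exists>p\<in>P. B x \<subseteq> p" if x: "x \<in> \<Omega>" for x
    proof -
      obtain p where "p \<in> P" "x \<in> p" using cov[OF P x] by blast
      have "B x \<subseteq> p"
      proof
        fix y assume "y \<in> B x"
        then obtain p' where p': "p' \<in> P" "x \<in> p'" "y \<in> p'"
          using P by (auto simp: B_def)
        have "p' = p" using un[OF P p'(1) \<open>p \<in> P\<close> p'(2) \<open>x \<in> p\<close>] .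
        with p' show "y \<in> p" by simp
      qed
      with \<open>p \<in> P\<close> show ?thesis by blast
    qed
    then show ?thesis using Bpart part[OF P] by (auto simp: refines_def)
  qed
  have greatest: "refines \<Omega> Q (B ` \<Omega>)"
    if Q: "partition_on \<Omega> Q" "\<forall>P\<in>A. refines \<Omega> Q P" for Q
  proof -
    have "\<exists>D\<in>B ` \<Omega>. q \<subseteq> D" if q: "q \<in> Q" for q
    proof -
      have "q \<noteq> {}" "q \<subseteq> \<Omega>"
        using Q(1) q by (auto simp: partition_on_def)
      then obtain x where x: "x \<in> q" "x \<in> \<Omega>" "q \<subseteq> \<Omega>" by blast
      have "\<exists>p\<in>P. q \<subseteq> p" if "P \<in> A" for P
        using Q(2) q that unfolding refines_def by blast
      then have "\<exists>p\<in>P. x \<in> p \<and> y \<in> p" if "P \<in> A" "y \<in> q" for P y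
        using that x(1) by blast
      then have "q \<subseteq> B x"
        using x(3) unfolding B_def by blast
      then show ?thesis using x(2) by blast
    qed
    then show ?thesis using Q Bpart by (auto simp: refines_def)
  qed
  show "\<exists>i. greatest (partition_order \<Omega>) i (Lower (partition_order \<Omega>) A)"
  proof
    show "greatest (partition_order \<Omega>) (B ` \<Omega>) (Lower (partition_order \<Omega>) A)"
      unfolding greatest_def Lower_def partition_order_def
      using Bpart lower greatest A(1)[unfolded partition_order_def] by simp blast
  qed
qed

end

theory Submission
  imports Defs
begin

text \<open>
  Numbering the points along the regular cyclic subgroup identifies \<open>\<Omega>\<close> with the integers modulo \<open>n\<close> and
  \<open>G\<close> with all maps \<open>x \<mapsto> s x + b\<close> where \<open>s\<close> runs over a group \<open>A\<close> of units modulo \<open>n\<close>. The join of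
  two orbit partitions is the orbit partition of the group generated, so join-coherence says that
  every two-generated subgroup has the same orbits as some single element.

  Necessity needs two kinds of joins. For \<open>d\<close> dividing \<open>n\<close>, the maps \<open>x \<mapsto> s x\<close> and \<open>x \<mapsto> x + d\<close>
  generate a group whose orbits are the preimages of the orbits of \<open>s\<close> modulo \<open>d\<close>. If \<open>x \<mapsto> t x + c\<close> has
  these orbits, then \<open>t\<close> and \<open>s\<close> generate the same group modulo \<open>d\<close>, while transitivity on each class
  modulo \<open>d\<close> forces \<open>t\<close> to be 1 modulo every prime dividing \<open>n div d\<close>. Suitable choices of \<open>d\<close> determine
  \<open>A\<close> modulo \<open>p ^ a\<close> for \<open>a > 1\<close>, and show that \<open>s\<close> modulo \<open>p\<close> has order prime to the other prime factors
  of \<open>n\<close>. The join of two multiplications \<open>x \<mapsto> u x\<close> and \<open>x \<mapsto> v x\<close> excludes a common prime divisor of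
  the orders of \<open>A\<close> modulo \<open>p\<close> and modulo \<open>q\<close>. By the Chinese
  remainder theorem \<open>G\<close> then splits as a product.

  Conversely, coprime orders make a cyclic subgroup of the product the product of its projections,
  so the joins may be formed factor by factor. Over a prime field, two affine maps generate a cyclic
  group or a transitive one, the latter because their commutator is a translation. In the extension of prime power order, an element whose translation part
  is not divisible by \<open>p ^ (a - 1)\<close> has residue classes as orbits, except in the dihedral group of
  order 8, and the remaining elements act on each class modulo \<open>p ^ (a - 1)\<close> by a translation.
\<close>

hide_const (open) Divisibility.prime

section \<open>Affine orbits over residue classes\<close>

text \<open>The recurring obstruction to join-coherence is a fixed point. When \<open>t - 1\<close>
  has too few factors \<open>p\<close>, the map \<open>x \<mapsto> t x + c\<close> fixes a point
  modulo \<open>d * p\<close>; its orbit is then trapped in one class modulo \<open>d * p\<close>,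
  whereas the join with the translation by \<open>d\<close> must sweep out a whole class modulo
  \<open>d\<close>. The argument needs \<open>d * p\<close> to divide \<open>n\<close>, so at a
  prime of exact exponent \<open>a\<close> it stops at \<open>p ^ (a - 1)\<close>. What stays free
  is the kernel of reducing units from \<open>p ^ a\<close> to \<open>p ^ (a - 1)\<close>. For
  \<open>a > 1\<close> this kernel has order \<open>p\<close> and is generated by
  \<open>1 + p ^ (a - 1)\<close>, the origin of \<open>r\<close>; for \<open>a = 1\<close> it
  consists of all units modulo \<open>p\<close>, hence the Frobenius group.

  The dihedral group of order 8 is exceptional in the converse because a reflection without fixed
  points on four points squares to the identity: its orbits have size two and are not residue
  classes.

  Finiteness is used throughout to replace generated groups by forward iteration, inverses being
  powers.\<close>

definition affine :: "int \<Rightarrow> int \<Rightarrow> int \<Rightarrow> int"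
  where "affine t c z = t * z + c"

lemma affine_cong: "[x = y] (mod m) \<Longrightarrow> [affine t c x = affine t c y] (mod m)"
  unfolding affine_def by (intro cong_add cong_mult cong_refl)

lemma funpow_affine_fixed:
  assumes "[affine t c x = x] (mod m)"
  shows "[(affine t c ^^ j) x = x] (mod m)"
proof (induction j)
  case (Suc j)
  have "[affine t c ((affine t c ^^ j) x) = affine t c x] (mod m)"
    using Suc by (rule affine_cong)
  then show ?case using assms by (auto intro: cong_trans)
qed simp

lemma funpow_affine_linear:
  assumes "m dvd c"
  shows "[(affine t c ^^ j) x = t ^ j * x] (mod m)"
proof (induction j)
  case (Suc j)
  have "[affine t c ((affine t c ^^ j) x) = affine t c (t ^ j * x)] (mod m)"
    using Suc by (rule affine_cong)
  also have "[affine t c (t ^ j * x) = t ^ Suc j * x] (mod m)"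
    using assms by (simp add: affine_def cong_iff_dvd_diff algebra_simps)
  finally show ?case by simp
qed simp

lemma funpow_affine_translation:
  assumes "[t = 1] (mod m)"
  shows "[(affine t c ^^ j) x = x + int j * c] (mod m)"
proof (induction j)
  case (Suc j)
  have "[affine t c ((affine t c ^^ j) x) = affine t c (x + int j * c)] (mod m)"
    using Suc by (rule affine_cong)
  also have "[affine t c (x + int j * c) = 1 * (x + int j * c) + c] (mod m)"
    unfolding affine_def using assms by (intro cong_add cong_mult cong_refl)
  finally show ?case by (simp add: algebra_simps)
qed simp

text \<open>Bezout over the naturals gives \<open>i * x = j * y + 1\<close>, so
  \<open>(t ^ i) ^ x\<close> equals \<open>(t ^ j) ^ y * t\<close>; the left side reduces to 1 and
  the right side to \<open>t\<close>.\<close>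

lemma cong_1_of_coprime_powers:
  fixes t :: int
  assumes "[t ^ i = 1] (mod m)" "[t ^ j = 1] (mod m)" "coprime i j" "i > 0"
  shows "[t = 1] (mod m)"
proof -
  obtain x y where "i * x = j * y + gcd i j"
    using bezout_nat[of i j] assms(4) by blast
  then have xy: "i * x = j * y + 1" using assms(3) by simp
  have "[(t ^ i) ^ x = 1 ^ x] (mod m)" using assms(1) by (rule cong_pow)
  moreover have "[(t ^ j) ^ y * t = 1 ^ y * t] (mod m)"
    using assms(2) by (intro cong_mult cong_pow cong_refl)
  moreover have "(t ^ i) ^ x = (t ^ j) ^ y * t"
    using xy by (simp flip: power_mult power_add)
  ultimately show ?thesis by (metis cong_sym cong_trans mult_1 power_one)
qed

text \<open>Units modulo \<open>p ^ a\<close> that are 1 modulo \<open>p\<close> form a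
  \<open>p\<close>-group, which has no element of order \<open>r\<close>. Concretely,
  \<open>s ^ r - 1\<close> is \<open>s - 1\<close> times a geometric sum that is congruent to
  \<open>r\<close> modulo \<open>p\<close> and therefore a unit.\<close>

lemma cong_1_prime_power_lift:
  fixes s :: int
  assumes p: "prime p" and r: "prime r" "r \<noteq> p"
    and s: "[s = 1] (mod int p)" "[s ^ r = 1] (mod int p ^ a)"
  shows "[s = 1] (mod int p ^ a)"
proof -
  have "[(\<Sum>i<r. s ^ i) = (\<Sum>i<r. 1 ^ i)] (mod int p)"
    by (intro cong_sum cong_pow s)
  then have "[(\<Sum>i<r. s ^ i) = int r] (mod int p)" by simp
  moreover have "coprime (int r) (int p)"
    using p r by (simp add: primes_coprime)
  ultimately have "coprime (\<Sum>i<r. s ^ i) (int p)"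
    by (meson cong_imp_coprime cong_sym)
  then have "coprime (int p ^ a) (\<Sum>i<r. s ^ i)"
    by (simp add: coprime_commute)
  moreover have "int p ^ a dvd (s - 1) * (\<Sum>i<r. s ^ i)"
    using s(2) by (simp add: cong_iff_dvd_diff power_diff_1_eq)
  ultimately have "int p ^ a dvd s - 1" by (simp add: coprime_dvd_mult_left_iff)
  then show ?thesis by (simp add: cong_iff_dvd_diff)
qed

text \<open>The source of all fixed points: those of \<open>x \<mapsto> t x + c\<close> are the
  roots of \<open>(t - 1) * x + c\<close>.\<close>

lemma ex_linear_root_mod_prime:
  fixes u c q :: int
  assumes "prime q" "\<not> q dvd u"
  shows "\<exists>x. q dvd u * x + c"
proof -
  have "coprime u q" using assms by (simp add: coprime_commute prime_imp_coprime)
  then obtain x where "[u * x = - c] (mod q)" using cong_solve_coprime_int[of u q]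
    by (metis cong_scalar_right mult.assoc mult_1)
  then show ?thesis by (auto simp: cong_iff_dvd_diff)
qed

text \<open>The right-hand side of \<open>orbits\<close> describes the classes of the join of
  \<open>x \<mapsto> s x\<close> and \<open>x \<mapsto> x + d\<close>; the locale studies a single
  affine map with these orbits. The exponent \<open>i = 0\<close> already puts each class modulo
  \<open>d\<close> into one orbit.\<close>

locale affine_orbits =
  fixes n d t c s :: int
  assumes d_dvd: "d dvd n" and d_pos: "d > 0"
    and orbits: "(\<exists>j. [(affine t c ^^ j) x = y] (mod n)) \<longleftrightarrow> (\<exists>i::nat. [y = s ^ i * x] (mod d))"
begin

lemma reach: "[x = y] (mod d) \<Longrightarrow> \<exists>j. [(affine t c ^^ j) x = y] (mod n)"
  using orbits[of x y] by (metis cong_sym mult_1 power_0)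

text \<open>A point fixed modulo \<open>m\<close> never leaves its class modulo \<open>m\<close>,
  while its orbit contains its whole class modulo \<open>d\<close>. For \<open>m\<close> a proper
  multiple of \<open>d\<close> this is contradictory, which is how the lemma is used.\<close>

lemma cong_of_fixed:
  assumes "m dvd n" "[affine t c x = x] (mod m)" "[x = y] (mod d)"
  shows "[x = y] (mod m)"
proof -
  obtain j where "[(affine t c ^^ j) x = y] (mod n)" using reach assms(3) by blast
  then have "[(affine t c ^^ j) x = y] (mod m)" using assms(1) by (rule cong_dvd_modulus)
  with funpow_affine_fixed[OF assms(2), of j] show ?thesis by (meson cong_sym cong_trans)
qed

text \<open>One step leads from 0 to \<open>c\<close>, and multiplication by \<open>s\<close> cannot
  leave 0 modulo \<open>d\<close>.\<close>

lemma dvd_c: "d dvd c"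
proof -
  have "[(affine t c ^^ 1) 0 = c] (mod n)" by (simp add: affine_def)
  then obtain i :: nat where "[c = s ^ i * 0] (mod d)" using orbits by blast
  then show ?thesis by (simp add: cong_0_iff)
qed

text \<open>Read off from the orbit of 1. Together with \<open>s_power\<close>, \<open>t\<close> and
  \<open>s\<close> have the same powers modulo \<open>d\<close>, so vanishing statements pass
  between them.\<close>

lemma t_power: "\<exists>i. [t = s ^ i] (mod d)"
proof -
  have "[(affine t c ^^ 1) 1 = t + c] (mod n)" by (simp add: affine_def)
  then obtain i :: nat where "[t + c = s ^ i * 1] (mod d)" using orbits by blast
  then have "[t = s ^ i] (mod d)" using dvd_c
    by (metis add.right_neutral cong_0_iff cong_add_lcancel cong_sym cong_trans mult.right_neutral)
  then show ?thesis ..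
qed

lemma s_power: "\<exists>j. [s = t ^ j] (mod d)"
proof -
  have "\<exists>i::nat. [s = s ^ i * 1] (mod d)" by (rule exI[of _ 1]) simp
  then obtain j where "[(affine t c ^^ j) 1 = s] (mod n)" using orbits by blast
  then have "[(affine t c ^^ j) 1 = s] (mod d)" using d_dvd by (rule cong_dvd_modulus)
  with funpow_affine_linear[OF dvd_c, where t = t and j = j and x = 1] have "[s = t ^ j] (mod d)"
    by (metis cong_sym cong_trans mult.right_neutral)
  then show ?thesis ..
qed

text \<open>Otherwise the root of \<open>(t - 1) * x + c div d\<close> modulo \<open>q\<close>
  yields the point \<open>d * x\<close>, fixed modulo \<open>d * q\<close>, and
  \<open>cong_of_fixed\<close> would squeeze a class modulo \<open>d\<close> into a class modulo
  \<open>d * q\<close>.\<close>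

lemma t_cong_1_mod_prime:
  assumes q: "prime q" "d * q dvd n"
  shows "[t = 1] (mod q)"
proof (rule ccontr)
  assume "\<not> [t = 1] (mod q)"
  then have nd: "\<not> q dvd t - 1" by (simp add: cong_iff_dvd_diff)
  obtain c' where c': "c = d * c'" using dvd_c by auto
  obtain x where "q dvd (t - 1) * x + c'" using ex_linear_root_mod_prime[OF q(1) nd] by blast
  then have "d * q dvd d * ((t - 1) * x + c')" by simp
  then have "[affine t c (d * x) = d * x] (mod d * q)"
    by (simp add: cong_iff_dvd_diff affine_def c' algebra_simps)
  from cong_of_fixed[OF q(2) this, of "d * x + d"]
  have "d * q dvd d" by (simp add: cong_iff_dvd_diff)
  then show False using q d_pos by (simp add: not_prime_unit)
qed

end

text \<open>The arithmetic content of join-coherence, separated from permutations.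
  \<open>join_multipliers\<close> records only the orbit of 1: for units it says that
  \<open>u\<close> and \<open>v\<close> generate a cyclic group modulo \<open>n\<close> with a
  generator in \<open>A\<close>.\<close>

locale join_closed_multipliers =
  fixes n :: int and A :: "int set"
  assumes join_translation:
      "s \<in> A \<Longrightarrow> d dvd n \<Longrightarrow> d > 0 \<Longrightarrow> \<exists>t\<in>A. \<exists>c. affine_orbits n d t c s"
    and join_multipliers:
      "u \<in> A \<Longrightarrow> v \<in> A \<Longrightarrow>
        \<exists>t\<in>A. (\<forall>y. (\<exists>j. [t ^ j = y] (mod n)) \<longleftrightarrow> (\<exists>i j. [y = u ^ i * v ^ j] (mod n)))"
begin

text \<open>Both \<open>d\<close> and the auxiliary prime are \<open>p\<close> here:
  \<open>t\<close> is 1 modulo \<open>p\<close>, and \<open>s\<close> is a power of \<open>t\<close>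
  modulo \<open>p\<close>.\<close>

lemma cong_1_mod_square_divisor:
  assumes p: "prime p" "p ^ 2 dvd n" and s: "s \<in> A"
  shows "[s = 1] (mod p)"
proof -
  have "p dvd n" using p(2) by (meson dvd_power dvd_trans pos2)
  then obtain t c where "affine_orbits n p t c s"
    using join_translation[OF s, of p] p(1) by (auto dest: prime_gt_0_int)
  then interpret affine_orbits n p t c s .
  have "[t = 1] (mod p)" using t_cong_1_mod_prime[of p] p by (simp add: power2_eq_square)
  then show ?thesis using s_power by (metis cong_pow cong_trans power_one)
qed

text \<open>Take \<open>d = p ^ (j + 1)\<close>. Since \<open>t\<close> is a power of
  \<open>s\<close>, \<open>t = 1 + p ^ j * u\<close>. If \<open>p\<close> did not divide
  \<open>u\<close>, a multiple of \<open>p\<close> would be fixed modulo \<open>p ^ (j + 2)\<close>: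
  the factor \<open>p\<close> of the point makes up for the missing factor of
  \<open>t - 1\<close>.\<close>

lemma cong_1_step:
  assumes p: "prime p" "p ^ (j + 2) dvd n" and j: "j \<ge> 1"
    and s: "s \<in> A" "[s = 1] (mod p ^ j)"
  shows "[s = 1] (mod p ^ (j + 1))"
proof -
  have p0: "p > 0" using p(1) by (rule prime_gt_0_int)
  have "p ^ (j + 1) dvd n" by (rule dvd_trans[OF _ p(2)]) (simp add: le_imp_power_dvd)
  then obtain t c where "affine_orbits n (p ^ (j + 1)) t c s"
    using join_translation[OF s(1), of "p ^ (j + 1)"] p0 by auto
  then interpret affine_orbits n "p ^ (j + 1)" t c s .
  obtain i where "[t = s ^ i] (mod p ^ (j + 1))" using t_power by blast
  then have "[t = s ^ i] (mod p ^ j)" by (rule cong_dvd_modulus) simp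
  then have "[t = 1] (mod p ^ j)" using s(2) by (metis cong_pow cong_trans power_one)
  then obtain u where u: "t = 1 + p ^ j * u"
    by (metis add_diff_cancel_left' add.commute cong_iff_dvd_diff diff_add_cancel dvdE)
  obtain c' where c': "c = p ^ (j + 1) * c'" using dvd_c by auto
  have "p dvd u"
  proof (rule ccontr)
    assume "\<not> p dvd u"
    then obtain x where "p dvd u * x + c'" using ex_linear_root_mod_prime[OF p(1)] by blast
    then have "p ^ (j + 1) * p dvd p ^ (j + 1) * (u * x + c')" by simp
    then have "[affine t c (p * x) = p * x] (mod p ^ (j + 2))"
      by (simp add: cong_iff_dvd_diff affine_def c' u algebra_simps)
    from cong_of_fixed[OF p(2) this, of "p * x + p ^ (j + 1)"]
    have "p ^ (j + 2) dvd p ^ (j + 1)" by (simp add: cong_iff_dvd_diff)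
    moreover have "p ^ (j + 1) < p ^ (j + 2)"
      using prime_gt_1_int[OF p(1)] by (intro power_strict_increasing) auto
    ultimately show False using p0 by (auto dest!: zdvd_imp_le)
  qed
  then have "[t = 1] (mod p ^ (j + 1))"
    by (auto simp: u cong_iff_dvd_diff)
  then show ?thesis using s_power by (metis cong_pow cong_trans power_one)
qed

text \<open>The induction ends one exponent below \<open>a\<close>, because
  \<open>cong_1_step\<close> compares a class modulo \<open>p ^ (j + 1)\<close> with the finer
  classes modulo \<open>p ^ (j + 2)\<close>, and the latter modulus must still divide
  \<open>n\<close>.\<close>

lemma cong_1_mod_prime_power:
  assumes p: "prime p" "p ^ a dvd n" and s: "s \<in> A" and j: "j + 1 \<le> a"
  shows "[s = 1] (mod p ^ j)"
  using j
proof (induction j)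
  case 0
  then show ?case by simp
next
  case (Suc j)
  have dvd: "p ^ (j + 2) dvd n"
    using Suc.prems by (intro dvd_trans[OF le_imp_power_dvd p(2)]) simp
  show ?case
  proof (cases "j = 0")
    case True
    then show ?thesis using cong_1_mod_square_divisor[OF p(1) _ s] dvd
      by (simp add: numeral_2_eq_2)
  next
    case False
    then show ?thesis using cong_1_step[OF p(1) dvd _ s] Suc by simp
  qed
qed

text \<open>With \<open>d = p\<close>, the multiplier \<open>t\<close> has order \<open>r\<close>
  modulo \<open>p\<close> but is 1 modulo \<open>r\<close>. Some \<open>j\<close> steps lead from 1
  to \<open>1 + p\<close>. Modulo \<open>p\<close> this gives \<open>t ^ j = 1\<close>, so
  \<open>r\<close> divides \<open>j\<close>; modulo \<open>r\<close> the \<open>j\<close> steps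
  translate by \<open>j * c\<close>, which vanishes, although they should translate by
  \<open>p\<close>.\<close>

lemma order_coprime_cofactor:
  assumes p: "prime p" "p dvd n" and r: "prime r" "int r dvd n" "int r \<noteq> p"
    and s: "s \<in> A" "[s ^ r = 1] (mod p)"
  shows "[s = 1] (mod p)"
proof (rule ccontr)
  assume s1: "\<not> [s = 1] (mod p)"
  obtain t c where "affine_orbits n p t c s"
    using join_translation[OF s(1), of p] p by (auto dest: prime_gt_0_int)
  then interpret affine_orbits n p t c s .
  have "coprime p (int r)" using p r by (simp add: primes_coprime)
  then have "p * int r dvd n" using p r by (simp add: divides_mult)
  then have t1: "[t = 1] (mod int r)" using t_cong_1_mod_prime[of "int r"] r by simp
  obtain j where j: "[(affine t c ^^ j) 1 = 1 + p] (mod n)"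
    using reach[of 1 "1 + p"] by (auto simp: cong_iff_dvd_diff)
  have "[t ^ j * 1 = 1 + p] (mod p)"
    using funpow_affine_linear[OF dvd_c, where t = t and j = j and x = 1] cong_dvd_modulus[OF j p(2)]
    by (meson cong_sym cong_trans)
  then have tj: "[t ^ j = 1] (mod p)" by (simp add: cong_def)
  obtain i where i: "[t = s ^ i] (mod p)" using t_power by blast
  have "[t ^ r = (s ^ i) ^ r] (mod p)" using i by (rule cong_pow)
  also have "(s ^ i) ^ r = (s ^ r) ^ i" by (simp add: mult.commute flip: power_mult)
  also have "[\<dots> = 1 ^ i] (mod p)" using s(2) by (rule cong_pow)
  finally have tr: "[t ^ r = 1] (mod p)" by simp
  have tn1: "\<not> [t = 1] (mod p)"
    using s1 s_power by (metis cong_pow cong_trans power_one)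
  have "r dvd j"
  proof (rule ccontr)
    assume "\<not> r dvd j"
    then have "coprime r j" using r(1) by (rule prime_imp_coprime[rotated])
    then show False using cong_1_of_coprime_powers[OF tr tj] r(1) tn1 prime_gt_0_nat by blast
  qed
  have "[(affine t c ^^ j) 1 = 1 + int j * c] (mod int r)"
    using t1 by (rule funpow_affine_translation)
  moreover have "[(affine t c ^^ j) 1 = 1 + p] (mod int r)"
    using j r(2) by (rule cong_dvd_modulus)
  ultimately have "[1 + p = 1 + int j * c] (mod int r)" by (meson cong_sym cong_trans)
  then have "[p = int j * c] (mod int r)" by (simp add: cong_add_lcancel)
  moreover have "[int j * c = 0] (mod int r)" using \<open>r dvd j\<close> by (simp add: cong_0_iff)
  ultimately have "int r dvd p" by (metis cong_0_iff cong_trans)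
  then show False using p(1) r by (auto simp: primes_dvd_imp_eq)
qed

text \<open>The multiplier \<open>t\<close> from the join of \<open>s\<close> with the translation
  by \<open>p\<close> generates the same group as \<open>s\<close> modulo \<open>p\<close> and is
  forced to be trivial modulo \<open>q\<close>.\<close>

lemma isolated_multiplier:
  assumes p: "prime p" "p dvd n" and q: "prime q" "q dvd n" "p \<noteq> q"
    and s: "s \<in> A" "[s ^ r = 1] (mod p)" "\<not> [s = 1] (mod p)"
  shows "\<exists>u\<in>A. [u ^ r = 1] (mod p) \<and> \<not> [u = 1] (mod p) \<and> [u = 1] (mod q)"
proof -
  obtain t c where t: "t \<in> A" "affine_orbits n p t c s"
    using join_translation[OF s(1), of p] p by (auto dest: prime_gt_0_int)
  interpret affine_orbits n p t c s by (rule t(2))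
  have "coprime p q" using p q by (simp add: primes_coprime)
  then have "p * q dvd n" using p q by (simp add: divides_mult)
  then have t1: "[t = 1] (mod q)" using t_cong_1_mod_prime[of q] q by simp
  obtain i where i: "[t = s ^ i] (mod p)" using t_power by blast
  have "[t ^ r = (s ^ i) ^ r] (mod p)" using i by (rule cong_pow)
  also have "(s ^ i) ^ r = (s ^ r) ^ i" by (simp add: mult.commute flip: power_mult)
  also have "[\<dots> = 1 ^ i] (mod p)" using s(2) by (rule cong_pow)
  finally have tr: "[t ^ r = 1] (mod p)" by simp
  have tn1: "\<not> [t = 1] (mod p)"
    using s(3) s_power by (metis cong_pow cong_trans power_one)
  show ?thesis using t(1) tr tn1 t1 by blast
qed

text \<open>Isolating at \<open>p\<close> and at \<open>q\<close> gives \<open>u\<close> and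
  \<open>v\<close> of order \<open>r\<close>, each trivial at the other prime. They would generate a
  product of two groups of order \<open>r\<close>, which is not cyclic, against
  \<open>join_multipliers\<close>: the exponent \<open>k\<close> with \<open>t ^ k = u\<close> is
  prime to \<open>r\<close>, so triviality of \<open>u\<close> modulo \<open>q\<close> makes
  \<open>t\<close>, and with it \<open>v\<close>, trivial there.\<close>

lemma orders_coprime:
  assumes p: "prime p" "p dvd n" and q: "prime q" "q dvd n" "p \<noteq> q" and r: "prime r"
    and s: "s \<in> A" "[s ^ r = 1] (mod p)" "\<not> [s = 1] (mod p)"
    and s': "s' \<in> A" "[s' ^ r = 1] (mod q)"
  shows "[s' = 1] (mod q)"
proof (rule ccontr)
  assume ns': "\<not> [s' = 1] (mod q)"
  obtain u where u: "u \<in> A" "[u ^ r = 1] (mod p)" "\<not> [u = 1] (mod p)" "[u = 1] (mod q)"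
    using isolated_multiplier[OF p q s] by blast
  obtain v where v: "v \<in> A" "[v ^ r = 1] (mod q)" "\<not> [v = 1] (mod q)" "[v = 1] (mod p)"
    using isolated_multiplier[OF q(1,2) p q(3)[symmetric] s' ns'] by blast
  obtain t where t: "\<And>y. (\<exists>j. [t ^ j = y] (mod n)) \<longleftrightarrow> (\<exists>i j. [y = u ^ i * v ^ j] (mod n))"
    using join_multipliers[OF u(1) v(1)] by blast
  have "\<exists>i j. [u = u ^ i * v ^ j] (mod n)"
    by (rule exI[of _ 1], rule exI[of _ 0]) simp
  then obtain k where k: "[t ^ k = u] (mod n)" using t by blast
  have "\<exists>i j. [v = u ^ i * v ^ j] (mod n)"
    by (rule exI[of _ 0], rule exI[of _ 1]) simp
  then obtain l where l: "[t ^ l = v] (mod n)" using t by blast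
  have "\<exists>j. [t ^ j = t] (mod n)" by (rule exI[of _ 1]) simp
  then obtain i j where ij: "[t = u ^ i * v ^ j] (mod n)" using t by blast
  have tr: "[t ^ r = 1] (mod m)" if m: "m dvd n" "[u ^ r = 1] (mod m)" "[v ^ r = 1] (mod m)" for m
  proof -
    have "[t ^ r = (u ^ i * v ^ j) ^ r] (mod m)"
      using cong_dvd_modulus[OF ij m(1)] by (rule cong_pow)
    also have "(u ^ i * v ^ j) ^ r = (u ^ r) ^ i * (v ^ r) ^ j"
      by (simp add: power_mult_distrib mult.commute flip: power_mult)
    also have "[\<dots> = 1 ^ i * 1 ^ j] (mod m)" using m(2,3) by (intro cong_mult cong_pow)
    finally show ?thesis by simp
  qed
  have "[u ^ r = 1] (mod q)" "[v ^ r = 1] (mod p)"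
    using u(4) v(4) by (metis cong_pow power_one)+
  then have trp: "[t ^ r = 1] (mod p)" and trq: "[t ^ r = 1] (mod q)"
    using tr[OF p(2)] tr[OF q(2)] u(2) v(2) by blast+
  have "\<not> r dvd k"
  proof
    assume "r dvd k"
    then have "[t ^ k = 1] (mod p)" using trp
      by (metis cong_pow dvdE power_mult power_one)
    then show False using u(3) cong_dvd_modulus[OF k p(2)] by (meson cong_sym cong_trans)
  qed
  then have "coprime r k" using r by (rule prime_imp_coprime[rotated])
  moreover have "[t ^ k = 1] (mod q)"
    using u(4) cong_dvd_modulus[OF k q(2)] by (meson cong_trans)
  ultimately have "[t = 1] (mod q)"
    using cong_1_of_coprime_powers[OF trq] r prime_gt_0_nat by blast
  then have "[v = 1] (mod q)"
    using cong_dvd_modulus[OF l q(2)] by (metis cong_pow cong_sym cong_trans power_one)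
  then show False using v(3) by blast
qed

end

section \<open>Orbit partitions and reachability\<close>

lemma carrier_perm_group [simp]: "carrier (perm_group V S) = S"
  by (simp add: perm_group_def)

lemma one_perm_group [simp]: "\<one>\<^bsub>perm_group V S\<^esub> = (\<lambda>x\<in>V. x)"
  by (simp add: perm_group_def BijGroup_def)

lemma group_perm_group: "subgroup S (BijGroup V) \<Longrightarrow> group (perm_group V S)"
  unfolding perm_group_def by (rule subgroup.subgroup_is_group[OF _ group_BijGroup])

lemma subgroup_subset_Bij: "subgroup S (BijGroup V) \<Longrightarrow> S \<subseteq> Bij V"
  by (drule subgroup.subset) (simp add: BijGroup_def)

lemma finite_Bij: "finite V \<Longrightarrow> finite (Bij V)"
  by (rule finite_subset[of _ "V \<rightarrow>\<^sub>E V"])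
    (auto simp: Bij_def PiE_iff bij_betw_def extensional_def intro: finite_PiE)

lemma BijD: "g \<in> Bij V \<Longrightarrow> x \<in> V \<Longrightarrow> g x \<in> V"
  by (auto simp: Bij_def bij_betw_def)

lemma funpow_closed: "g ` V \<subseteq> V \<Longrightarrow> x \<in> V \<Longrightarrow> (g ^^ j) x \<in> V"
  by (induction j) auto

lemma mult_BijGroup:
  "g \<in> Bij V \<Longrightarrow> h \<in> Bij V \<Longrightarrow> x \<in> V \<Longrightarrow> (g \<otimes>\<^bsub>BijGroup V\<^esub> h) x = g (h x)"
  by (simp add: BijGroup_def compose_eq)

lemma mult_perm_group:
  assumes "subgroup S (BijGroup V)" "g \<in> S" "h \<in> S" "x \<in> V"
  shows "(g \<otimes>\<^bsub>perm_group V S\<^esub> h) x = g (h x)"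
  using assms subgroup_subset_Bij[OF assms(1)] by (simp add: perm_group_def mult_BijGroup subset_iff)

lemma nat_pow_BijGroup:
  assumes "g \<in> Bij V" "x \<in> V"
  shows "(g [^]\<^bsub>BijGroup V\<^esub> (k::nat)) x = (g ^^ k) x"
  using assms(2)
proof (induction k arbitrary: x)
  case 0
  then show ?case by (simp add: BijGroup_def)
next
  case (Suc k)
  interpret group "BijGroup V" by (rule group_BijGroup)
  have "g [^]\<^bsub>BijGroup V\<^esub> k \<in> Bij V"
    using assms(1) nat_pow_closed[of g k] by (simp add: BijGroup_def)
  then show ?case
    using Suc assms(1) by (simp add: mult_BijGroup BijD funpow_swap1)
qed

lemma nat_pow_perm_group:
  assumes "subgroup S (BijGroup V)" "g \<in> S" "x \<in> V"
  shows "(g [^]\<^bsub>perm_group V S\<^esub> (k::nat)) x = (g ^^ k) x"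
  using assms subgroup_subset_Bij[OF assms(1)]
  by (metis group.is_monoid group_BijGroup monoid.nat_pow_consistent nat_pow_BijGroup
      perm_group_def subsetD)

lemma funpow_order_perm_group:
  assumes "subgroup S (BijGroup V)" "g \<in> S" "x \<in> V"
  shows "(g ^^ Coset.order (perm_group V S)) x = x"
proof -
  interpret group "perm_group V S" using assms(1) by (rule group_perm_group)
  have "g [^]\<^bsub>perm_group V S\<^esub> Coset.order (perm_group V S) = \<one>\<^bsub>perm_group V S\<^esub>"
    using assms(2) by (intro pow_order_eq_1) simp
  then show ?thesis using nat_pow_perm_group[OF assms] assms(3) by (metis one_perm_group restrict_apply')
qed

lemma funpow_period:
  assumes "finite V" "g \<in> Bij V"
  shows "\<exists>k>0. \<forall>x\<in>V. (g ^^ k) x = x"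
proof -
  have sub: "subgroup (Bij V) (BijGroup V)"
    using group.subgroup_self[OF group_BijGroup, of V] by (simp add: BijGroup_def)
  have "Coset.order (perm_group V (Bij V)) > 0"
    using assms finite_Bij by (auto simp: Coset.order_def card_gt_0_iff)
  then show ?thesis using funpow_order_perm_group[OF sub assms(2)] by blast
qed

text \<open>The graph of \<open>g\<close> on \<open>V\<close>. Joins of orbit partitions become
  closures of unions of such graphs. These closures relate a point outside \<open>V\<close> only to
  itself.\<close>

definition step :: "'a set \<Rightarrow> ('a \<Rightarrow> 'a) \<Rightarrow> ('a \<times> 'a) set"
  where "step V g = {(x, g x) | x. x \<in> V}"

lemma step_iff: "(x, y) \<in> step V g \<longleftrightarrow> x \<in> V \<and> y = g x"
  by (auto simp: step_def)

lemma step_subset: "g ` V \<subseteq> V \<Longrightarrow> step V g \<subseteq> V \<times> V"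
  by (auto simp: step_def)

lemma rtrancl_step:
  assumes "g ` V \<subseteq> V" "x \<in> V"
  shows "(x, y) \<in> (step V g)\<^sup>* \<longleftrightarrow> (\<exists>j. y = (g ^^ j) x)"
proof
  assume "(x, y) \<in> (step V g)\<^sup>*"
  then show "\<exists>j. y = (g ^^ j) x"
  proof induction
    case base
    then show ?case by (metis funpow_0)
  next
    case (step y z)
    then show ?case by (metis step_iff funpow.simps(2) o_apply)
  qed
next
  assume "\<exists>j. y = (g ^^ j) x"
  then obtain j where "y = (g ^^ j) x" ..
  moreover have "(x, (g ^^ j) x) \<in> (step V g)\<^sup>*" for j
    by (induction j) (use assms funpow_closed[OF assms] in
      \<open>auto simp: step_iff intro: rtrancl.rtrancl_into_rtrancl\<close>)
  ultimately show "(x, y) \<in> (step V g)\<^sup>*" by simp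
qed

text \<open>If \<open>k\<close> is a period of \<open>g\<close>, then \<open>k - 1\<close> further
  steps lead from \<open>g x\<close> back to \<open>x\<close>.\<close>

lemma sym_rtrancl_step:
  assumes "finite V" "g \<in> Bij V"
  shows "sym ((step V g)\<^sup>*)"
proof -
  have g_img: "g ` V \<subseteq> V" using assms(2) by (auto dest: BijD)
  obtain k where k: "k > 0" "\<forall>x\<in>V. (g ^^ k) x = x" using funpow_period[OF assms] by blast
  have "(g x, x) \<in> (step V g)\<^sup>*" if "x \<in> V" for x
  proof -
    have "x = (g ^^ (k - 1)) (g x)"
      using k that by (metis Suc_diff_1 funpow.simps(2) funpow_swap1 o_apply)
    then show ?thesis using rtrancl_step[OF g_img] g_img that by blast
  qed
  then have "(step V g)\<inverse> \<subseteq> (step V g)\<^sup>*" by (auto simp: step_iff)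
  then have "((step V g)\<^sup>*)\<inverse> \<subseteq> (step V g)\<^sup>*"
    by (metis rtrancl_converse rtrancl_idemp rtrancl_mono)
  then show ?thesis by (auto simp: sym_def)
qed

lemma sym_rtrancl_Un:
  assumes "sym (R\<^sup>*)" "sym (S\<^sup>*)"
  shows "sym ((R \<union> S)\<^sup>*)"
proof -
  have "(R \<union> S)\<^sup>* = (R\<^sup>* \<union> S\<^sup>*)\<^sup>*" by (simp add: rtrancl_Un_rtrancl)
  then show ?thesis using assms by (metis sym_Un sym_rtrancl)
qed

abbreviation same_orbits :: "'a set \<Rightarrow> ('a \<Rightarrow> 'a) \<Rightarrow> ('a \<Rightarrow> 'a) \<Rightarrow> ('a \<Rightarrow> 'a) \<Rightarrow> bool"
  where "same_orbits V k g h \<equiv> (step V k)\<^sup>* = (step V g \<union> step V h)\<^sup>*"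

text \<open>Join-coherence in terms of graphs alone. It makes sense for any set of maps, such as the
  image of an abstract group under an action, and so can be carried between different encodings of a
  group.\<close>

definition orbit_join_closed :: "'a set \<Rightarrow> ('a \<Rightarrow> 'a) set \<Rightarrow> bool"
  where "orbit_join_closed V S \<longleftrightarrow>
    (\<forall>g\<in>S. \<forall>h\<in>S. \<exists>k\<in>S. same_orbits V k g h)"

section \<open>Partitions into reachability classes and their joins\<close>

definition reach_classes :: "'a set \<Rightarrow> ('a \<times> 'a) set \<Rightarrow> 'a set set"
  where "reach_classes V R = (\<lambda>x. R\<^sup>* `` {x}) ` V"

lemma rtrancl_in:
  assumes "R \<subseteq> V \<times> V" "(x, y) \<in> R\<^sup>*" "x \<in> V"
  shows "y \<in> V"
  using assms(2,3,1) by (induction rule: rtrancl_induct) auto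

lemma reach_class_eq:
  assumes "sym (R\<^sup>*)" "(x, y) \<in> R\<^sup>*"
  shows "R\<^sup>* `` {x} = R\<^sup>* `` {y}"
proof -
  have "(y, x) \<in> R\<^sup>*" using assms by (rule symD)
  with assms(2) show ?thesis by (auto intro: rtrancl_trans)
qed

lemma partition_on_reach_classes:
  assumes "R \<subseteq> V \<times> V" "sym (R\<^sup>*)"
  shows "partition_on V (reach_classes V R)"
proof (rule partition_onI)
  show "\<Union> (reach_classes V R) = V"
    using rtrancl_in[OF assms(1)] by (auto simp: reach_classes_def)
  show "{} \<notin> reach_classes V R" by (auto simp: reach_classes_def)
  fix p q assume pq: "p \<in> reach_classes V R" "q \<in> reach_classes V R" "p \<noteq> q"
  then obtain x y where "p = R\<^sup>* `` {x}" "q = R\<^sup>* `` {y}" by (auto simp: reach_classes_def)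
  then show "disjnt p q" using pq(3) reach_class_eq[OF assms(2)]
    unfolding disjnt_iff by (metis Image_singleton_iff)
qed

lemma reach_classes_inject:
  assumes "R \<subseteq> V \<times> V" "S \<subseteq> V \<times> V" "sym (R\<^sup>*)" "sym (S\<^sup>*)"
  shows "reach_classes V R = reach_classes V S \<longleftrightarrow> R\<^sup>* = S\<^sup>*"
proof
  assume "R\<^sup>* = S\<^sup>*"
  then show "reach_classes V R = reach_classes V S" by (simp add: reach_classes_def)
next
  have sub: "T\<^sup>* \<subseteq> U\<^sup>*" if "T \<subseteq> V \<times> V" "reach_classes V T = reach_classes V U" "sym (U\<^sup>*)"
    for T U :: "('a \<times> 'a) set"
  proof (rule rtrancl_subset_rtrancl, rule subrelI)
    fix x y assume xy: "(x, y) \<in> T"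
    then have "x \<in> V" using that(1) by blast
    then have "T\<^sup>* `` {x} \<in> reach_classes V U" using that(2) by (auto simp: reach_classes_def)
    then obtain z where "T\<^sup>* `` {x} = U\<^sup>* `` {z}" by (auto simp: reach_classes_def)
    then have "(z, x) \<in> U\<^sup>*" "(z, y) \<in> U\<^sup>*" using xy by auto
    then show "(x, y) \<in> U\<^sup>*" using that(3) by (meson symE rtrancl_trans)
  qed
  assume "reach_classes V R = reach_classes V S"
  then show "R\<^sup>* = S\<^sup>*" using sub[of R S] sub[of S R] assms by blast
qed

text \<open>Refinement is a condition on single edges, hence additive over unions of relations; this
  is what identifies the join of two partitions.\<close>

lemma refines_reach_classes_iff:
  assumes "R \<subseteq> V \<times> V" "sym (R\<^sup>*)" "partition_on V P"
  shows "refines V (reach_classes V R) P \<longleftrightarrow> (\<forall>(x, y)\<in>R. \<exists>B\<in>P. x \<in> B \<and> y \<in> B)"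
proof
  assume ref: "refines V (reach_classes V R) P"
  have "\<exists>B\<in>P. x \<in> B \<and> y \<in> B" if xy: "(x, y) \<in> R" for x y
  proof -
    have "R\<^sup>* `` {x} \<in> reach_classes V R" using xy assms(1) by (auto simp: reach_classes_def)
    then obtain B where "B \<in> P" "R\<^sup>* `` {x} \<subseteq> B" using ref unfolding refines_def by blast
    then show ?thesis using xy by blast
  qed
  then show "\<forall>(x, y)\<in>R. \<exists>B\<in>P. x \<in> B \<and> y \<in> B" by blast
next
  assume R: "\<forall>(x, y)\<in>R. \<exists>B\<in>P. x \<in> B \<and> y \<in> B"
  have "\<exists>B\<in>P. R\<^sup>* `` {x} \<subseteq> B" if x: "x \<in> V" for x
  proof -
    obtain B where B: "B \<in> P" "x \<in> B" using x assms(3) by (auto simp: partition_on_def)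
    have "y \<in> B" if "(x, y) \<in> R\<^sup>*" for y
      using that
    proof induction
      case (step y z)
      then obtain C where C: "C \<in> P" "y \<in> C" "z \<in> C" using R by blast
      then have "C = B" using B step.IH assms(3)
        by (metis IntI disjointD empty_iff partition_onD2)
      then show ?case using C by simp
    qed (rule B)
    then show ?thesis using B by blast
  qed
  then show "refines V (reach_classes V R) P"
    using assms partition_on_reach_classes[OF assms(1,2)]
    by (auto simp: refines_def reach_classes_def)
qed

lemma join_reach_classes:
  assumes "R \<subseteq> V \<times> V" "S \<subseteq> V \<times> V" "sym (R\<^sup>*)" "sym (S\<^sup>*)"
  shows "reach_classes V R \<squnion>\<^bsub>partition_order V\<^esub> reach_classes V S = reach_classes V (R \<union> S)"
proof -
  let ?L = "partition_order V"
  interpret complete_lattice ?L by (rule partition_order_complete_lattice)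
  have RS: "R \<union> S \<subseteq> V \<times> V" "sym ((R \<union> S)\<^sup>*)" using assms sym_rtrancl_Un by auto
  note parts = partition_on_reach_classes[OF assms(1,3)] partition_on_reach_classes[OF assms(2,4)]
    partition_on_reach_classes[OF RS]
  have carr [simp]: "P \<in> carrier ?L \<longleftrightarrow> partition_on V P" for P by (simp add: partition_order_def)
  have le [simp]: "P \<sqsubseteq>\<^bsub>?L\<^esub> Q \<longleftrightarrow> refines V P Q" for P Q by (simp add: partition_order_def)
  have upper: "P \<in> Upper ?L {reach_classes V R, reach_classes V S} \<longleftrightarrow>
      partition_on V P \<and> refines V (reach_classes V (R \<union> S)) P" for P
  proof (cases "partition_on V P")
    case True
    have "P \<in> Upper ?L {reach_classes V R, reach_classes V S} \<longleftrightarrow>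
        refines V (reach_classes V R) P \<and> refines V (reach_classes V S) P"
      using True parts(1,2) by (auto simp: Upper_def)
    then show ?thesis
      using True refines_reach_classes_iff[OF assms(1,3) True]
        refines_reach_classes_iff[OF assms(2,4) True] refines_reach_classes_iff[OF RS True]
      by (simp only: ball_Un simp_thms)
  qed (simp add: Upper_def)
  have lst: "least ?L (reach_classes V (R \<union> S)) (Upper ?L {reach_classes V R, reach_classes V S})"
    unfolding least_def using upper refines_refl[OF parts(3)] parts(3) by (auto simp: subset_iff)
  \<comment> \<open>The join is defined by choice, so uniqueness of the least upper bound is
    required as well.\<close>
  have "P = reach_classes V (R \<union> S)"
    if "least ?L P (Upper ?L {reach_classes V R, reach_classes V S})" for P
    using that lst unfolding least_def le by (meson refines_asym)
  then show ?thesis unfolding join_def sup_def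
    using lst by (rule some_equality[rotated])
qed

text \<open>In a finite group the subgroup generated by \<open>g\<close> consists of its nonnegative
  powers, and these are the forward iterates.\<close>

lemma orbit_partition_eq_reach_classes:
  assumes "finite V" "g \<in> Bij V"
  shows "orbit_partition V g = reach_classes V (step V g)"
proof -
  interpret group "BijGroup V" by (rule group_BijGroup)
  have g: "g \<in> carrier (BijGroup V)" using assms by (simp add: BijGroup_def)
  have fin: "finite (carrier (BijGroup V))" using assms finite_Bij by (simp add: BijGroup_def)
  have carr: "carrier (subgroup_generated (BijGroup V) {g}) = {g [^]\<^bsub>BijGroup V\<^esub> k |k. k \<in> (UNIV :: nat set)}"
    using generate_pow_on_finite_carrier[OF fin g] g
    by (simp add: carrier_subgroup_generated)
  have g_img: "g ` V \<subseteq> V" using assms(2) by (auto dest: BijD)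
  have "orbit (subgroup_generated (BijGroup V) {g}) (\<lambda>h. h) x = (step V g)\<^sup>* `` {x}" if "x \<in> V" for x
  proof -
    have "orbit (subgroup_generated (BijGroup V) {g}) (\<lambda>h. h) x =
        {(g [^]\<^bsub>BijGroup V\<^esub> k) x |k::nat. True}"
      unfolding orbit_def carr by blast
    then show ?thesis
      using nat_pow_BijGroup[OF assms(2) that] rtrancl_step[OF g_img that] by auto
  qed
  then show ?thesis
    by (auto simp: orbit_partition_def orbits_def reach_classes_def)
qed

lemma join_coherent_iff_orbit_join_closed:
  assumes "finite V" "S \<subseteq> Bij V"
  shows "join_coherent V S \<longleftrightarrow> orbit_join_closed V S"
proof -
  have sub: "step V g \<subseteq> V \<times> V" if "g \<in> S" for g
    using that assms by (intro step_subset) (auto dest: BijD)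
  have sy: "sym ((step V g)\<^sup>*)" if "g \<in> S" for g
    using that assms by (intro sym_rtrancl_step) auto
  have eq: "orbit_partition V g = reach_classes V (step V g)" if "g \<in> S" for g
    using that assms by (intro orbit_partition_eq_reach_classes) auto
  have "(orbit_partition V g \<squnion>\<^bsub>partition_order V\<^esub> orbit_partition V h \<in> orbit_partition V ` S) \<longleftrightarrow>
      (\<exists>k\<in>S. same_orbits V k g h)" if gh: "g \<in> S" "h \<in> S" for g h
  proof -
    have "step V g \<union> step V h \<subseteq> V \<times> V" using sub gh by blast
    moreover have "sym ((step V g \<union> step V h)\<^sup>*)" using sy gh by (intro sym_rtrancl_Un)
    ultimately show ?thesis
      using gh sub sy
      by (auto simp: image_iff eq join_reach_classes reach_classes_inject)
  qed
  then show ?thesis by (simp add: join_coherent_def orbit_join_closed_def)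
qed

section \<open>Transport of orbit joins along bijections\<close>

lemma rtrancl_image_iff:
  assumes "inj_on b V" "R \<subseteq> V \<times> V" "x \<in> V" "y \<in> V"
  shows "(b x, b y) \<in> (map_prod b b ` R)\<^sup>* \<longleftrightarrow> (x, y) \<in> R\<^sup>*"
proof
  have "\<exists>y\<in>V. v = b y \<and> (x, y) \<in> R\<^sup>*" if "(b x, v) \<in> (map_prod b b ` R)\<^sup>*" for v
    using that
  proof induction
    case base
    then show ?case using assms(3) by blast
  next
    case (step v w)
    then obtain y where y: "y \<in> V" "v = b y" "(x, y) \<in> R\<^sup>*" by blast
    from step(2) obtain y' z where yz: "(y', z) \<in> R" "v = b y'" "w = b z" by auto
    have "y' \<in> V" "z \<in> V" using yz(1) assms(2) by blast+
    with y(1) yz(2) have "y' = y" using inj_onD[OF assms(1)] y(2) by metis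
    with yz(1) y(3) have "(x, z) \<in> R\<^sup>*" by (simp add: rtrancl.rtrancl_into_rtrancl)
    with yz(3) \<open>z \<in> V\<close> show ?case by blast
  qed
  moreover assume "(b x, b y) \<in> (map_prod b b ` R)\<^sup>*"
  ultimately show "(x, y) \<in> R\<^sup>*" using assms(1,4) by (metis inj_onD)
next
  assume "(x, y) \<in> R\<^sup>*"
  then show "(b x, b y) \<in> (map_prod b b ` R)\<^sup>*"
  proof induction
    case (step y z)
    then have "(b y, b z) \<in> map_prod b b ` R"
      by (intro image_eqI[of _ _ "(y, z)"]) (simp_all add: step.hyps)
    with step.IH show ?case by (rule rtrancl.rtrancl_into_rtrancl)
  qed simp
qed

lemma orbit_join_closed_transfer:
  assumes b: "bij_betw b V W" and S_img: "\<And>g. g \<in> S \<Longrightarrow> g ` V \<subseteq> V"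
    and forth: "\<And>g. g \<in> S \<Longrightarrow> \<exists>g'\<in>S'. \<forall>x\<in>V. b (g x) = g' (b x)"
    and conv: "\<And>g'. g' \<in> S' \<Longrightarrow> \<exists>g\<in>S. \<forall>x\<in>V. b (g x) = g' (b x)"
    and S: "orbit_join_closed V S"
  shows "orbit_join_closed W S'"
  unfolding orbit_join_closed_def
proof (intro ballI)
  have inj: "inj_on b V" and W: "W = b ` V" using b by (auto simp: bij_betw_def)
  have step: "step W g' = map_prod b b ` step V g" if "\<forall>x\<in>V. b (g x) = g' (b x)" for g g'
  proof -
    have "step W g' = (\<lambda>x. (b x, b (g x))) ` V" using that by (auto simp: step_def W)
    also have "\<dots> = map_prod b b ` (\<lambda>x. (x, g x)) ` V" by (simp add: image_image)
    also have "(\<lambda>x. (x, g x)) ` V = step V g" by (auto simp: step_def)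
    finally show ?thesis .
  qed
  fix g' h' assume "g' \<in> S'" "h' \<in> S'"
  obtain g where g: "g \<in> S" "\<forall>x\<in>V. b (g x) = g' (b x)" using conv[OF \<open>g' \<in> S'\<close>] ..
  obtain h where h: "h \<in> S" "\<forall>x\<in>V. b (h x) = h' (b x)" using conv[OF \<open>h' \<in> S'\<close>] ..
  obtain k where k: "k \<in> S" "same_orbits V k g h"
    using S g(1) h(1) unfolding orbit_join_closed_def by blast
  obtain k' where k': "k' \<in> S'" "\<forall>x\<in>V. b (k x) = k' (b x)" using forth k(1) by blast
  have sub: "step V f \<subseteq> V \<times> V" if "f \<in> S" for f using S_img[OF that] by (rule step_subset)
  \<comment> \<open>The closures are relations on the whole type; apart from reflexive pairs they
    live inside \<open>W\<close>, where \<open>rtrancl_image_iff\<close> applies.\<close>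
  have iff: "(u, v) \<in> (map_prod b b ` R)\<^sup>* \<longleftrightarrow> u = v \<or> (\<exists>x\<in>V. \<exists>y\<in>V. u = b x \<and> v = b y \<and> (x, y) \<in> R\<^sup>*)"
    if R: "R \<subseteq> V \<times> V" for u v R
  proof -
    have "u \<in> W \<and> v \<in> W" if "(u, v) \<in> (map_prod b b ` R)\<^sup>*" "u \<noteq> v"
    proof -
      have "map_prod b b ` R \<subseteq> W \<times> W" using R W by auto
      then have "(map_prod b b ` R)\<^sup>+ \<subseteq> W \<times> W" by (rule trancl_subset_Sigma)
      then show ?thesis using that by (auto simp: rtrancl_eq_or_trancl)
    qed
    moreover have "(u, v) \<in> (map_prod b b ` R)\<^sup>* \<longleftrightarrow> (\<exists>x\<in>V. \<exists>y\<in>V. u = b x \<and> v = b y \<and> (x, y) \<in> R\<^sup>*)"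
      if uv: "u \<in> W" "v \<in> W"
    proof -
      obtain x y where xy: "x \<in> V" "u = b x" "y \<in> V" "v = b y" using uv W by blast
      have "(\<exists>x'\<in>V. \<exists>y'\<in>V. u = b x' \<and> v = b y' \<and> (x', y') \<in> R\<^sup>*) \<longleftrightarrow> (x, y) \<in> R\<^sup>*"
        unfolding xy(2,4) using xy(1,3) inj_onD[OF inj] by blast
      then show ?thesis using rtrancl_image_iff[OF inj R xy(1,3)] xy(2,4) by simp
    qed
    ultimately show ?thesis using W by blast
  qed
  have "step V g \<union> step V h \<subseteq> V \<times> V" using sub g(1) h(1) by blast
  then have "(u, v) \<in> (map_prod b b ` step V k)\<^sup>* \<longleftrightarrow>
      (u, v) \<in> (map_prod b b ` (step V g \<union> step V h))\<^sup>*" for u v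
    by (simp only: iff sub[OF k(1)] k(2))
  then have "(map_prod b b ` step V k)\<^sup>* = (map_prod b b ` (step V g \<union> step V h))\<^sup>*"
    by (simp add: set_eq_iff split_paired_all)
  then have "(step W k')\<^sup>* = (step W g' \<union> step W h')\<^sup>*"
    using step k'(2) g(2) h(2) by (simp add: image_Un)
  then show "\<exists>k\<in>S'. (step W k)\<^sup>* = (step W g' \<union> step W h')\<^sup>*" using k'(1) by blast
qed

text \<open>The last three hypotheses say that \<open>k\<close> generates the group generated by \<open>g\<close> and \<open>h\<close>.\<close>

lemma rtrancl_step_eq_Un:
  assumes V: "finite V" and gh: "g \<in> Bij V" "h \<in> Bij V"
    and "\<And>x. x \<in> V \<Longrightarrow> g x = (k ^^ i) x" "\<And>x. x \<in> V \<Longrightarrow> h x = (k ^^ j) x"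
    and "\<And>x. x \<in> V \<Longrightarrow> k x = (g ^^ ia) ((h ^^ jb) x)"
  shows "same_orbits V k g h"
proof
  have g_img: "g ` V \<subseteq> V" and h_img: "h ` V \<subseteq> V" using gh by (auto dest: BijD)
  have k_img: "k ` V \<subseteq> V" using assms(6) funpow_closed[OF g_img] funpow_closed[OF h_img] by auto
  show "(step V k)\<^sup>* \<subseteq> (step V g \<union> step V h)\<^sup>*"
  proof (rule rtrancl_subset_rtrancl, rule subrelI)
    fix x y assume "(x, y) \<in> step V k"
    then have x: "x \<in> V" "y = (g ^^ ia) ((h ^^ jb) x)" using assms(6) by (auto simp: step_iff)
    have "(x, (h ^^ jb) x) \<in> (step V h)\<^sup>*" using rtrancl_step[OF h_img x(1)] by blast
    moreover have "((h ^^ jb) x, y) \<in> (step V g)\<^sup>*"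
      using rtrancl_step[OF g_img funpow_closed[OF h_img x(1)]] x(2) by blast
    ultimately show "(x, y) \<in> (step V g \<union> step V h)\<^sup>*"
      by (meson Un_upper1 Un_upper2 rtrancl_mono rtrancl_trans subsetD)
  qed
  have "step V g \<subseteq> (step V k)\<^sup>*" "step V h \<subseteq> (step V k)\<^sup>*"
    using rtrancl_step[OF k_img] assms(4,5) by (auto simp: step_iff)
  then show "(step V g \<union> step V h)\<^sup>* \<subseteq> (step V k)\<^sup>*" by (simp add: rtrancl_subset_rtrancl)
qed

section \<open>Products and isomorphisms of actions\<close>

lemma funpow_cong_period:
  assumes "(f ^^ m) x = x" "[i = j] (mod m)"
  shows "(f ^^ i) x = (f ^^ j) x"
  using assms funpow_mod_eq[of m f x] by (metis cong_def)

lemma product_action_apply: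
  "x \<in> PiE I D \<Longrightarrow> i \<in> I \<Longrightarrow> product_action I D g x i = g i (x i)"
  by (simp add: product_action_def)

lemma product_action_closed:
  assumes "\<And>i. i \<in> I \<Longrightarrow> g i ` D i \<subseteq> D i"
  shows "product_action I D g ` PiE I D \<subseteq> PiE I D"
proof
  fix y assume "y \<in> product_action I D g ` PiE I D"
  then obtain x where x: "x \<in> PiE I D" "y = (\<lambda>i\<in>I. g i (x i))"
    by (auto simp: product_action_def)
  then show "y \<in> PiE I D" using assms by (auto simp: PiE_iff)
qed

lemma funpow_product_action:
  assumes "\<And>i. i \<in> I \<Longrightarrow> g i ` D i \<subseteq> D i" "x \<in> PiE I D" "i \<in> I"
  shows "(product_action I D g ^^ k) x i = (g i ^^ k) (x i)"
proof (induction k)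
  case (Suc k)
  have "(product_action I D g ^^ k) x \<in> PiE I D"
    using product_action_closed[of I g D, OF assms(1)] assms(2) by (rule funpow_closed)
  then show ?case using Suc assms(3) by (simp add: product_action_apply)
qed simp

locale coprime_perm_groups =
  fixes I :: "'i set" and D :: "'i \<Rightarrow> 'a set" and H :: "'i \<Rightarrow> ('a \<Rightarrow> 'a) set"
  assumes finite_I: "finite I"
    and sub: "i \<in> I \<Longrightarrow> subgroup (H i) (BijGroup (D i))"
    and coprime_orders: "i \<in> I \<Longrightarrow> j \<in> I \<Longrightarrow> i \<noteq> j \<Longrightarrow>
      coprime (Coset.order (perm_group (D i) (H i))) (Coset.order (perm_group (D j) (H j)))"
begin

abbreviation "E \<equiv> PiE I D"

lemma image_subset: "i \<in> I \<Longrightarrow> g \<in> H i \<Longrightarrow> g ` D i \<subseteq> D i"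
  using subgroup_subset_Bij[OF sub] by (auto dest: BijD)

lemma product_image_subset: "g \<in> PiE I H \<Longrightarrow> product_action I D g ` E \<subseteq> E"
  by (intro product_action_closed image_subset) auto

text \<open>The Chinese remainder theorem on the group orders: a single exponent agrees with a
  prescribed one in every component.\<close>

lemma simultaneous_power:
  assumes g: "g \<in> PiE I H"
  shows "\<exists>k. \<forall>i\<in>I. \<forall>x\<in>D i. (g i ^^ k) x = (g i ^^ j i) x"
proof -
  obtain k where k: "\<forall>i\<in>I. [k = j i] (mod Coset.order (perm_group (D i) (H i)))"
    using chinese_remainder_nat[of I "\<lambda>i. Coset.order (perm_group (D i) (H i))" j]
      finite_I coprime_orders by blast
  have "(g i ^^ k) x = (g i ^^ j i) x" if "i \<in> I" "x \<in> D i" for i x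
    using funpow_order_perm_group[OF sub[OF that(1)] _ that(2)] g that(1) k
    by (intro funpow_cong_period) auto
  then show ?thesis by blast
qed

lemma rtrancl_step_product:
  assumes g: "g \<in> PiE I H" and xy: "x \<in> E" "y \<in> E"
    and rel: "\<And>i. i \<in> I \<Longrightarrow> (x i, y i) \<in> (step (D i) (g i))\<^sup>*"
  shows "(x, y) \<in> (step E (product_action I D g))\<^sup>*"
proof -
  have gD: "g i ` D i \<subseteq> D i" if "i \<in> I" for i
    using image_subset that g by auto
  have "\<exists>j. y i = (g i ^^ j) (x i)" if "i \<in> I" for i
    using rel[OF that] rtrancl_step[OF gD[OF that], of "x i"] xy(1) that by auto
  then obtain j where j: "\<And>i. i \<in> I \<Longrightarrow> y i = (g i ^^ j i) (x i)" by metis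
  obtain k where k: "\<forall>i\<in>I. \<forall>x\<in>D i. (g i ^^ k) x = (g i ^^ j i) x"
    using simultaneous_power[OF g] by blast
  have "y = (product_action I D g ^^ k) x"
  proof (rule PiE_ext[OF xy(2)])
    show "(product_action I D g ^^ k) x \<in> E"
      using funpow_closed[OF product_image_subset[OF g] xy(1)] .
    show "y i = (product_action I D g ^^ k) x i" if "i \<in> I" for i
      using funpow_product_action[of I g D x i k] gD xy(1) that j k by (auto simp: PiE_iff)
  qed
  then show ?thesis using rtrancl_step[OF product_image_subset[OF g] xy(1)] by blast
qed

text \<open>From right to left, \<open>x\<close> is changed into \<open>y\<close> one coordinate at
  a time. By \<open>rtrancl_step_product\<close> a step in one component can be performed while all
  others stay fixed, each of them being related to itself by zero steps.\<close>

lemma rtrancl_step_Un_product: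
  assumes g: "g \<in> PiE I H" and h: "h \<in> PiE I H" and xy: "x \<in> E" "y \<in> E"
  shows "(x, y) \<in> (step E (product_action I D g) \<union> step E (product_action I D h))\<^sup>* \<longleftrightarrow>
    (\<forall>i\<in>I. (x i, y i) \<in> (step (D i) (g i) \<union> step (D i) (h i))\<^sup>*)"
    (is "_ \<in> ?R\<^sup>* \<longleftrightarrow> (\<forall>i\<in>I. _ \<in> (?r i)\<^sup>*)")
proof
  assume "(x, y) \<in> ?R\<^sup>*"
  then show "\<forall>i\<in>I. (x i, y i) \<in> (?r i)\<^sup>*"
  proof induction
    case (step y z)
    have "(y i, z i) \<in> ?r i" if "i \<in> I" for i
      using step.hyps(2) that by (auto simp: step_iff product_action_apply PiE_iff)
    then show ?case using step.IH by (meson rtrancl.rtrancl_into_rtrancl)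
  qed simp
next
  assume rel: "\<forall>i\<in>I. (x i, y i) \<in> (?r i)\<^sup>*"
  have r_sub: "?r i \<subseteq> D i \<times> D i" if "i \<in> I" for i
    using step_subset[OF image_subset[OF that]] g h that by (simp add: PiE_iff)
  have upd: "u(i := v) \<in> E" if "u \<in> E" "i \<in> I" "v \<in> D i" for u i v
    using that by (auto simp: PiE_iff extensional_def)
  have move1: "(u(i := v), u(i := w)) \<in> (step E (product_action I D f))\<^sup>*"
    if "f \<in> PiE I H" "u \<in> E" "i \<in> I" "(v, w) \<in> step (D i) (f i)" for f u i v w
  proof (rule rtrancl_step_product[OF that(1)])
    have "v \<in> D i" "w \<in> D i"
      using that(4) step_subset[OF image_subset[OF that(3)]] that(1,3) by (auto simp: PiE_iff)
    then show "u(i := v) \<in> E" "u(i := w) \<in> E" using upd that(2,3) by auto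
    show "((u(i := v)) l, (u(i := w)) l) \<in> (step (D l) (f l))\<^sup>*" for l
      using that(4) by auto
  qed
  have move: "(u, u(i := v)) \<in> ?R\<^sup>*" if u: "u \<in> E" "i \<in> I" and "(u i, v) \<in> (?r i)\<^sup>*" for u i v
    using that(3)
  proof induction
    case (step v w)
    have "(u(i := v), u(i := w)) \<in> ?R\<^sup>*"
      using step.hyps(2) move1[OF g u] move1[OF h u]
      by (meson UnE Un_upper1 Un_upper2 rtrancl_mono subsetD)
    then show ?case using step.IH by (rule rtrancl_trans[rotated])
  qed simp
  have "(x, \<lambda>i. if i \<in> F then y i else x i) \<in> ?R\<^sup>*" if "F \<subseteq> I" for F
    using finite_subset[OF that finite_I] that
  proof (induction F rule: finite_induct)
    case (insert i F)
    let ?u = "\<lambda>i. if i \<in> F then y i else x i"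
    have "?u \<in> E" using xy by (auto simp: PiE_iff extensional_def)
    moreover have "(?u i, y i) \<in> (?r i)\<^sup>*" using rel insert.prems insert.hyps by simp
    ultimately have "(?u, ?u(i := y i)) \<in> ?R\<^sup>*" using move insert.prems by blast
    moreover have "?u(i := y i) = (\<lambda>l. if l \<in> insert i F then y l else x l)" by auto
    ultimately show ?case using insert by (metis (no_types, lifting) insert_subset rtrancl_trans)
  qed simp
  then have "(x, \<lambda>i. if i \<in> I then y i else x i) \<in> ?R\<^sup>*" by simp
  moreover have "(\<lambda>i. if i \<in> I then y i else x i) = y"
    using xy by (auto simp: PiE_iff extensional_def)
  ultimately show "(x, y) \<in> ?R\<^sup>*" by simp
qed

lemma orbit_join_closed_product:
  assumes "\<And>i. i \<in> I \<Longrightarrow> orbit_join_closed (D i) (H i)"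
  shows "orbit_join_closed E (product_action I D ` PiE I H)"
proof -
  have "\<exists>k\<in>PiE I H. (step E (product_action I D k))\<^sup>* =
      (step E (product_action I D g) \<union> step E (product_action I D h))\<^sup>*"
    if g: "g \<in> PiE I H" and h: "h \<in> PiE I H" for g h
  proof -
    have "\<exists>k\<in>H i. (step (D i) k)\<^sup>* = (step (D i) (g i) \<union> step (D i) (h i))\<^sup>*" if "i \<in> I" for i
    proof -
      have "g i \<in> H i" "h i \<in> H i" using g h that by auto
      then show ?thesis using assms[OF that] unfolding orbit_join_closed_def by blast
    qed
    then obtain k where k: "\<And>i. i \<in> I \<Longrightarrow> k i \<in> H i \<and>
        (step (D i) (k i))\<^sup>* = (step (D i) (g i) \<union> step (D i) (h i))\<^sup>*"
      by metis
    let ?k = "restrict k I" and ?R = "step E (product_action I D g) \<union> step E (product_action I D h)"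
    have kH: "?k \<in> PiE I H" using k by auto
    have on_E: "(x, y) \<in> (step E (product_action I D ?k))\<^sup>* \<longleftrightarrow> (x, y) \<in> ?R\<^sup>*"
      if "x \<in> E" "y \<in> E" for x y
      using rtrancl_step_Un_product[OF kH kH that] rtrancl_step_Un_product[OF g h that] k by simp
    have E: "step E (product_action I D f) \<subseteq> E \<times> E" if "f \<in> PiE I H" for f
      using product_image_subset[OF that] by (rule step_subset)
    then have RE: "?R \<subseteq> E \<times> E" using g h by blast
    have "(x, y) \<in> S\<^sup>* \<longleftrightarrow> x = y \<or> x \<in> E \<and> y \<in> E \<and> (x, y) \<in> S\<^sup>*" if "S \<subseteq> E \<times> E" for S x y
      using trancl_subset_Sigma[OF that] by (auto simp: rtrancl_eq_or_trancl)
    then have "(x, y) \<in> (step E (product_action I D ?k))\<^sup>* \<longleftrightarrow> (x, y) \<in> ?R\<^sup>*" for x y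
      using E[OF kH] RE on_E by metis
    then have "(step E (product_action I D ?k))\<^sup>* = ?R\<^sup>*" by (simp add: set_eq_iff split_paired_all)
    then show ?thesis using kH by blast
  qed
  then show ?thesis unfolding orbit_join_closed_def by blast
qed

end

section \<open>Isomorphisms of faithful actions\<close>

text \<open>A faithful action of a structure that need not be a group.\<close>

definition faithful_by ::
  "('g, 'm) monoid_scheme \<Rightarrow> 'a set \<Rightarrow> ('g \<Rightarrow> 'a \<Rightarrow> 'a) \<Rightarrow> bool"
  where "faithful_by G V \<phi> \<longleftrightarrow>
    (\<forall>g\<in>carrier G. \<phi> g ` V \<subseteq> V) \<and>
    (\<forall>g\<in>carrier G. \<forall>h\<in>carrier G. g \<otimes>\<^bsub>G\<^esub> h \<in> carrier G \<and>
      (\<forall>x\<in>V. \<phi> (g \<otimes>\<^bsub>G\<^esub> h) x = \<phi> g (\<phi> h x))) \<and>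
    (\<forall>g\<in>carrier G. \<forall>h\<in>carrier G. (\<forall>x\<in>V. \<phi> g x = \<phi> h x) \<longrightarrow> g = h)"

lemma faithful_byD:
  assumes "faithful_by G V \<phi>" "g \<in> carrier G" "h \<in> carrier G"
  shows "g \<otimes>\<^bsub>G\<^esub> h \<in> carrier G" "x \<in> V \<Longrightarrow> \<phi> (g \<otimes>\<^bsub>G\<^esub> h) x = \<phi> g (\<phi> h x)"
    "x \<in> V \<Longrightarrow> \<phi> g x \<in> V" "(\<And>x. x \<in> V \<Longrightarrow> \<phi> g x = \<phi> h x) \<Longrightarrow> g = h"
  using assms unfolding faithful_by_def by blast+

text \<open>Faithfulness makes the counterpart of each element unique, so that the map
  \<open>f\<close> picked by \<open>forth\<close> is automatically multiplicative and bijective.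
  Only the correspondence of maps on points has to be supplied.\<close>

lemma action_isomorphicI:
  assumes G: "faithful_by G V \<phi>" and H: "faithful_by H W \<psi>" and b: "bij_betw b V W"
    and forth: "\<And>g. g \<in> carrier G \<Longrightarrow> \<exists>h\<in>carrier H. \<forall>x\<in>V. b (\<phi> g x) = \<psi> h (b x)"
    and conv: "\<And>h. h \<in> carrier H \<Longrightarrow> \<exists>g\<in>carrier G. \<forall>x\<in>V. b (\<phi> g x) = \<psi> h (b x)"
  shows "action_isomorphic G V \<phi> H W \<psi>"
proof -
  have inj: "inj_on b V" and W: "W = b ` V" using b by (auto simp: bij_betw_def)
  obtain f where f: "\<And>g. g \<in> carrier G \<Longrightarrow> f g \<in> carrier H"
      "\<And>g x. g \<in> carrier G \<Longrightarrow> x \<in> V \<Longrightarrow> b (\<phi> g x) = \<psi> (f g) (b x)"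
    using forth by metis
  have f_eq: "f g = h" if "g \<in> carrier G" "h \<in> carrier H" "\<forall>x\<in>V. b (\<phi> g x) = \<psi> h (b x)" for g h
  proof (rule faithful_byD(4)[OF H f(1)[OF that(1)] that(2)])
    show "\<psi> (f g) y = \<psi> h y" if "y \<in> W" for y
      using that f(2)[OF \<open>g \<in> carrier G\<close>] \<open>\<forall>x\<in>V. b (\<phi> g x) = \<psi> h (b x)\<close> by (auto simp: W)
  qed
  have "f (g \<otimes>\<^bsub>G\<^esub> g') = f g \<otimes>\<^bsub>H\<^esub> f g'" if g: "g \<in> carrier G" and g': "g' \<in> carrier G" for g g'
  proof (rule f_eq)
    show "g \<otimes>\<^bsub>G\<^esub> g' \<in> carrier G" "f g \<otimes>\<^bsub>H\<^esub> f g' \<in> carrier H"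
      using faithful_byD(1)[OF G g g'] faithful_byD(1)[OF H f(1)[OF g] f(1)[OF g']] by auto
    show "\<forall>x\<in>V. b (\<phi> (g \<otimes>\<^bsub>G\<^esub> g') x) = \<psi> (f g \<otimes>\<^bsub>H\<^esub> f g') (b x)"
    proof
      fix x assume x: "x \<in> V"
      then have "b (\<phi> (g \<otimes>\<^bsub>G\<^esub> g') x) = \<psi> (f g) (b (\<phi> g' x))"
        using f(2)[OF g] faithful_byD(2)[OF G g g'] faithful_byD(3)[OF G g' g'] by simp
      also have "\<dots> = \<psi> (f g) (\<psi> (f g') (b x))" using f(2)[OF g' x] by simp
      also have "\<dots> = \<psi> (f g \<otimes>\<^bsub>H\<^esub> f g') (b x)"
        using faithful_byD(2)[OF H f(1)[OF g] f(1)[OF g']] x W by simp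
      finally show "b (\<phi> (g \<otimes>\<^bsub>G\<^esub> g') x) = \<psi> (f g \<otimes>\<^bsub>H\<^esub> f g') (b x)" .
    qed
  qed
  then have hom: "f \<in> hom G H" using f(1) by (auto simp: hom_def)
  have "inj_on f (carrier G)"
  proof (rule inj_onI)
    fix g g' assume g: "g \<in> carrier G" "g' \<in> carrier G" "f g = f g'"
    then have "b (\<phi> g x) = b (\<phi> g' x)" if "x \<in> V" for x
      using f(2) that by metis
    then have "\<phi> g x = \<phi> g' x" if "x \<in> V" for x
      using inj_onD[OF inj] faithful_byD(3)[OF G] g(1,2) that by blast
    then show "g = g'" by (rule faithful_byD(4)[OF G g(1,2)])
  qed
  moreover have "f ` carrier G = carrier H"
  proof (intro equalityI subsetI)
    fix h assume "h \<in> carrier H"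
    then show "h \<in> f ` carrier G" using conv f_eq by (metis imageI)
  qed (use f(1) in blast)
  ultimately have "f \<in> iso G H" using hom by (auto simp: iso_def bij_betw_def)
  then show ?thesis using b f(2) unfolding action_isomorphic_def by blast
qed

lemma orbit_join_closed_iso_iff:
  assumes iso: "action_isomorphic G V \<phi> H W \<psi>" and img: "\<And>g. g \<in> carrier G \<Longrightarrow> \<phi> g ` V \<subseteq> V"
  shows "orbit_join_closed V (\<phi> ` carrier G) \<longleftrightarrow> orbit_join_closed W (\<psi> ` carrier H)"
proof -
  obtain b f where b: "bij_betw b V W" and f: "f \<in> iso G H"
    and eq: "\<And>g x. g \<in> carrier G \<Longrightarrow> x \<in> V \<Longrightarrow> b (\<phi> g x) = \<psi> (f g) (b x)"
    using iso unfolding action_isomorphic_def by blast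
  define c where "c = inv_into V b"
  have c: "bij_betw c W V" using b by (simp add: c_def bij_betw_inv_into)
  have cb: "c (b x) = x" if "x \<in> V" for x
    using b that by (simp add: c_def bij_betw_inv_into_left)
  have bc: "b (c y) = y" "c y \<in> V" if "y \<in> W" for y
    using b c that by (auto simp: c_def bij_betw_inv_into_right bij_betw_def)
  have fG: "carrier H = f ` carrier G" using f by (auto simp: iso_def bij_betw_def)
  have eq': "c (\<psi> (f g) y) = \<phi> g (c y)" if "g \<in> carrier G" "y \<in> W" for g y
  proof -
    have "\<phi> g (c y) \<in> V" using img[OF that(1)] bc(2)[OF that(2)] by blast
    moreover have "\<psi> (f g) y = b (\<phi> g (c y))"
      using eq[OF that(1) bc(2)[OF that(2)]] bc(1)[OF that(2)] by simp
    ultimately show ?thesis using cb by simp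
  qed
  have img': "\<psi> h ` W \<subseteq> W" if h: "h \<in> carrier H" for h
  proof
    fix z assume "z \<in> \<psi> h ` W"
    then obtain y where y: "y \<in> W" "z = \<psi> h y" by blast
    obtain g where g: "g \<in> carrier G" "h = f g" using h fG by blast
    have "z = b (\<phi> g (c y))" using eq[OF g(1) bc(2)[OF y(1)]] bc[OF y(1)] g y by simp
    moreover have "\<phi> g (c y) \<in> V" using img[OF g(1)] bc(2)[OF y(1)] by blast
    ultimately show "z \<in> W" using b by (auto simp: bij_betw_def)
  qed
  show ?thesis
  proof
    show "orbit_join_closed W (\<psi> ` carrier H)" if "orbit_join_closed V (\<phi> ` carrier G)"
    proof (rule orbit_join_closed_transfer[OF b _ _ _ that])
      show "g ` V \<subseteq> V" if "g \<in> \<phi> ` carrier G" for g using that img by blast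
      show "\<exists>g'\<in>\<psi> ` carrier H. \<forall>x\<in>V. b (g x) = g' (b x)" if "g \<in> \<phi> ` carrier G" for g
        using that eq unfolding fG by blast
      show "\<exists>g\<in>\<phi> ` carrier G. \<forall>x\<in>V. b (g x) = g' (b x)" if "g' \<in> \<psi> ` carrier H" for g'
        using that eq unfolding fG by blast
    qed
    show "orbit_join_closed V (\<phi> ` carrier G)" if "orbit_join_closed W (\<psi> ` carrier H)"
    proof (rule orbit_join_closed_transfer[OF c _ _ _ that])
      show "h ` W \<subseteq> W" if "h \<in> \<psi> ` carrier H" for h using that img' by blast
      show "\<exists>g\<in>\<phi> ` carrier G. \<forall>y\<in>W. c (h y) = g (c y)" if "h \<in> \<psi> ` carrier H" for h
        using that eq' unfolding fG by blast
      show "\<exists>h\<in>\<psi> ` carrier H. \<forall>y\<in>W. c (h y) = g (c y)" if "g \<in> \<phi> ` carrier G" for g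
        using that eq' unfolding fG by blast
    qed
  qed
qed

lemma faithful_by_perm_group:
  assumes "subgroup S (BijGroup V)"
  shows "faithful_by (perm_group V S) V (\<lambda>g. g)"
proof -
  have S: "S \<subseteq> Bij V" by (rule subgroup_subset_Bij[OF assms])
  have "g \<otimes>\<^bsub>perm_group V S\<^esub> h \<in> S" if "g \<in> S" "h \<in> S" for g h
    using subgroup.m_closed[OF assms that] by (simp add: perm_group_def)
  moreover have "g = h" if "g \<in> S" "h \<in> S" "\<forall>x\<in>V. g x = h x" for g h
    using that S by (intro extensionalityI[of g V h]) (auto simp: Bij_def)
  ultimately show ?thesis
    using S mult_perm_group[OF assms] by (auto simp: faithful_by_def dest: BijD)
qed

lemma faithful_by_product:
  assumes faithful: "\<And>i. i \<in> I \<Longrightarrow> faithful_by (G i) (D i) (\<phi> i)" and ne: "\<And>i. i \<in> I \<Longrightarrow> D i \<noteq> {}"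
  shows "faithful_by (product_group I G) (PiE I D) (\<lambda>g. product_action I D (\<lambda>i. \<phi> i (g i)))"
  unfolding faithful_by_def
proof (intro conjI ballI impI)
  fix g assume g: "g \<in> carrier (product_group I G)"
  have img: "(\<lambda>i. \<phi> i (f i)) i ` D i \<subseteq> D i" if "f \<in> carrier (product_group I G)" "i \<in> I" for i f
    using faithful_byD(3)[OF faithful[OF that(2)]] that by (auto simp: PiE_iff)
  show "product_action I D (\<lambda>i. \<phi> i (g i)) ` PiE I D \<subseteq> PiE I D"
    using img[OF g] by (intro product_action_closed)
  fix h assume h: "h \<in> carrier (product_group I G)"
  have comp: "g i \<in> carrier (G i)" "h i \<in> carrier (G i)" if "i \<in> I" for i
    using g h that by auto
  show "g \<otimes>\<^bsub>product_group I G\<^esub> h \<in> carrier (product_group I G)"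
    using faithful_byD(1)[OF faithful] comp by simp
  show "product_action I D (\<lambda>i. \<phi> i ((g \<otimes>\<^bsub>product_group I G\<^esub> h) i)) x =
      product_action I D (\<lambda>i. \<phi> i (g i)) (product_action I D (\<lambda>i. \<phi> i (h i)) x)"
    if x: "x \<in> PiE I D" for x
  proof -
    have "product_action I D (\<lambda>i. \<phi> i (h i)) x \<in> PiE I D"
      using product_action_closed[of I "\<lambda>i. \<phi> i (h i)" D] img[OF h] x by blast
    then show ?thesis
      using x faithful_byD(2)[OF faithful comp] by (auto simp: product_action_def PiE_iff fun_eq_iff)
  qed
  assume eq: "\<forall>x\<in>PiE I D. product_action I D (\<lambda>i. \<phi> i (g i)) x = product_action I D (\<lambda>i. \<phi> i (h i)) x"
  show "g = h"
  proof (rule PiE_ext)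
    show "g \<in> (\<Pi>\<^sub>E i\<in>I. carrier (G i))" "h \<in> (\<Pi>\<^sub>E i\<in>I. carrier (G i))" using g h by auto
    fix i assume i: "i \<in> I"
    show "g i = h i"
    proof (rule faithful_byD(4)[OF faithful[OF i] comp(1)[OF i] comp(2)[OF i]])
      fix z assume z: "z \<in> D i"
      \<comment> \<open>A point \<open>z\<close> of one component is tested by placing it into an
        arbitrary tuple, which exists as all components are nonempty.\<close>
      obtain y where y: "y \<in> PiE I D" using ne by (metis PiE_eq_empty_iff ex_in_conv)
      then have "y(i := z) \<in> PiE I D" using i z by (auto simp: PiE_iff extensional_def)
      then show "\<phi> i (g i) z = \<phi> i (h i) z"
        using bspec[OF eq] product_action_apply[OF _ i, of "y(i := z)" D] by (metis fun_upd_same)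
    qed
  qed
qed

section \<open>Affine groups in cyclic coordinates\<close>

text \<open>Closure under inverses follows from finiteness: the inverse of \<open>g\<close> is its
  power with exponent one less than the group order.\<close>

lemma subgroup_BijGroupI:
  assumes fin: "finite V" and S: "S \<subseteq> Bij V" and one: "(\<lambda>x\<in>V. x) \<in> S"
    and comp: "\<And>g h. g \<in> S \<Longrightarrow> h \<in> S \<Longrightarrow> compose V g h \<in> S"
  shows "subgroup S (BijGroup V)"
proof -
  interpret group "BijGroup V" by (rule group_BijGroup)
  have carr: "carrier (BijGroup V) = Bij V" by (simp add: BijGroup_def)
  have mult: "g \<otimes>\<^bsub>BijGroup V\<^esub> h \<in> S" if "g \<in> S" "h \<in> S" for g h
    using that S comp by (auto simp: BijGroup_def)
  have pow: "g [^]\<^bsub>BijGroup V\<^esub> (k::nat) \<in> S" if "g \<in> S" for g k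
  proof (induction k)
    case 0
    have "\<one>\<^bsub>BijGroup V\<^esub> \<in> S" unfolding BijGroup_def using one by simp
    then show ?case by simp
  next
    case (Suc k)
    then show ?case using mult[OF Suc that] by simp
  qed
  show ?thesis
  proof (rule subgroupI)
    fix g assume g: "g \<in> S"
    then have gc: "g \<in> carrier (BijGroup V)" using S carr by auto
    let ?N = "Coset.order (BijGroup V)"
    have "?N > 0" using finite_Bij[OF fin] carr order_gt_0_iff_finite by simp
    then have "g [^]\<^bsub>BijGroup V\<^esub> (?N - 1) \<otimes>\<^bsub>BijGroup V\<^esub> g = \<one>\<^bsub>BijGroup V\<^esub>"
      using pow_order_eq_1[OF gc] by (metis Suc_diff_1 nat_pow_Suc)
    then have "inv\<^bsub>BijGroup V\<^esub> g = g [^]\<^bsub>BijGroup V\<^esub> (?N - 1)"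
      using gc by (intro inv_equality) auto
    then show "inv\<^bsub>BijGroup V\<^esub> g \<in> S" using pow[OF g] by simp
  qed (use S one mult carr in auto)
qed

text \<open>\<open>A\<close> may be any set of integers. The condition \<open>g \<in> Bij V\<close>
  retains only the multipliers that are units, so \<open>A = UNIV\<close> gives the full affine
  group, and only residues of \<open>A\<close> matter.\<close>

definition affine_group :: "'a set \<Rightarrow> (int \<Rightarrow> 'a) \<Rightarrow> int set \<Rightarrow> ('a \<Rightarrow> 'a) set"
  where "affine_group V e A = {g \<in> Bij V. \<exists>s\<in>A. \<exists>b. \<forall>x. g (e x) = e (s * x + b)}"

text \<open>Points are numbered by all integers with period \<open>m\<close> instead of by residues,
  so affine formulas are written without reduction and can be compared modulo every divisor of
  \<open>m\<close>.\<close>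

locale cyclic_coords =
  fixes V :: "'a set" and e :: "int \<Rightarrow> 'a" and m :: nat
  assumes m_pos: "m > 0" and range_e: "range e = V"
    and e_eq_iff: "e x = e y \<longleftrightarrow> [x = y] (mod int m)"
begin

lemma e_in: "e x \<in> V" using range_e by auto

lemma ex_coordinate: "y \<in> V \<Longrightarrow> \<exists>x. y = e x" using range_e by auto

lemma bij_betw_residues: "bij_betw e {0..<int m} V"
  unfolding bij_betw_def
proof
  show "inj_on e {0..<int m}"
    by (rule inj_onI) (auto simp: e_eq_iff cong_def)
  have "e x \<in> e ` {0..<int m}" for x
    using m_pos by (intro image_eqI[of _ _ "x mod int m"]) (auto simp: e_eq_iff)
  then show "e ` {0..<int m} = V" using range_e by auto
qed

lemma finite_space: "finite V" and card_space: "card V = m"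
  using bij_betw_finite[OF bij_betw_residues] bij_betw_same_card[OF bij_betw_residues] by auto

lemma ex_affine:
  assumes "coprime s (int m)"
  shows "\<exists>g\<in>Bij V. \<forall>x. g (e x) = e (s * x + b)"
proof -
  define g where "g = (\<lambda>y\<in>V. e (s * inv_into UNIV e y + b))"
  have g: "g (e x) = e (s * x + b)" for x
  proof -
    have "e (inv_into UNIV e (e x)) = e x" by (simp add: f_inv_into_f)
    then show ?thesis by (simp add: g_def e_in e_eq_iff cong_add cong_scalar_left)
  qed
  have img: "g ` V \<subseteq> V" using ex_coordinate e_in g by fastforce
  moreover have "inj_on g V"
  proof (rule inj_onI)
    fix y z assume "y \<in> V" "z \<in> V" "g y = g z"
    then obtain u v where uv: "y = e u" "z = e v" "[s * u + b = s * v + b] (mod int m)"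
      using ex_coordinate g e_eq_iff by metis
    then have "[u = v] (mod int m)"
      using assms by (simp add: cong_add_rcancel cong_mult_lcancel)
    then show "y = z" using uv e_eq_iff by simp
  qed
  ultimately have "bij_betw g V V"
    using endo_inj_surj[OF finite_space] by (simp add: bij_betw_def)
  then have "g \<in> Bij V" by (simp add: Bij_def g_def)
  with g show ?thesis by blast
qed

lemma ex_affine_group:
  assumes "s \<in> A" "coprime s (int m)"
  shows "\<exists>g\<in>affine_group V e A. \<forall>x. g (e x) = e (s * x + b)"
  using ex_affine[OF assms(2), of b] assms(1) by (auto simp: affine_group_def)

text \<open>Multiplication by \<open>s\<close> identifies 0 with the quotient of \<open>m\<close> by
  \<open>gcd s m\<close>, so injectivity forces the gcd to be 1.\<close>

lemma coprime_multiplier: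
  assumes g: "g \<in> Bij V" "\<And>x. g (e x) = e (s * x + b)"
  shows "coprime s (int m)"
proof -
  obtain m' where m': "int m = gcd s (int m) * m'" by (meson dvdE gcd_dvd2)
  obtain s' where s': "s = gcd s (int m) * s'" by (meson dvdE gcd_dvd1)
  have "s * m' = int m * s'" using m' s' by (metis mult.assoc mult.commute)
  then have "g (e m') = g (e 0)" using g(2) by (simp add: e_eq_iff cong_iff_dvd_diff)
  then have "e m' = e 0" using g(1) e_in by (auto simp: Bij_def bij_betw_def dest: inj_onD)
  then have "int m dvd m'" by (simp add: e_eq_iff cong_iff_dvd_diff)
  then obtain k where "m' = int m * k" by auto
  with m' have "int m * 1 = int m * (gcd s (int m) * k)" by (metis mult.left_commute mult.right_neutral)
  then have "gcd s (int m) * k = 1" using m_pos by simp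
  then have "gcd s (int m) dvd 1" by (metis dvd_triv_left)
  then show ?thesis by (simp add: coprime_iff_gcd_eq_1)
qed

lemma Bij_eqI:
  assumes "g \<in> Bij V" "h \<in> Bij V" "\<And>x. g (e x) = h (e x)"
  shows "g = h"
  using assms ex_coordinate by (intro extensionalityI[of g V h]) (auto simp: Bij_def)

lemma subgroup_affine_group:
  assumes "1 \<in> A" and mult: "\<And>s t. s \<in> A \<Longrightarrow> t \<in> A \<Longrightarrow> s * t \<in> A"
  shows "subgroup (affine_group V e A) (BijGroup V)"
proof (rule subgroup_BijGroupI[OF finite_space])
  show "affine_group V e A \<subseteq> Bij V" by (auto simp: affine_group_def)
  have "\<forall>x. (\<lambda>x\<in>V. x) (e x) = e (1 * x + 0)" by (simp add: e_in)
  then show "(\<lambda>x\<in>V. x) \<in> affine_group V e A"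
    using assms(1) id_Bij unfolding affine_group_def by blast
  fix g h assume "g \<in> affine_group V e A" "h \<in> affine_group V e A"
  then obtain s b t c where g: "g \<in> Bij V" "s \<in> A" "\<forall>x. g (e x) = e (s * x + b)"
    and h: "h \<in> Bij V" "t \<in> A" "\<forall>x. h (e x) = e (t * x + c)"
    by (auto simp: affine_group_def)
  have "\<forall>x. compose V g h (e x) = e ((s * t) * x + (s * c + b))"
    using g h by (simp add: compose_eq e_in algebra_simps)
  then show "compose V g h \<in> affine_group V e A"
    using mult[OF g(2) h(2)] compose_Bij[OF g(1) h(1)] unfolding affine_group_def by blast
qed

lemma funpow_affine:
  assumes "\<And>x. g (e x) = e (t * x + c)"
  shows "(g ^^ j) (e x) = e ((affine t c ^^ j) x)"
  by (induction j) (simp_all add: assms affine_def)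

lemma rtrancl_step_affine:
  assumes "\<And>x. g (e x) = e (t * x + c)"
  shows "(e x, e y) \<in> (step V g)\<^sup>* \<longleftrightarrow> (\<exists>j. [(affine t c ^^ j) x = y] (mod int m))"
proof -
  have "g ` V \<subseteq> V" using ex_coordinate e_in assms by fastforce
  from rtrancl_step[OF this e_in] show ?thesis
    by (simp add: funpow_affine[OF assms] e_eq_iff) (metis cong_sym)
qed

lemma rtrancl_step_multiplier_translation:
  assumes g: "\<And>x. g (e x) = e (s * x)" and h: "\<And>x. h (e x) = e (x + d)" and d: "d dvd int m"
  shows "(e x, e y) \<in> (step V g \<union> step V h)\<^sup>* \<longleftrightarrow> (\<exists>i::nat. [y = s ^ i * x] (mod d))"
    (is "_ \<in> ?R\<^sup>* \<longleftrightarrow> _")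
proof
  have "\<exists>y (i::nat). z = e y \<and> [y = s ^ i * x] (mod d)" if "(e x, z) \<in> ?R\<^sup>*" for z
    using that
  proof induction
    case base
    have "[x = s ^ 0 * x] (mod d)" by simp
    then show ?case by blast
  next
    case (step z w)
    then obtain y i where y: "z = e y" "[y = s ^ i * x] (mod d)" by blast
    consider "w = e (s * y)" | "w = e (y + d)"
      using step.hyps(2) g h y(1) by (auto simp: step_iff)
    then show ?case
    proof cases
      case 1
      have "[s * y = s ^ Suc i * x] (mod d)" using cong_scalar_left[OF y(2), of s] by (simp add: mult.assoc)
      then show ?thesis using 1 by blast
    next
      case 2
      have "[y + d = s ^ i * x] (mod d)" using y(2) by (simp add: cong_def)
      then show ?thesis using 2 by blast
    qed
  qed
  moreover assume "(e x, e y) \<in> ?R\<^sup>*"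
  ultimately obtain y' i where "e y = e y'" "[y' = s ^ i * x] (mod d)" by blast
  then show "\<exists>i::nat. [y = s ^ i * x] (mod d)"
    using cong_dvd_modulus[OF _ d] e_eq_iff by (meson cong_trans)
next
  assume "\<exists>i::nat. [y = s ^ i * x] (mod d)"
  then obtain i where "[y = s ^ i * x] (mod d)" by blast
  then obtain q where q: "y = s ^ i * x + d * q"
    by (metis add.commute cong_iff_dvd_diff diff_add_cancel dvdE)
  have "(e x, e (s ^ i * x)) \<in> ?R\<^sup>*"
  proof (induction i)
    case (Suc i)
    have "(e (s ^ i * x), e (s ^ Suc i * x)) \<in> ?R" by (simp add: step_iff e_in g mult.assoc)
    with Suc show ?case by (rule rtrancl.rtrancl_into_rtrancl)
  qed simp
  moreover have "(e z, e (z + d * int l)) \<in> ?R\<^sup>*" for z l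
  proof (induction l)
    case (Suc l)
    have "(e (z + d * int l), e (z + d * int (Suc l))) \<in> ?R"
      by (simp add: step_iff e_in h algebra_simps)
    with Suc show ?case by (rule rtrancl.rtrancl_into_rtrancl)
  qed simp
  \<comment> \<open>The number \<open>q\<close> of translations by \<open>d\<close> may be negative;
    the period of \<open>e\<close> permits its residue modulo \<open>m\<close> instead.\<close>
  moreover have "e (s ^ i * x + d * int (nat (q mod int m))) = e y"
  proof -
    have "[q mod int m = q] (mod int m)" by simp
    then show ?thesis using m_pos by (simp add: q e_eq_iff cong_add cong_scalar_left)
  qed
  ultimately show "(e x, e y) \<in> ?R\<^sup>*" by (metis rtrancl_trans)
qed

lemma rtrancl_step_multipliers:
  assumes g: "\<And>x. g (e x) = e (u * x)" and h: "\<And>x. h (e x) = e (v * x)"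
  shows "(e x, e y) \<in> (step V g \<union> step V h)\<^sup>* \<longleftrightarrow>
    (\<exists>i j::nat. [y = u ^ i * v ^ j * x] (mod int m))"
    (is "_ \<in> ?R\<^sup>* \<longleftrightarrow> _")
proof
  have "\<exists>i j. z = e (u ^ i * v ^ j * x)" if "(e x, z) \<in> ?R\<^sup>*" for z
    using that
  proof induction
    case base
    have "e x = e (u ^ 0 * v ^ 0 * x)" by simp
    then show ?case by blast
  next
    case (step z w)
    then obtain i j where y: "z = e (u ^ i * v ^ j * x)" by blast
    have "w = e (u ^ Suc i * v ^ j * x) \<or> w = e (u ^ i * v ^ Suc j * x)"
      using step.hyps(2) g h y by (auto simp: step_iff algebra_simps)
    then show ?case by blast
  qed
  moreover assume "(e x, e y) \<in> ?R\<^sup>*"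
  ultimately show "\<exists>i j::nat. [y = u ^ i * v ^ j * x] (mod int m)" using e_eq_iff by blast
next
  assume "\<exists>i j::nat. [y = u ^ i * v ^ j * x] (mod int m)"
  then obtain i j where "e y = e (u ^ i * v ^ j * x)" using e_eq_iff by blast
  moreover have "(e x, e (v ^ j * x)) \<in> ?R\<^sup>*"
  proof (induction j)
    case (Suc j)
    have "(e (v ^ j * x), e (v ^ Suc j * x)) \<in> ?R" by (simp add: step_iff e_in h mult.assoc)
    with Suc show ?case by (rule rtrancl.rtrancl_into_rtrancl)
  qed simp
  moreover have "(e z, e (u ^ i * z)) \<in> ?R\<^sup>*" for z
  proof (induction i)
    case (Suc i)
    have "(e (u ^ i * z), e (u ^ Suc i * z)) \<in> ?R" by (simp add: step_iff e_in g mult.assoc)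
    with Suc show ?case by (rule rtrancl.rtrancl_into_rtrancl)
  qed simp
  ultimately show "(e x, e y) \<in> ?R\<^sup>*" by (metis mult.assoc rtrancl_trans)
qed

lemma join_closed_multipliers:
  assumes one: "1 \<in> A" and A: "\<And>s. s \<in> A \<Longrightarrow> coprime s (int m)"
    and jc: "orbit_join_closed V (affine_group V e A)"
  shows "join_closed_multipliers (int m) A"
proof
  have join: "\<exists>t\<in>A. \<exists>c. \<forall>x y. (\<exists>j. [(affine t c ^^ j) x = y] (mod int m)) \<longleftrightarrow>
      (e x, e y) \<in> (step V g \<union> step V h)\<^sup>*"
    if gh: "g \<in> affine_group V e A" "h \<in> affine_group V e A" for g h
  proof -
    obtain k where k: "k \<in> affine_group V e A" "same_orbits V k g h"
      using jc gh unfolding orbit_join_closed_def by blast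
    obtain t c where t: "t \<in> A" "\<And>x. k (e x) = e (t * x + c)"
      using k(1) by (auto simp: affine_group_def)
    show ?thesis using t(1) rtrancl_step_affine[OF t(2)] k(2) by blast
  qed
  have mul: "\<exists>g\<in>affine_group V e A. \<forall>x. g (e x) = e (s * x)" if "s \<in> A" for s
    using ex_affine_group[OF that A[OF that], of 0] by simp
  show "\<exists>t\<in>A. \<exists>c. affine_orbits (int m) d t c s" if s: "s \<in> A" and d: "d dvd int m" "d > 0" for s d
  proof -
    obtain g where g: "g \<in> affine_group V e A" "\<And>x. g (e x) = e (s * x)" using mul[OF s] by blast
    obtain h where h: "h \<in> affine_group V e A" "\<And>x. h (e x) = e (x + d)"
      using ex_affine_group[OF one A[OF one], of d] by auto
    obtain t c where "t \<in> A" "\<forall>x y. (\<exists>j. [(affine t c ^^ j) x = y] (mod int m)) \<longleftrightarrow>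
        (\<exists>i::nat. [y = s ^ i * x] (mod d))"
      using join[OF g(1) h(1)] rtrancl_step_multiplier_translation[of g s h d, OF g(2) h(2) d(1)] by auto
    then show ?thesis using d unfolding affine_orbits_def by blast
  qed
  show "\<exists>t\<in>A. \<forall>y. (\<exists>j. [t ^ j = y] (mod int m)) \<longleftrightarrow> (\<exists>i j. [y = u ^ i * v ^ j] (mod int m))"
    if u: "u \<in> A" and v: "v \<in> A" for u v
  proof -
    obtain g where g: "g \<in> affine_group V e A" "\<And>x. g (e x) = e (u * x)" using mul[OF u] by blast
    obtain h where h: "h \<in> affine_group V e A" "\<And>x. h (e x) = e (v * x)" using mul[OF v] by blast
    obtain t c where t: "t \<in> A" "\<And>x y. (\<exists>j. [(affine t c ^^ j) x = y] (mod int m)) \<longleftrightarrow>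
        (\<exists>i j::nat. [y = u ^ i * v ^ j * x] (mod int m))"
      using join[OF g(1) h(1)] rtrancl_step_multipliers[of g u h v, OF g(2) h(2)] by auto
    \<comment> \<open>Both multiplications fix 0, so the map realising their join fixes 0 too, and
      its translation part vanishes modulo \<open>m\<close>.\<close>
    have "[(affine t c ^^ 1) 0 = c] (mod int m)" by (simp add: affine_def)
    then have "\<exists>i j::nat. [c = u ^ i * v ^ j * 0] (mod int m)" using t(2) by blast
    then have "int m dvd c" by (simp add: cong_0_iff)
    from funpow_affine_linear[OF this, where t = t and x = 1]
    have "[(affine t c ^^ j) 1 = y] (mod int m) \<longleftrightarrow> [t ^ j = y] (mod int m)" for j y
      by (metis cong_sym cong_trans mult.right_neutral)
    then show ?thesis using t(1) t(2)[of 1] by auto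
  qed
qed

end

section \<open>Change of coordinates and standard models\<close>

lemma coordinate_change:
  assumes "cyclic_coords V e m" "cyclic_coords W e' m"
  shows "\<exists>c. bij_betw c V W \<and> (\<forall>x. c (e x) = e' x)"
proof -
  interpret E: cyclic_coords V e m by fact
  interpret E': cyclic_coords W e' m by fact
  define c where "c y = e' (inv_into UNIV e y)" for y
  have c: "c (e x) = e' x" for x
  proof -
    have "e (inv_into UNIV e (e x)) = e x" by (simp add: f_inv_into_f)
    then show ?thesis by (simp add: c_def E.e_eq_iff E'.e_eq_iff)
  qed
  have "c ` V = W" unfolding E.range_e[symmetric] E'.range_e[symmetric] by (auto simp: c image_iff)
  moreover have "inj_on c V"
    by (rule inj_onI) (metis E.ex_coordinate E.e_eq_iff E'.e_eq_iff c)
  ultimately show ?thesis using c by (auto simp: bij_betw_def)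
qed

lemma affine_group_isomorphic:
  assumes E: "cyclic_coords V e m" and E': "cyclic_coords W e' m"
    and one: "1 \<in> A" and mult: "\<And>s t. s \<in> A \<Longrightarrow> t \<in> A \<Longrightarrow> s * t \<in> A"
  shows "action_isomorphic (perm_group V (affine_group V e A)) V (\<lambda>g. g)
    (perm_group W (affine_group W e' A)) W (\<lambda>g. g)"
proof -
  interpret E: cyclic_coords V e m by fact
  interpret E': cyclic_coords W e' m by fact
  obtain c where c: "bij_betw c V W" "\<And>x. c (e x) = e' x"
    using coordinate_change[OF E E'] by blast
  show ?thesis
  proof (rule action_isomorphicI[OF _ _ c(1)])
    show "faithful_by (perm_group V (affine_group V e A)) V (\<lambda>g. g)"
      using E.subgroup_affine_group[OF one mult] by (rule faithful_by_perm_group)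
    show "faithful_by (perm_group W (affine_group W e' A)) W (\<lambda>g. g)"
      using E'.subgroup_affine_group[OF one mult] by (rule faithful_by_perm_group)
    have match: "\<forall>x\<in>V. c (g x) = h (c x)"
      if "\<forall>x. g (e x) = e (s * x + b)" "\<forall>x. h (e' x) = e' (s * x + b)" for g h s b
      using that c(2) E.ex_coordinate by fastforce
    show "\<exists>h\<in>carrier (perm_group W (affine_group W e' A)). \<forall>x\<in>V. c (g x) = h (c x)"
      if "g \<in> carrier (perm_group V (affine_group V e A))" for g
    proof -
      from that obtain s b where s: "g \<in> Bij V" "s \<in> A" "\<forall>x. g (e x) = e (s * x + b)"
        by (auto simp: affine_group_def)
      then obtain h where "h \<in> affine_group W e' A" "\<forall>x. h (e' x) = e' (s * x + b)"
        using E'.ex_affine_group E.coprime_multiplier by metis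
      then show ?thesis using match[OF s(3)] by auto
    qed
    show "\<exists>g\<in>carrier (perm_group V (affine_group V e A)). \<forall>x\<in>V. c (g x) = h (c x)"
      if "h \<in> carrier (perm_group W (affine_group W e' A))" for h
    proof -
      from that obtain s b where s: "h \<in> Bij W" "s \<in> A" "\<forall>x. h (e' x) = e' (s * x + b)"
        by (auto simp: affine_group_def)
      then obtain g where "g \<in> affine_group V e A" "\<forall>x. g (e x) = e (s * x + b)"
        using E.ex_affine_group E'.coprime_multiplier by metis
      then show ?thesis using match[OF _ s(3)] by auto
    qed
  qed
qed

lemma cyclic_coords_int: "m > 0 \<Longrightarrow> cyclic_coords {0..<int m} (\<lambda>x. x mod int m) m"
proof
  assume m: "m > 0"
  have "y \<in> range (\<lambda>x. x mod int m)" if "y \<in> {0..<int m}" for y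
    using that by (intro image_eqI[of _ _ y]) auto
  then show "range (\<lambda>x. x mod int m) = {0..<int m}" using m by auto
qed (auto simp: cong_def)

text \<open>The factors sought by the classification act on sets of naturals, whereas the model
  groups act on integer residues; hence two standard numberings.\<close>

lemma cyclic_coords_nat: "m > 0 \<Longrightarrow> cyclic_coords {..<m} (\<lambda>x. nat (x mod int m)) m"
proof
  assume m: "m > 0"
  have "y \<in> range (\<lambda>x. nat (x mod int m))" if "y \<in> {..<m}" for y
    using that by (intro image_eqI[of _ _ "int y"]) (auto simp flip: of_nat_mod)
  moreover have "nat (x mod int m) < m" for x
    using m pos_mod_bound[of "int m" x] by (simp add: nat_less_iff)
  ultimately show "range (\<lambda>x. nat (x mod int m)) = {..<m}" by auto
  show "nat (x mod int m) = nat (y mod int m) \<longleftrightarrow> [x = y] (mod int m)" for x y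
    using m by (simp add: cong_def eq_nat_nat_iff)
qed

section \<open>Affine groups over prime fields\<close>

text \<open>Bezout with nonnegative coefficients, as required for exponents: modulo \<open>N\<close>
  the factor \<open>N - 1\<close> stands for \<open>-1\<close>.\<close>

lemma gcd_combination_mod:
  fixes i j N :: nat
  assumes "N > 0"
  shows "\<exists>ia jb. [i * ia + j * jb = gcd i j] (mod N)"
proof (cases "i = 0")
  case True
  then show ?thesis by (intro exI[of _ 0] exI[of _ 1]) simp
next
  case False
  then obtain x y where xy: "i * x = j * y + gcd i j" using bezout_nat by blast
  have "i * x + j * (y * (N - 1)) = gcd i j + j * y * (1 + (N - 1))"
    by (simp add: xy algebra_simps)
  also have "1 + (N - 1) = N" using assms by simp
  finally have "[i * x + j * (y * (N - 1)) = gcd i j] (mod N)" by (simp add: cong_def)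
  then show ?thesis by blast
qed

text \<open>The powers of a generator with exponents \<open>i\<close> and \<open>j\<close> generate
  the same group as its power with exponent \<open>gcd i j\<close>.\<close>

lemma orbit_join_closed_cyclic:
  assumes fin: "finite V" and S: "subgroup S (BijGroup V)" and cyc: "cyclic_group (perm_group V S)"
  shows "orbit_join_closed V S"
proof -
  let ?P = "perm_group V S"
  interpret group ?P using S by (rule group_perm_group)
  have SB: "S \<subseteq> Bij V" using S by (rule subgroup_subset_Bij)
  then have finS: "finite S" using finite_Bij[OF fin] by (rule finite_subset)
  obtain c where c: "c \<in> S" "subgroup_generated ?P {c} = ?P"
    using cyc by (auto simp: cyclic_group_def)
  have "S = carrier (subgroup_generated ?P {c})" using c(2) by simp
  also have "\<dots> = {c [^]\<^bsub>?P\<^esub> k |k. k \<in> (UNIV :: nat set)}"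
    using c(1) finS by (simp add: carrier_subgroup_generated generate_pow_on_finite_carrier)
  finally have S_eq: "S = {c [^]\<^bsub>?P\<^esub> k |k. k \<in> (UNIV :: nat set)}" .
  let ?N = "Coset.order ?P"
  have N: "?N > 0" using finS order_gt_0_iff_finite by simp
  have "\<exists>k\<in>S. same_orbits V k g h" if gh: "g \<in> S" "h \<in> S" for g h
  proof -
    obtain i j :: nat where ij: "g = c [^]\<^bsub>?P\<^esub> i" "h = c [^]\<^bsub>?P\<^esub> j" using gh S_eq by blast
    obtain ia jb where ab: "[i * ia + j * jb = gcd i j] (mod ?N)" using gcd_combination_mod[OF N] by blast
    obtain i' j' where ij': "i = gcd i j * i'" "j = gcd i j * j'" by (metis dvdE gcd_dvd1 gcd_dvd2)
    have g: "g x = (c ^^ i) x" and h: "h x = (c ^^ j) x" if "x \<in> V" for x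
      using nat_pow_perm_group[OF S c(1) that] ij by auto
    let ?k = "c [^]\<^bsub>?P\<^esub> gcd i j"
    have k: "?k x = (c ^^ gcd i j) x" if "x \<in> V" for x
      using nat_pow_perm_group[OF S c(1) that] by auto
    have cl: "c ` V \<subseteq> V" using c(1) SB by (auto dest: BijD)
    have pow: "(f ^^ l) x = (c ^^ (u * l)) x" if "\<And>x. x \<in> V \<Longrightarrow> f x = (c ^^ u) x" "x \<in> V" for f u l x
      using that(2)
    proof (induction l arbitrary: x)
      case (Suc l)
      have "(f ^^ Suc l) x = (f ^^ l) ((c ^^ u) x)"
        using that(1)[OF Suc.prems] by (simp add: funpow_swap1)
      also have "\<dots> = (c ^^ (u * l)) ((c ^^ u) x)"
        using Suc.IH funpow_closed[OF cl Suc.prems] by blast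
      also have "\<dots> = (c ^^ (u * l + u)) x" by (simp add: funpow_add)
      finally show ?case by (simp only: mult_Suc_right add.commute)
    qed simp
    have kS: "?k \<in> S" using c(1) nat_pow_closed[of c] by simp
    have "same_orbits V ?k g h"
    proof (rule rtrancl_step_eq_Un[OF fin])
      show "g \<in> Bij V" "h \<in> Bij V" using gh SB by auto
      show "g x = (?k ^^ i') x" "h x = (?k ^^ j') x" if "x \<in> V" for x
        using pow[OF k that] g[OF that] h[OF that] ij' by metis+
      show "?k x = (g ^^ ia) ((h ^^ jb) x)" if x: "x \<in> V" for x
      proof -
        have "(g ^^ ia) ((h ^^ jb) x) = (c ^^ (i * ia)) ((c ^^ (j * jb)) x)"
          using pow[OF g] pow[OF h x] funpow_closed[OF cl x] by simp
        also have "\<dots> = (c ^^ (i * ia + j * jb)) x" by (simp add: funpow_add)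
        also have "\<dots> = (c ^^ gcd i j) x"
          using funpow_order_perm_group[OF S c(1) x] ab by (rule funpow_cong_period)
        finally show ?thesis using k[OF x] by simp
      qed
    qed
    then show ?thesis using kS by blast
  qed
  then show ?thesis unfolding orbit_join_closed_def by blast
qed

section \<open>Comparing orbits in cyclic coordinates\<close>

context cyclic_coords
begin

lemma step_in: "g \<in> Bij V \<Longrightarrow> step V g \<subseteq> V \<times> V"
  by (intro step_subset) (auto dest: BijD)

lemma rtrancl_eqI:
  assumes RS: "R \<subseteq> V \<times> V" "S \<subseteq> V \<times> V" and eq: "\<And>x y. (e x, e y) \<in> R\<^sup>* \<longleftrightarrow> (e x, e y) \<in> S\<^sup>*"
  shows "R\<^sup>* = S\<^sup>*"
proof -
  have sub: "R\<^sup>* \<subseteq> S\<^sup>*" if R: "R \<subseteq> V \<times> V" and RS: "\<And>x y. (e x, e y) \<in> R\<^sup>* \<Longrightarrow> (e x, e y) \<in> S\<^sup>*" for R S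
  proof (rule rtrancl_subset_rtrancl, rule subrelI)
    fix y z assume yz: "(y, z) \<in> R"
    then obtain u v where "y = e u" "z = e v" using R ex_coordinate by blast
    then show "(y, z) \<in> S\<^sup>*" using RS yz by blast
  qed
  show ?thesis using sub[OF RS(1)] sub[OF RS(2)] eq by blast
qed

lemma rtrancl_eq_of_transitive:
  assumes k: "k \<in> Bij V" "\<And>x y. (e x, e y) \<in> (step V k)\<^sup>*"
    and R: "R \<subseteq> V \<times> V" "step V k \<subseteq> R\<^sup>*"
  shows "(step V k)\<^sup>* = R\<^sup>*"
  using rtrancl_subset_rtrancl[OF R(2)] k(2) by (intro rtrancl_eqI step_in k R(1)) blast

lemma invariant_rtrancl:
  assumes R: "R \<subseteq> V \<times> V" and d: "d dvd int m"
    and inv: "\<And>x y. (e x, e y) \<in> R \<Longrightarrow> [x = y] (mod d)" and xy: "(e x, e y) \<in> R\<^sup>*"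
  shows "[x = y] (mod d)"
proof -
  have "\<exists>y. z = e y \<and> [x = y] (mod d)" if "(e x, z) \<in> R\<^sup>*" for z
    using that
  proof induction
    case (step y z)
    then obtain u v where "y = e u" "[x = u] (mod d)" "z = e v" using R ex_coordinate by blast
    then have "[x = v] (mod d)" using step.hyps(2) inv cong_trans by blast
    then show ?case using \<open>z = e v\<close> by blast
  qed auto
  then obtain y' where "e y = e y'" "[x = y'] (mod d)" using xy by blast
  then show ?thesis using cong_dvd_modulus[OF _ d] by (meson cong_sym cong_trans e_eq_iff)
qed

lemma transitive_translation:
  assumes g: "\<And>x. g (e x) = e (s * x + b)" and s: "[s = 1] (mod int m)" and b: "coprime b (int m)"
  shows "(e x, e y) \<in> (step V g)\<^sup>*"
proof -
  obtain z where "[b * z = 1] (mod int m)" using cong_solve_coprime_int[OF b] by blast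
  then have z: "[b * z * (y - x) = 1 * (y - x)] (mod int m)" by (rule cong_scalar_right)
  \<comment> \<open>As \<open>z\<close> inverts \<open>b\<close>, this is the number of translations
    by \<open>b\<close> that lead from \<open>x\<close> to \<open>y\<close>.\<close>
  let ?j = "nat ((z * (y - x)) mod int m)"
  have "[(affine s b ^^ ?j) x = x + int ?j * b] (mod int m)"
    using s by (rule funpow_affine_translation)
  also have "[x + int ?j * b = x + (z * (y - x)) * b] (mod int m)"
    using m_pos by (intro cong_add cong_mult cong_refl) simp
  also have "[x + (z * (y - x)) * b = x + 1 * (y - x)] (mod int m)"
    using z by (intro cong_add cong_refl) (simp add: ac_simps)
  finally show ?thesis using rtrancl_step_affine[OF g] by (auto simp: cong_def)
qed

end

lemma ex_primitive_root_powers: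
  assumes p: "prime (p::nat)"
  shows "\<exists>r. coprime p r \<and> (\<forall>s. coprime s (int p) \<longrightarrow> (\<exists>i. [s = int r ^ i] (mod int p)))"
proof -
  obtain r where r: "residue_primroot p r" using prime_primitive_root_exists[of p] p prime_gt_1_nat by blast
  have bij: "bij_betw (\<lambda>i. r ^ i mod p) {..<totient p} (totatives p)"
    using prime_gt_1_nat[OF p] by (intro residue_primroot_is_generator r)
  have "\<exists>i. [s = int r ^ i] (mod int p)" if s: "coprime s (int p)" for s
  proof -
    have p0: "int p > 0" using p prime_gt_0_nat by simp
    define y where "y = nat (s mod int p)"
    have y: "int y = s mod int p" using p0 by (simp add: y_def)
    have "coprime (int y) (int p)" unfolding y using s p0 by (simp add: coprime_mod_left_iff)
    then have "coprime y p" by (simp only: coprime_int_iff)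
    moreover have "y < p" using p0 y pos_mod_bound[of "int p" s] by linarith
    moreover have "y \<noteq> 0"
      using \<open>coprime y p\<close> p by (metis coprime_0_left_iff not_prime_unit)
    ultimately have "y \<in> totatives p" by (auto simp: totatives_def)
    then obtain i where "y = r ^ i mod p" using bij by (auto simp: bij_betw_def)
    then have "s mod int p = int (r ^ i mod p)" using y by simp
    then show ?thesis by (auto simp: cong_def of_nat_mod)
  qed
  moreover have "coprime p r" using r by (simp add: residue_primroot_def)
  ultimately show ?thesis by blast
qed

text \<open>If the maps do not commute, their commutator is a nontrivial translation and by itself
  transitive. If they commute and one is a translation, either it is the identity and the other map
  serves, or it is transitive. Otherwise they share a fixed point \<open>x0\<close>, around which
  both are multiplications by powers of one primitive root.\<close>

lemma (in cyclic_coords) orbit_join_closed_prime: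
  assumes p: "prime m" and S: "subgroup S (BijGroup V)" "S \<subseteq> affine_group V e UNIV"
  shows "orbit_join_closed V S"
  unfolding orbit_join_closed_def
proof (intro ballI)
  fix g h assume g: "g \<in> S" and h: "h \<in> S"
  let ?R = "step V g \<union> step V h"
  have SB: "S \<subseteq> Bij V" using S(1) by (rule subgroup_subset_Bij)
  have gB: "g \<in> Bij V" and hB: "h \<in> Bij V" using g h SB by auto
  have R: "?R \<subseteq> V \<times> V" using step_in[OF gB] step_in[OF hB] by blast
  have prime: "prime (int m)" using p by simp
  obtain s b where gs: "\<And>x. g (e x) = e (s * x + b)" using g S(2) by (auto simp: affine_group_def)
  obtain t c where ht: "\<And>x. h (e x) = e (t * x + c)" using h S(2) by (auto simp: affine_group_def)
  have cs: "coprime s (int m)" using coprime_multiplier[OF gB gs] .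
  have ct: "coprime t (int m)" using coprime_multiplier[OF hB ht] .
  have unit: "coprime z (int m)" if "\<not> int m dvd z" for z
    using prime_imp_coprime[OF prime that] by (simp add: coprime_commute)
  show "\<exists>k\<in>S. (step V k)\<^sup>* = ?R\<^sup>*"
  proof (cases "\<forall>x. g (h (e x)) = h (g (e x))")
    case False
    then obtain x0 where x0: "g (h (e x0)) \<noteq> h (g (e x0))" by blast
    interpret group "perm_group V S" using S(1) by (rule group_perm_group)
    let ?P = "perm_group V S"
    define k where "k = (g \<otimes>\<^bsub>?P\<^esub> h) \<otimes>\<^bsub>?P\<^esub> inv\<^bsub>?P\<^esub> (h \<otimes>\<^bsub>?P\<^esub> g)"
    have kS: "k \<in> S" using g h m_closed inv_closed unfolding k_def by simp
    have "g \<in> carrier ?P" "h \<in> carrier ?P" using g h by simp_all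
    then have "k \<otimes>\<^bsub>?P\<^esub> (h \<otimes>\<^bsub>?P\<^esub> g) = g \<otimes>\<^bsub>?P\<^esub> h"
      unfolding k_def by (simp add: m_assoc del: carrier_perm_group one_perm_group)
    then have kx: "k (h (g x)) = g (h x)" if "x \<in> V" for x
      using mult_perm_group[OF S(1)] g h kS that BijD[OF gB that] m_closed[of h g] by (metis carrier_perm_group)
    obtain s' b' where k: "\<And>x. k (e x) = e (s' * x + b')" using kS S(2) by (auto simp: affine_group_def)
    have eq: "[s' * (t * (s * x + b) + c) + b' = s * (t * x + c) + b] (mod int m)" for x
      using kx[OF e_in, of x] by (simp add: gs ht k e_eq_iff)
    \<comment> \<open>Subtracting the identity at 0 from the identity at 1 removes all translation
      parts.\<close>
    have "[(s * t) * s' = (s * t) * 1] (mod int m)"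
      using cong_diff[OF eq[of 1] eq[of 0]] by (simp add: algebra_simps)
    then have s': "[s' = 1] (mod int m)" using cs ct
      by (subst (asm) cong_mult_lcancel) simp_all
    have "\<not> int m dvd b'"
    proof
      assume "int m dvd b'"
      then have "[s' * x + b' = 1 * x + 0] (mod int m)" for x
        using s' by (intro cong_add cong_scalar_right) (simp_all add: cong_0_iff)
      then have "k (e x) = e x" for x by (simp add: k e_eq_iff)
      then have "k (h (g (e x0))) = h (g (e x0))" using gs ht by simp
      then show False using kx[OF e_in] x0 by simp
    qed
    then have tr: "(e x, e y) \<in> (step V k)\<^sup>*" for x y
      using transitive_translation[OF k s' unit] by blast
    have symR: "sym (?R\<^sup>*)"
      using finite_space gB hB by (intro sym_rtrancl_Un sym_rtrancl_step)
    have "step V k \<subseteq> ?R\<^sup>*"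
    proof (rule subrelI)
      fix y z assume "(y, z) \<in> step V k"
      then have y: "y \<in> V" "z = k y" by (auto simp: step_iff)
      have onto: "f ` V = V" if "f \<in> Bij V" for f using that by (auto simp: Bij_def bij_betw_def)
      \<comment> \<open>Writing \<open>y\<close> as \<open>h (g x)\<close> makes \<open>k y\<close>
        equal to \<open>g (h x)\<close>: both ends of the step are reached from the common point
        \<open>x\<close>.\<close>
      obtain x where x: "x \<in> V" "y = h (g x)" using y(1) onto[OF gB] onto[OF hB] by (metis imageE)
      have "(x, g x) \<in> ?R" "(g x, y) \<in> ?R" "(x, h x) \<in> ?R" "(h x, z) \<in> ?R"
        using x y BijD[OF gB x(1)] BijD[OF hB x(1)] kx by (auto simp: step_iff)
      then have "(x, y) \<in> ?R\<^sup>*" "(x, z) \<in> ?R\<^sup>*" by (meson converse_rtrancl_into_rtrancl r_into_rtrancl)+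
      then show "(y, z) \<in> ?R\<^sup>*" using symR by (meson rtrancl_trans symD)
    qed
    then have "(step V k)\<^sup>* = ?R\<^sup>*" using kS SB tr R by (intro rtrancl_eq_of_transitive) auto
    then show ?thesis using kS by blast
  next
    case comm: True
    have unipotent: "f \<in> S \<Longrightarrow> f' \<in> S \<Longrightarrow> (\<And>x. f (e x) = e (u * x + v)) \<Longrightarrow> [u = 1] (mod int m) \<Longrightarrow>
        \<exists>k\<in>S. same_orbits V k f f'" for f f' u v
    proof -
      assume f: "f \<in> S" "f' \<in> S" and fu: "\<And>x. f (e x) = e (u * x + v)" and u: "[u = 1] (mod int m)"
      have B: "f \<in> Bij V" "f' \<in> Bij V" using f SB by auto
      have sub: "step V f \<union> step V f' \<subseteq> V \<times> V" using step_in[OF B(1)] step_in[OF B(2)] by blast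
      show ?thesis
      proof (cases "int m dvd v")
        case True
        then have "[u * x + v = 1 * x + 0] (mod int m)" for x
          using u by (intro cong_add cong_scalar_right) (simp_all add: cong_0_iff)
        then have "f (e x) = e x" for x by (simp add: fu e_eq_iff)
        then have "f x = (f' ^^ 0) x" if "x \<in> V" for x using that ex_coordinate by auto
        then have "same_orbits V f' f f'"
          by (rule rtrancl_step_eq_Un[OF finite_space B, where j = 1 and ia = 0 and jb = 1]) simp_all
        then show ?thesis using f by blast
      next
        case False
        then have "same_orbits V f f f'"
          using transitive_translation[OF fu u unit] B sub by (intro rtrancl_eq_of_transitive) auto
        then show ?thesis using f by blast
      qed
    qed
    consider "[s = 1] (mod int m)" | "[t = 1] (mod int m)"
      | "\<not> [s = 1] (mod int m)" "\<not> [t = 1] (mod int m)" by blast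
    then show ?thesis
    proof cases
      case 1
      then show ?thesis using unipotent[OF g h gs] by blast
    next
      case 2
      then show ?thesis using unipotent[OF h g ht] by (simp add: Un_commute)
    next
      case 3
      then have s1: "coprime (s - 1) (int m)" and t1: "\<not> int m dvd t - 1"
        using unit by (auto simp: cong_iff_dvd_diff)
      have "[s * (t * 0 + c) + b = t * (s * 0 + b) + c] (mod int m)"
        using spec[OF comm, of 0] by (simp only: gs ht e_eq_iff)
      then have cb: "int m dvd (s - 1) * c - (t - 1) * b" by (simp add: cong_iff_dvd_diff algebra_simps)
      obtain x0 where x0: "int m dvd (s - 1) * x0 + b"
        using ex_linear_root_mod_prime[OF prime] 3 by (metis cong_iff_dvd_diff)
      \<comment> \<open>The sum equals \<open>(s - 1) * ((t - 1) * x0 + c)\<close>. As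
        \<open>s - 1\<close> is a unit, the fixed point \<open>x0\<close> of \<open>g\<close> is
        also fixed by \<open>h\<close>.\<close>
      have "int m dvd (t - 1) * ((s - 1) * x0 + b) + ((s - 1) * c - (t - 1) * b)"
        by (rule dvd_add[OF dvd_mult[OF x0] cb])
      then have "int m dvd (s - 1) * ((t - 1) * x0 + c)" by (simp add: algebra_simps)
      then have x0': "int m dvd (t - 1) * x0 + c"
        using s1 by (simp add: coprime_dvd_mult_right_iff coprime_commute)
      have shift: "\<exists>z. y = e (x0 + z)" if "y \<in> V" for y
        using ex_coordinate[OF that] by (metis add.commute diff_add_cancel)
      have gz: "g (e (x0 + z)) = e (x0 + s * z)" for z
        using x0 by (simp add: gs e_eq_iff cong_iff_dvd_diff algebra_simps)
      have hz: "h (e (x0 + z)) = e (x0 + t * z)" for z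
        using x0' by (simp add: ht e_eq_iff cong_iff_dvd_diff algebra_simps)
      have pow: "(f ^^ l) (e (x0 + z)) = e (x0 + u ^ l * z)"
        if "\<And>z. f (e (x0 + z)) = e (x0 + u * z)" for f u l z
        by (induction l) (simp_all add: that mult.assoc)
      obtain r where cop: "coprime m r" and r: "\<forall>s. coprime s (int m) \<longrightarrow> (\<exists>i. [s = int r ^ i] (mod int m))"
        using ex_primitive_root_powers[OF p] by blast
      obtain i j where i: "[s = int r ^ i] (mod int m)" and j: "[t = int r ^ j] (mod int m)"
        using r cs ct by blast
      show ?thesis
      proof -
        \<comment> \<open>Exponents of the primitive root matter only modulo its order, which
          divides \<open>totient m\<close>; so Bezout is applied modulo
          \<open>totient m\<close>.\<close>
        have tot: "totient m > 0" using m_pos by simp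
        obtain ia jb where ab: "[i * ia + j * jb = gcd i j] (mod totient m)"
          using gcd_combination_mod[OF tot] by blast
        obtain i' j' where ij': "i = gcd i j * i'" "j = gcd i j * j'" by (metis dvdE gcd_dvd1 gcd_dvd2)
        define u where "u = s ^ ia * t ^ jb"
        have "[u = (int r ^ i) ^ ia * (int r ^ j) ^ jb] (mod int m)"
          unfolding u_def using i j by (intro cong_mult cong_pow)
        also have "(int r ^ i) ^ ia * (int r ^ j) ^ jb = int (r ^ (i * ia + j * jb))"
          by (simp add: power_add power_mult)
        also have "[\<dots> = int (r ^ gcd i j)] (mod int m)"
          using cop cong_dvd_modulus_nat[OF ab order_divides_totient[OF cop]]
          by (subst cong_int_iff) (simp add: order_divides_expdiff)
        finally have u: "[u = int r ^ gcd i j] (mod int m)" by simp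
        have upow: "[u ^ l = int r ^ (gcd i j * l)] (mod int m)" for l
          using cong_pow[OF u, of l] by (simp add: power_mult)
        have us: "[s = u ^ i'] (mod int m)" and ut: "[t = u ^ j'] (mod int m)"
          using i j upow ij' by (metis cong_sym cong_trans)+
        interpret group "perm_group V S" using S(1) by (rule group_perm_group)
        let ?P = "perm_group V S"
        define k where "k = g [^]\<^bsub>?P\<^esub> ia \<otimes>\<^bsub>?P\<^esub> h [^]\<^bsub>?P\<^esub> jb"
        have pS: "g [^]\<^bsub>?P\<^esub> ia \<in> S" "h [^]\<^bsub>?P\<^esub> jb \<in> S" using g h nat_pow_closed by auto
        then have kS: "k \<in> S" unfolding k_def using m_closed by simp
        have h_img: "h ` V \<subseteq> V" using hB by (auto dest: BijD)
        have kx: "k x = (g ^^ ia) ((h ^^ jb) x)" if "x \<in> V" for x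
          unfolding k_def
          using mult_perm_group[OF S(1) pS that] nat_pow_perm_group[OF S(1) g funpow_closed[OF h_img that]]
            nat_pow_perm_group[OF S(1) h that] by simp
        have kz: "k (e (x0 + z)) = e (x0 + u * z)" for z
          by (simp add: kx e_in pow[OF hz] pow[OF gz] u_def mult.assoc)
        have "(step V k)\<^sup>* = ?R\<^sup>*"
        proof (rule rtrancl_step_eq_Un[OF finite_space gB hB])
          fix x assume x: "x \<in> V"
          then obtain z where z: "x = e (x0 + z)" using shift by blast
          show "g x = (k ^^ i') x"
            unfolding z gz pow[OF kz] e_eq_iff using us by (intro cong_add cong_mult cong_refl)
          show "h x = (k ^^ j') x"
            unfolding z hz pow[OF kz] e_eq_iff using ut by (intro cong_add cong_mult cong_refl)
          show "k x = (g ^^ ia) ((h ^^ jb) x)" using kx[OF x] .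
        qed
        then show ?thesis using kS by blast
      qed
    qed
  qed
qed

section \<open>Affine groups of prime power degree\<close>

text \<open>With \<open>q * q\<close> vanishing, the multiplier of the \<open>i\<close>-th iterate
  is \<open>1 + q * w * i\<close>. Adding the contributions \<open>b * (1 + q * w * i)\<close> of
  the translation over \<open>i < j\<close> produces the binomial coefficient.\<close>

lemma funpow_affine_nilpotent:
  assumes q: "M dvd q * q"
  shows "[(affine (1 + q * w) b ^^ j) x = x + int j * b + q * w * (int j * x + b * int (j choose 2))] (mod M)"
    (is "[?F j = ?G j] (mod M)")
proof (induction j)
  case (Suc j)
  let ?T = "int j * x + b * int (j choose 2)"
  have "[affine (1 + q * w) b (?F j) = affine (1 + q * w) b (?G j)] (mod M)"
    using Suc by (rule affine_cong)
  also have "affine (1 + q * w) b (?G j) = ?G (Suc j) + (q * q) * (w * w * ?T)"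
    by (simp add: affine_def numeral_2_eq_2 algebra_simps)
  also have "[\<dots> = ?G (Suc j) + 0] (mod M)"
    using q by (intro cong_add cong_refl) (simp add: cong_0_iff)
  finally show ?case by simp
qed (simp add: numeral_2_eq_2)

text \<open>The excluded case is that of the dihedral group of order 8.\<close>

lemma affine_p_th_power:
  fixes p a v :: nat and w b' :: int
  assumes p: "prime p" and a: "a \<ge> 2" "\<not> (p = 2 \<and> a = 2)" and b': "\<not> int p dvd b'"
  shows "\<exists>c. \<not> int p dvd c \<and> (\<forall>x j.
    [(affine (1 + int p ^ (a - 1) * w) (int p ^ v * b') ^^ (p * j)) x = x + int p ^ (v + 1) * (int j * c)]
      (mod int p ^ a))"
proof -
  let ?q = "int p ^ (a - 1)" and ?b = "int p ^ v * b'" and ?M = "int p ^ a"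
  have qp: "?M = ?q * int p" using a by (cases a) simp_all
  have qq: "?M dvd ?q * ?q" using a by (simp add: le_imp_power_dvd flip: power_add)
  have F: "[(affine (1 + ?q * w) ?b ^^ (p * j)) x =
      x + int (p * j) * ?b + ?q * w * ?b * int (p * j choose 2)] (mod ?M)" for x j
  proof -
    have "?q * w * (int (p * j) * x + ?b * int (p * j choose 2)) =
        ?q * w * ?b * int (p * j choose 2) + ?M * (w * int j * x)"
      by (simp add: qp algebra_simps)
    then have "[x + int (p * j) * ?b + ?q * w * (int (p * j) * x + ?b * int (p * j choose 2)) =
        x + int (p * j) * ?b + ?q * w * ?b * int (p * j choose 2)] (mod ?M)"
      by (simp add: cong_iff_dvd_diff)
    with funpow_affine_nilpotent[OF qq, where w = w and b = ?b and j = "p * j" and x = x] show ?thesis by (rule cong_trans)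
  qed
  have choose: "2 * (p * j choose 2) = p * j * (p * j - 1)" for j
  proof -
    have "even (n * (n - 1))" for n :: nat by (cases n) auto
    then show ?thesis unfolding choose_two by (rule dvd_mult_div_cancel)
  qed
  show ?thesis
  proof (cases "p = 2")
    case False
    then have "coprime p 2" by (rule primes_coprime[OF p two_is_prime_nat])
    have "[(affine (1 + ?q * w) ?b ^^ (p * j)) x = x + int p ^ (v + 1) * (int j * b')] (mod ?M)" for x j
    proof -
      \<comment> \<open>For odd \<open>p\<close> the binomial itself is divisible by
        \<open>p\<close>, and with the factor \<open>q\<close> the quadratic term disappears modulo
        \<open>p ^ a\<close>.\<close>
      have "p dvd 2 * (p * j choose 2)" unfolding choose by simp
      then have "p dvd (p * j choose 2)" using \<open>coprime p 2\<close> by (simp add: coprime_dvd_mult_right_iff)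
      then obtain k where "(p * j choose 2) = p * k" by auto
      then have C: "?q * w * ?b * int (p * j choose 2) = ?M * (w * ?b * int k)" by (simp add: qp)
      have E: "x + int (p * j) * ?b + ?q * w * ?b * int (p * j choose 2) =
          x + int p ^ (v + 1) * (int j * b') + ?M * (w * ?b * int k)"
        unfolding C by (simp add: algebra_simps)
      have "[x + int (p * j) * ?b + ?q * w * ?b * int (p * j choose 2) =
          x + int p ^ (v + 1) * (int j * b')] (mod ?M)"
        unfolding E by (simp add: cong_iff_dvd_diff)
      with F show ?thesis by (rule cong_trans)
    qed
    then show ?thesis using b' by blast
  next
    case True
    then have a3: "a \<ge> 3" using a by simp
    \<comment> \<open>For \<open>p = 2\<close> the binomial is \<open>j + 2 * j * (j - 1)\<close>;
      the even part vanishes and the part \<open>j\<close> adds \<open>2 ^ (a - 2) * w\<close> to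
      the coefficient. The bracket is odd because \<open>a\<close> is at least 3; for
      \<open>a = 2\<close> and odd \<open>w\<close> it would be even.\<close>
    let ?c = "b' * (1 + 2 ^ (a - 2) * w)"
    have q2: "?q = 2 * 2 ^ (a - 2)"
    proof -
      have "a - 1 = Suc (a - 2)" using a3 by simp
      then show ?thesis using True by (simp only: power_Suc of_nat_numeral)
    qed
    have "even (2 ^ (a - 2) :: int)" using a3 by simp
    then have "\<not> int p dvd ?c" using b' True by simp
    moreover have "[(affine (1 + ?q * w) ?b ^^ (p * j)) x = x + int p ^ (v + 1) * (int j * ?c)] (mod ?M)" for x j
    proof -
      have "(p * j choose 2) = j * (2 * j - 1)" using choose[of j] True by simp
      then have C: "int (p * j choose 2) = int j * (2 * int j - 1)"
        by (cases j) (simp_all add: algebra_simps)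
      have M: "?M = 2 * ?q" using qp True by simp
      have E: "x + int (p * j) * ?b + ?q * w * ?b * int (p * j choose 2) =
          x + int p ^ (v + 1) * (int j * ?c) + ?M * (w * ?b * int j * (int j - 1))"
        unfolding C M q2 using True by (simp add: algebra_simps)
      have "[x + int (p * j) * ?b + ?q * w * ?b * int (p * j choose 2) =
          x + int p ^ (v + 1) * (int j * ?c)] (mod ?M)"
        unfolding E by (simp add: cong_iff_dvd_diff)
      with F show ?thesis by (rule cong_trans)
    qed
    ultimately show ?thesis by blast
  qed
qed

lemma ex_nat_multiple_cong:
  assumes "coprime u M" "M > 0"
  shows "\<exists>i. [u * int i = z] (mod M)"
proof -
  obtain y where "[u * y = 1] (mod M)" using cong_solve_coprime_int[OF assms(1)] by blast
  then have "[u * y * z = 1 * z] (mod M)" by (rule cong_scalar_right)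
  moreover have "[u * int (nat (y * z mod M)) = u * (y * z)] (mod M)"
    using assms(2) by (intro cong_mult cong_refl) simp
  ultimately have "[u * int (nat (y * z mod M)) = z] (mod M)"
    by (metis cong_trans mult.assoc mult_1)
  then show ?thesis ..
qed

text \<open>The point \<open>y\<close> is approached in two stages. Modulo
  \<open>p ^ (v + 1)\<close> the map is a translation by \<open>p ^ v * b'\<close>, so some
  \<open>i\<close> steps reach the class of \<open>y\<close>; the \<open>p\<close>-th power of the
  map then acts like a translation by \<open>p ^ (v + 1)\<close> times a unit and closes the
  remaining gap.\<close>

lemma affine_orbit_residue_class:
  fixes p a v :: nat and w b' :: int
  assumes p: "prime p" and a: "a \<ge> 2" "\<not> (p = 2 \<and> a = 2)" and b': "\<not> int p dvd b'"
    and v: "v + 1 < a" and xy: "[x = y] (mod int p ^ v)"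
  shows "\<exists>j. [(affine (1 + int p ^ (a - 1) * w) (int p ^ v * b') ^^ j) x = y] (mod int p ^ a)"
proof -
  let ?F = "affine (1 + int p ^ (a - 1) * w) (int p ^ v * b')"
  have p': "prime (int p)" and p0: "int p > 0" using p prime_gt_0_nat by auto
  have cop: "coprime u (int p)" if "\<not> int p dvd u" for u
    using prime_imp_coprime[OF p' that] by (simp add: coprime_commute)
  obtain z where z: "y = x + int p ^ v * z"
    using xy unfolding cong_iff_lin ..
  obtain i where i: "[b' * int i = z] (mod int p)"
    using ex_nat_multiple_cong[OF cop[OF b'] p0] by blast
  have "[1 + int p ^ (a - 1) * w = 1] (mod int p ^ (v + 1))"
  proof -
    have "int p ^ (v + 1) dvd int p ^ (a - 1)" using v by (intro le_imp_power_dvd) simp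
    then have "int p ^ (v + 1) dvd int p ^ (a - 1) * w" by (rule dvd_mult2)
    then show ?thesis by (simp add: cong_iff_dvd_diff)
  qed
  then have "[(?F ^^ i) x = x + int i * (int p ^ v * b')] (mod int p ^ (v + 1))"
    by (rule funpow_affine_translation)
  moreover have "[x + int i * (int p ^ v * b') = y] (mod int p ^ (v + 1))"
  proof -
    have "int p ^ v * int p dvd int p ^ v * (b' * int i - z)"
      using i by (intro mult_dvd_mono) (simp_all add: cong_iff_dvd_diff)
    then show ?thesis by (simp add: z cong_iff_dvd_diff algebra_simps)
  qed
  ultimately have "[(?F ^^ i) x = y] (mod int p ^ (v + 1))" by (rule cong_trans)
  then obtain z' where z': "y = (?F ^^ i) x + int p ^ (v + 1) * z'" unfolding cong_iff_lin ..
  obtain c where c: "\<not> int p dvd c"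
    "\<And>x j. [(?F ^^ (p * j)) x = x + int p ^ (v + 1) * (int j * c)] (mod int p ^ a)"
    using affine_p_th_power[OF p a b', of w v] by blast
  obtain j where j: "[c * int j = z'] (mod int p ^ a)"
    using ex_nat_multiple_cong[of c "int p ^ a" z'] cop[OF c(1)] p0 by auto
  have "[(?F ^^ (p * j)) ((?F ^^ i) x) = (?F ^^ i) x + int p ^ (v + 1) * (int j * c)] (mod int p ^ a)"
    by (rule c(2))
  also have "[(?F ^^ i) x + int p ^ (v + 1) * (int j * c) = y] (mod int p ^ a)"
    unfolding z' using j by (intro cong_add cong_mult cong_refl) (simp add: mult.commute)
  finally have "[(?F ^^ (p * j + i)) x = y] (mod int p ^ a)" by (simp add: funpow_add)
  then show ?thesis ..
qed

lemma coprime_unipotent: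
  assumes "[s = 1] (mod int p ^ (a - 1))" "a \<ge> 2"
  shows "coprime s (int (p ^ a))"
proof -
  have "[s = 1] (mod int p)"
    using assms(1) by (rule cong_dvd_modulus) (use assms(2) in \<open>simp add: dvd_power\<close>)
  then have "coprime s (int p)" by (meson cong_imp_coprime cong_sym coprime_1_left)
  then show ?thesis by simp
qed

section \<open>Joins in the full extension of prime power degree\<close>

locale prime_power_coords = cyclic_coords V e m
  for V :: "'a set" and e m +
  fixes p a :: nat and q :: int
  assumes p: "prime p" and a: "a \<ge> 2" and m: "m = p ^ a" and q: "q = int p ^ (a - 1)"
begin

abbreviation "G \<equiv> affine_group V e {s. [s = 1] (mod q)}"

lemma int_m: "int m = q * int p" "int m = int p ^ a"
  using a by (simp_all add: m q flip: power_Suc2)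

lemma prime_p: "prime (int p)" using p by simp

lemma ex_G: "\<exists>g\<in>G. \<forall>x. g (e x) = e ((1 + q * w) * x + b)"
  using ex_affine_group[of "1 + q * w" "{s. [s = 1] (mod q)}" b] coprime_unipotent[of "1 + q * w" p a] a
  by (simp add: q m cong_iff_dvd_diff)

lemma G_cases:
  assumes "g \<in> G"
  obtains w b where "g \<in> Bij V" "\<And>x. g (e x) = e ((1 + q * w) * x + b)"
proof -
  from assms obtain s b where s: "g \<in> Bij V" "[s = 1] (mod q)" "\<forall>x. g (e x) = e (s * x + b)"
    by (auto simp: affine_group_def)
  then obtain w where "s = 1 + q * w" by (metis add.commute cong_iff_dvd_diff diff_add_cancel dvdE)
  with s that show thesis by blast
qed

lemma G_cong:
  assumes "\<And>x. g (e x) = e ((1 + q * w) * x + b)" "d dvd q" "d dvd b" "(e x, e y) \<in> step V g"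
  shows "[x = y] (mod d)"
proof -
  have "[(1 + q * w) * x + b = y] (mod int m)" using assms(1,4) by (simp add: step_iff e_eq_iff cong_sym)
  then have y: "[(1 + q * w) * x + b = y] (mod d)"
    using assms(2) int_m(1) by (metis cong_dvd_modulus dvd_mult2)
  have "d dvd (q * w) * x + b" using assms(2,3) by simp
  then obtain k where "(q * w) * x + b = d * k" by (rule dvdE)
  then have "[x = (1 + q * w) * x + b] (mod d)"
    unfolding cong_iff_lin by (intro exI[of _ k]) (simp add: algebra_simps)
  then show ?thesis using y by (rule cong_trans)
qed

lemma rtrancl_residue_classes:
  assumes R: "R \<subseteq> V \<times> V" and pres: "\<And>x y. (e x, e y) \<in> R \<Longrightarrow> [x = y] (mod int p ^ v)"
    and g: "step V g \<subseteq> R" "\<And>x. g (e x) = e ((1 + q * w) * x + int p ^ v * b')"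
    and b': "\<not> int p dvd b'" and v: "v + 1 < a" and not_D8: "\<not> (p = 2 \<and> a = 2)"
  shows "(e x, e y) \<in> R\<^sup>* \<longleftrightarrow> [x = y] (mod int p ^ v)"
proof
  have "int p ^ v dvd int m" unfolding int_m(2) using v by (intro le_imp_power_dvd) simp
  then show "[x = y] (mod int p ^ v)" if "(e x, e y) \<in> R\<^sup>*"
    using invariant_rtrancl[OF R _ pres that] by blast
  assume "[x = y] (mod int p ^ v)"
  then have "(e x, e y) \<in> (step V g)\<^sup>*"
    using affine_orbit_residue_class[OF p a not_D8 b' v, folded q] rtrancl_step_affine[OF g(2)] int_m(2) by metis
  then show "(e x, e y) \<in> R\<^sup>*" using rtrancl_mono[OF g(1)] by blast
qed

text \<open>All steps preserve classes modulo \<open>p ^ v\<close>, and \<open>g\<close> is already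
  transitive on each of them. The join is therefore the partition into these classes, as for the
  translation by \<open>p ^ v\<close>.\<close>

lemma join_large:
  assumes g: "g \<in> G" "\<And>x. g (e x) = e ((1 + q * w) * x + int p ^ v * b')"
    and h: "h \<in> G" "\<And>x. h (e x) = e ((1 + q * w') * x + c)"
    and b': "\<not> int p dvd b'" and v: "v + 1 < a" and c: "int p ^ v dvd c"
    and not_D8: "\<not> (p = 2 \<and> a = 2)"
  shows "\<exists>k\<in>G. same_orbits V k g h"
proof -
  obtain k where k: "k \<in> G" "\<And>x. k (e x) = e ((1 + q * 0) * x + int p ^ v * 1)"
    using ex_G[of 0 "int p ^ v"] by auto
  have B: "g \<in> Bij V" "h \<in> Bij V" "k \<in> Bij V" using g h k by (auto simp: affine_group_def)
  have sub: "step V g \<union> step V h \<subseteq> V \<times> V" using step_in B by blast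
  have vq: "int p ^ v dvd q" unfolding q using v by (intro le_imp_power_dvd) simp
  have p1: "\<not> int p dvd 1" using not_prime_unit[of "int p"] prime_p by blast
  have "same_orbits V k g h"
  proof (rule rtrancl_eqI[OF step_in[OF B(3)] sub])
    fix x y
    have pres: "[x = y] (mod int p ^ v)" if "(e x, e y) \<in> step V g \<union> step V h" for x y
      using that G_cong[OF g(2) vq, of x y] G_cong[OF h(2) vq c, of x y] by auto
    have presk: "[x = y] (mod int p ^ v)" if "(e x, e y) \<in> step V k" for x y
      using that G_cong[OF k(2) vq, of x y] by auto
    show "(e x, e y) \<in> (step V k)\<^sup>* \<longleftrightarrow> (e x, e y) \<in> (step V g \<union> step V h)\<^sup>*"
      using rtrancl_residue_classes[OF step_in[OF B(3)] presk order_refl k(2) p1 v not_D8]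
        rtrancl_residue_classes[OF sub pres Un_upper1 g(2) b' v not_D8] by simp
  qed
  then show ?thesis using k(1) by blast
qed

text \<open>On four points with \<open>b\<close> odd, \<open>g\<close> is a rotation of order 4,
  hence transitive, or the reflection \<open>x \<mapsto> b - x\<close>. In the latter case
  \<open>h\<close> either acts as the identity or as \<open>g\<close>, and \<open>g\<close> serves,
  or the group generated is transitive and the rotation by 1 serves.\<close>

lemma join_dihedral:
  assumes g: "g \<in> G" "\<And>x. g (e x) = e ((1 + q * w) * x + b)"
    and h: "h \<in> G" "\<And>x. h (e x) = e ((1 + q * w') * x + c)"
    and b: "\<not> int p dvd b" and D8: "p = 2" "a = 2"
  shows "\<exists>k\<in>G. same_orbits V k g h"
proof -
  let ?R = "step V g \<union> step V h"
  have m4: "int m = 4" and q2: "q = 2" using D8 m q by auto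
  have odd: "odd b" using b D8 by simp
  have B: "g \<in> Bij V" "h \<in> Bij V" using g h by (auto simp: affine_group_def)
  have sub: "?R \<subseteq> V \<times> V" using step_in B by blast
  have cop: "coprime u (int m)" if "odd u" for u :: int
  proof -
    have "coprime u 2" using that by simp
    then have "coprime u (2 * 2)" by (simp only: coprime_mult_right_iff)
    then show ?thesis by (simp add: m4)
  qed
  show ?thesis
  proof (cases "even w")
    case True
    then have "[1 + q * w = 1] (mod int m)" by (auto simp: m4 q2 cong_iff_dvd_diff)
    then have "(e x, e y) \<in> (step V g)\<^sup>*" for x y
      using transitive_translation[OF g(2) _ cop[OF odd]] by blast
    then have "(step V g)\<^sup>* = ?R\<^sup>*" using B sub by (intro rtrancl_eq_of_transitive) auto
    then show ?thesis using g(1) by blast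
  next
    case False
    then obtain w1 where w1: "w = 2 * w1 + 1" by (auto elim: oddE)
    have gx: "g (e x) = e (b - x)" for x
      by (simp add: g(2) e_eq_iff cong_iff_dvd_diff m4 q2 w1 algebra_simps)
    \<comment> \<open>Chosen so that the rotation by \<open>d\<close> is available in both cases: it
      is \<open>h\<close> itself, or the reflection \<open>h\<close> followed by the reflection
      \<open>g\<close>.\<close>
    define d where "d = (if even w' then c else b - c)"
    have hx: "h (e x) = (if even w' then e (x + d) else e (b - d - x))" for x
    proof (cases "even w'")
      case True
      then obtain k where "w' = 2 * k" by auto
      then show ?thesis by (simp add: h(2) d_def e_eq_iff cong_iff_dvd_diff m4 q2 algebra_simps)
    next
      case False
      then obtain k where "w' = 2 * k + 1" by (auto elim: oddE)
      then show ?thesis by (simp add: h(2) d_def e_eq_iff cong_iff_dvd_diff m4 q2 algebra_simps)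
    qed
    show ?thesis
    proof (cases "4 dvd d")
      case True
      then have "h (e x) = e x \<or> h (e x) = g (e x)" for x
        by (auto simp: hx gx e_eq_iff cong_iff_dvd_diff m4)
      then have "h y = y \<or> h y = g y" if "y \<in> V" for y
        using ex_coordinate[OF that] by auto
      then have "step V h \<subseteq> (step V g)\<^sup>*"
        by (auto simp: step_iff) (metis r_into_rtrancl rtrancl.rtrancl_refl step_iff)
      then have "(step V g)\<^sup>* = ?R\<^sup>*"
        by (intro equalityI rtrancl_mono rtrancl_subset_rtrancl) auto
      then show ?thesis using g(1) by blast
    next
      case False
      have shift: "(e x, e (x + d)) \<in> ?R\<^sup>*" for x
      proof (cases "even w'")
        case True
        then have "(e x, e (x + d)) \<in> step V h" by (simp add: step_iff e_in hx)
        then show ?thesis by blast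
      next
        case odd: False
        have "(e x, e (b - d - x)) \<in> step V h" using odd by (simp add: step_iff e_in hx)
        moreover have "(e (b - d - x), e (x + d)) \<in> step V g"
          by (simp add: step_iff e_in gx algebra_simps)
        ultimately show ?thesis by (meson UnI1 UnI2 converse_rtrancl_into_rtrancl r_into_rtrancl)
      qed
      have shift2: "(e x, e (x + 2)) \<in> ?R\<^sup>*" for x
      proof (cases "even d")
        case True
        then have "[x + d = x + 2] (mod int m)" using False unfolding m4 cong_iff_dvd_diff by presburger
        then show ?thesis using shift[of x] e_eq_iff by metis
      next
        case False
        then have "[x + d + d = x + 2] (mod int m)" unfolding m4 cong_iff_dvd_diff by presburger
        then show ?thesis using rtrancl_trans[OF shift[of x] shift[of "x + d"]] e_eq_iff by metis
      qed
      have near: "(e x, e y) \<in> ?R\<^sup>*" if "even (y - x)" for x y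
      proof -
        have "[x = y] (mod int m) \<or> [x + 2 = y] (mod int m)"
          using that unfolding m4 cong_iff_dvd_diff by presburger
        then show ?thesis using shift2[of x] e_eq_iff by (metis rtrancl.rtrancl_refl)
      qed
      have total: "(e x, e y) \<in> ?R\<^sup>*" for x y
      proof (cases "even (y - x)")
        case True
        then show ?thesis by (rule near)
      next
        case False
        then have "(e (b - x), e y) \<in> ?R\<^sup>*" using odd by (intro near) simp
        moreover have "(e x, e (b - x)) \<in> ?R" by (simp add: step_iff e_in gx)
        ultimately show ?thesis by (rule converse_rtrancl_into_rtrancl[rotated])
      qed
      obtain k where k: "k \<in> G" "\<And>x. k (e x) = e ((1 + q * 0) * x + 1)" using ex_G[of 0 1] by blast
      have kB: "k \<in> Bij V" using k by (auto simp: affine_group_def)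
      have "(e x, e y) \<in> (step V k)\<^sup>*" for x y
        using transitive_translation[OF k(2)] by simp
      then have "(step V k)\<^sup>* = ?R\<^sup>*"
        using total by (intro rtrancl_eqI step_in kB sub) simp
      then show ?thesis using k(1) by blast
    qed
  qed
qed

text \<open>As \<open>p\<close> divides \<open>q\<close>, the value \<open>w * x + b\<close> modulo
  \<open>p\<close> is constant on classes modulo \<open>q\<close>. Each such class has
  \<open>p\<close> points and is translated by \<open>q\<close> times this value: it is one orbit if
  the value is nonzero modulo \<open>p\<close>, and fixed pointwise otherwise.\<close>

lemma rtrancl_small:
  assumes g: "g \<in> Bij V" "\<And>x. g (e x) = e (x + q * (w * x + b))"
    and h: "h \<in> Bij V" "\<And>x. h (e x) = e (x + q * (w' * x + c))"
  shows "(e x, e y) \<in> (step V g \<union> step V h)\<^sup>* \<longleftrightarrow>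
    [x = y] (mod int m) \<or> (\<not> (int p dvd w * x + b \<and> int p dvd w' * x + c)) \<and> [x = y] (mod q)"
    (is "_ \<in> ?R\<^sup>* \<longleftrightarrow> ?rhs")
proof
  have R: "?R \<subseteq> V \<times> V" using step_in g h by blast
  have gf: "g (e x) = (e ((1 + q * w) * x + q * b))" and hf: "h (e x) = (e ((1 + q * w') * x + q * c))" for x
    by (simp_all add: g(2) h(2) algebra_simps)
  assume xy: "(e x, e y) \<in> ?R\<^sup>*"
  have "[x = y] (mod q)"
  proof (rule invariant_rtrancl[OF R _ _ xy])
    show "q dvd int m" by (simp add: int_m(1))
    show "[x = y] (mod q)" if "(e x, e y) \<in> ?R" for x y
      using that G_cong[OF gf, of q x y] G_cong[OF hf, of q x y] by auto
  qed
  moreover have "[x = y] (mod int m)" if root: "int p dvd w * x + b" "int p dvd w' * x + c"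
  proof -
    have "q * int p dvd q * (w * x + b)" "q * int p dvd q * (w' * x + c)"
      using root by (auto intro: mult_dvd_mono)
    then have "g (e x) = e x" "h (e x) = e x"
      by (simp_all add: g(2) h(2) e_eq_iff cong_iff_dvd_diff int_m(1))
    have "z = e x" if "(e x, z) \<in> ?R\<^sup>*" for z
      using that
    proof induction
      case (step y z)
      then show ?case using \<open>g (e x) = e x\<close> \<open>h (e x) = e x\<close> by (auto simp: step_iff)
    qed simp
    then show ?thesis using xy e_eq_iff by metis
  qed
  ultimately show ?rhs by blast
next
  have one: "(e x, e y) \<in> (step V f)\<^sup>*"
    if f: "\<And>x. f (e x) = e (x + q * (u * x + d))" and nd: "\<not> int p dvd u * x + d" and xy: "[x = y] (mod q)"
    for f u d x y
  proof -
    have fx: "f (e (x + q * z)) = e (x + q * (z + (u * x + d)))" for z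
    proof -
      have "int m dvd q * (q * (u * z))"
        unfolding int_m(1) using a by (intro mult_dvd_mono dvd_mult2) (auto simp: q dvd_power)
      then show ?thesis by (simp add: f e_eq_iff cong_iff_dvd_diff algebra_simps)
    qed
    have pow: "(f ^^ j) (e x) = e (x + q * (int j * (u * x + d)))" for j
    proof (induction j)
      case (Suc j)
      have "(f ^^ Suc j) (e x) = f (e (x + q * (int j * (u * x + d))))" using Suc by simp
      also have "\<dots> = e (x + q * (int j * (u * x + d) + (u * x + d)))" by (rule fx)
      finally show ?case by (simp add: distrib_right add.commute)
    qed simp
    obtain z where z: "y = x + q * z"
      using xy unfolding cong_iff_lin ..
    have "coprime (u * x + d) (int p)" using prime_imp_coprime[OF prime_p nd] by (simp add: coprime_commute)
    then obtain j where "[(u * x + d) * int j = z] (mod int p)"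
      using ex_nat_multiple_cong[of "u * x + d" "int p" z] p prime_gt_0_nat by auto
    then have "q * int p dvd q * ((u * x + d) * int j - z)" by (simp add: cong_iff_dvd_diff)
    then have "e (x + q * (int j * (u * x + d))) = e y"
      by (simp add: z e_eq_iff cong_iff_dvd_diff int_m(1) algebra_simps)
    moreover have "f ` V \<subseteq> V" using ex_coordinate e_in f by fastforce
    ultimately show ?thesis using rtrancl_step[of f V "e x" "e y"] e_in pow by metis
  qed
  assume ?rhs
  then consider "[x = y] (mod int m)" | "\<not> int p dvd w * x + b" "[x = y] (mod q)"
    | "\<not> int p dvd w' * x + c" "[x = y] (mod q)" by blast
  then show "(e x, e y) \<in> ?R\<^sup>*"
  proof cases
    case 1
    then show ?thesis using e_eq_iff by (metis rtrancl.rtrancl_refl)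
  next
    case 2
    then show ?thesis using one[OF g(2)] rtrancl_mono[of "step V g" ?R] by blast
  next
    case 3
    then show ?thesis using one[OF h(2)] rtrancl_mono[of "step V h" ?R] by blast
  qed
qed

text \<open>The orbits are determined by the roots of \<open>w * x + b\<close> modulo
  \<open>p\<close>, and the join corresponds to the intersection of the two root sets. A root set is
  empty, a single class or everything; so either one contains the other and \<open>g\<close> or
  \<open>h\<close> serves, or they are disjoint and the translation by \<open>q\<close>, which has
  no root, serves.\<close>

lemma join_small:
  assumes g: "g \<in> G" "\<And>x. g (e x) = e ((1 + q * w) * x + q * b)"
    and h: "h \<in> G" "\<And>x. h (e x) = e ((1 + q * w') * x + q * c)"
  shows "\<exists>k\<in>G. same_orbits V k g h"
proof -
  let ?R = "step V g \<union> step V h"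
  have B: "g \<in> Bij V" "h \<in> Bij V" using g h by (auto simp: affine_group_def)
  have sub: "?R \<subseteq> V \<times> V" using step_in B by blast
  have gf: "g (e x) = e (x + q * (w * x + b))" and hf: "h (e x) = e (x + q * (w' * x + c))" for x
    by (simp_all add: g(2) h(2) algebra_simps)
  have *: "(step V k)\<^sup>* = ?R\<^sup>*"
    if k: "k \<in> G" "\<And>x. k (e x) = e (x + q * (u * x + d))"
      and roots: "\<And>x. int p dvd u * x + d \<longleftrightarrow> int p dvd w * x + b \<and> int p dvd w' * x + c"
    for k u d
  proof (rule rtrancl_eqI[OF step_in sub])
    show kB: "k \<in> Bij V" using k by (auto simp: affine_group_def)
    show "(e x, e y) \<in> (step V k)\<^sup>* \<longleftrightarrow> (e x, e y) \<in> ?R\<^sup>*" for x y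
      using rtrancl_small[OF kB k(2) kB k(2), of x y] rtrancl_small[OF B(1) gf B(2) hf, of x y]
        roots[of x] by simp
  qed
  show ?thesis
  proof (cases "(\<forall>x. int p dvd w * x + b \<longrightarrow> int p dvd w' * x + c) \<or>
      (\<forall>x. int p dvd w' * x + c \<longrightarrow> int p dvd w * x + b)")
    case True
    then show ?thesis using *[OF g(1) gf] *[OF h(1) hf] g(1) h(1) by blast
  next
    case False
    then obtain x1 x2 where x1: "int p dvd w * x1 + b" "\<not> int p dvd w' * x1 + c"
      and x2: "\<not> int p dvd w * x2 + b" by blast
    have "\<not> (int p dvd w * x + b \<and> int p dvd w' * x + c)" for x
    proof
      assume x: "int p dvd w * x + b \<and> int p dvd w' * x + c"
      have "int p dvd w * (x - x1)" using dvd_diff[OF conjunct1[OF x] x1(1)] by (simp add: algebra_simps)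
      moreover have "\<not> int p dvd w"
      proof
        assume "int p dvd w"
        then have "int p dvd w * (x2 - x1) + (w * x1 + b)"
          by (rule dvd_add[OF dvd_mult2 x1(1)])
        then show False using x2 by (simp add: algebra_simps)
      qed
      ultimately have "int p dvd x - x1" using prime_p prime_dvd_mult_iff by blast
      then have "int p dvd (w' * x + c) - w' * (x - x1)" using x by (intro dvd_diff) auto
      then show False using x1(2) by (simp add: algebra_simps)
    qed
    moreover have "\<not> int p dvd 1" using not_prime_unit[of "int p"] prime_p by blast
    moreover obtain k where "k \<in> G" "\<And>x. k (e x) = e (x + q * (0 * x + 1))"
      using ex_G[of 0 q] by auto
    ultimately show ?thesis using *[of k 0 1] by auto
  qed
qed

lemma ex_power_decomposition:
  fixes b :: int
  assumes "\<not> int p ^ k dvd b"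
  shows "\<exists>v b'. v < k \<and> b = int p ^ v * b' \<and> \<not> int p dvd b'"
proof -
  have "b \<noteq> 0" using assms by auto
  moreover have "\<not> int p dvd 1" using not_prime_unit[of "int p"] prime_p by blast
  ultimately obtain b' where b': "b = int p ^ multiplicity (int p) b * b'" "\<not> int p dvd b'"
    using multiplicity_decompose'[of b "int p"] by blast
  have "multiplicity (int p) b < k"
    using assms b'(1) by (metis dvd_triv_left dvd_trans le_imp_power_dvd not_le)
  then show ?thesis using b' by blast
qed

text \<open>The cases compare the powers of \<open>p\<close> in the two translation parts. The map
  with the smaller power governs the join when that power is below \<open>p ^ (a - 1)\<close>; if
  both parts are divisible by \<open>q\<close>, \<open>join_small\<close> applies.\<close>

lemma orbit_join_closed_prime_power: "orbit_join_closed V G"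
  unfolding orbit_join_closed_def
proof (intro ballI)
  have large: "\<exists>k\<in>G. same_orbits V k g h"
    if g: "g \<in> G" "\<And>x. g (e x) = e ((1 + q * w) * x + int p ^ v * b')" and b': "\<not> int p dvd b'" "v < a - 1"
      and h: "h \<in> G" "\<And>x. h (e x) = e ((1 + q * w') * x + c)" "int p ^ v dvd c" for g h w w' v b' c
  proof (cases "p = 2 \<and> a = 2")
    case True
    then have "v = 0" using b'(2) by simp
    then have "\<not> int p dvd int p ^ v * b'" using b'(1) by simp
    then show ?thesis using join_dihedral[OF g h(1,2)] True by blast
  next
    case False
    have "v + 1 < a" using b'(2) by simp
    from join_large[OF g h(1,2) b'(1) this h(3) False] show ?thesis .
  qed
  fix g h assume gG: "g \<in> G" and hG: "h \<in> G"
  obtain w b where g: "\<And>x. g (e x) = e ((1 + q * w) * x + b)" using G_cases[OF gG] by metis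
  obtain w' c where h: "\<And>x. h (e x) = e ((1 + q * w') * x + c)" using G_cases[OF hG] by metis
  have flip: "\<exists>k\<in>G. same_orbits V k g h"
    if c: "c = int p ^ v * c'" "\<not> int p dvd c'" "v < a - 1" and b: "int p ^ v dvd b" for v c'
    using large[OF hG h[unfolded c(1)] c(2,3) gG g b] by (simp add: Un_commute)
  show "\<exists>k\<in>G. same_orbits V k g h"
  proof (cases "q dvd b")
    case True
    show ?thesis
    proof (cases "q dvd c")
      case True
      with \<open>q dvd b\<close> obtain b1 c1 where "b = q * b1" "c = q * c1" by (auto elim!: dvdE)
      then show ?thesis using join_small gG hG g h by blast
    next
      case False
      then obtain v c' where c: "c = int p ^ v * c'" "\<not> int p dvd c'" "v < a - 1"
        using ex_power_decomposition[of "a - 1" c, folded q] by blast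
      have "int p ^ v dvd b" using c(3) \<open>q dvd b\<close> unfolding q
        by (meson dvd_trans le_imp_power_dvd less_imp_le)
      then show ?thesis using flip c by blast
    qed
  next
    case False
    then obtain v b' where b: "b = int p ^ v * b'" "\<not> int p dvd b'" "v < a - 1"
      using ex_power_decomposition[of "a - 1" b, folded q] by blast
    show ?thesis
    proof (cases "int p ^ v dvd c")
      case True
      then show ?thesis using large[OF gG g[unfolded b(1)] b(2,3) hG h] by blast
    next
      case False
      then obtain v' c' where c: "c = int p ^ v' * c'" "\<not> int p dvd c'" "v' < v"
        using ex_power_decomposition[of v c] by blast
      have "int p ^ v' dvd b" unfolding b(1) using c(3) by (intro dvd_mult2 le_imp_power_dvd) simp
      then show ?thesis using flip[OF c(1,2)] c(3) b(3) by auto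
    qed
  qed
qed

end

section \<open>The groups of the classification\<close>

lemma unipotent_power_cong:
  fixes q w M :: int
  assumes "M dvd q * q"
  shows "[(1 + q * w) ^ i = 1 + q * (int i * w)] (mod M)"
proof (induction i)
  case (Suc i)
  have "[(1 + q * w) * (1 + q * w) ^ i = (1 + q * w) * (1 + q * (int i * w))] (mod M)"
    using Suc by (rule cong_scalar_left)
  also have "(1 + q * w) * (1 + q * (int i * w)) = 1 + q * (int (Suc i) * w) + (q * q) * (w * (int i * w))"
    by (simp add: algebra_simps)
  also have "[\<dots> = 1 + q * (int (Suc i) * w) + 0] (mod M)"
    using assms by (intro cong_add cong_refl) (simp add: cong_0_iff)
  finally show ?case by simp
qed simp

text \<open>Coprimality makes the \<open>r\<close>-th power map an automorphism, so it survives in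
  \<open>subgroup_generated\<close>, and by finiteness its nonnegative powers exhaust the generated
  group. \<open>integer_mod_group\<close> being additive, that map is multiplication by
  \<open>r\<close>.\<close>

lemma power_extension_carrier:
  fixes m r :: nat
  defines "K \<equiv> integer_mod_group m"
  assumes m: "m > 0" and r: "coprime (int r) (int m)"
  shows "carrier (power_extension K r) = {0..<int m} \<times> {\<lambda>x\<in>{0..<int m}. (int r ^ i * x) mod int m |i. True}"
    and "\<And>k l s t. s \<in> Bij {0..<int m} \<Longrightarrow> t \<in> Bij {0..<int m} \<Longrightarrow>
      (k, s) \<otimes>\<^bsub>power_extension K r\<^esub> (l, t) = ((k + s l) mod int m, compose {0..<int m} s t)"
    and "\<And>i. (\<lambda>x\<in>{0..<int m}. (int r ^ i * x) mod int m) \<in> Bij {0..<int m}"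
proof -
  let ?M = "{0..<int m}"
  let ?f = "\<lambda>x\<in>?M. (int r * x) mod int m"
  interpret C: cyclic_coords ?M "\<lambda>x. x mod int m" m using m by (rule cyclic_coords_int)
  interpret K: group K unfolding K_def by simp
  interpret Aut: group "AutoGroup K" by (rule K.AutoGroup)
  have carr: "carrier K = ?M" using m by (simp add: K_def carrier_integer_mod_group)
  have mul: "(\<lambda>x\<in>?M. (s * x) mod int m) \<in> Bij ?M" if s: "coprime s (int m)" for s
  proof -
    obtain g where g: "g \<in> Bij ?M" "\<forall>x. g (x mod int m) = (s * x + 0) mod int m"
      using C.ex_affine[OF s, of 0] by blast
    have "g x = (s * x) mod int m" if "x \<in> ?M" for x using that spec[OF g(2), of x] by simp
    then have "g = (\<lambda>x\<in>?M. (s * x) mod int m)"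
      using g(1) by (intro extensionalityI[of g ?M]) (auto simp: Bij_def)
    then show ?thesis using g(1) by simp
  qed
  show pow_Bij: "(\<lambda>x\<in>?M. (int r ^ i * x) mod int m) \<in> Bij ?M" for i
    using r by (intro mul) simp
  have f_Bij: "?f \<in> Bij ?M" using r by (rule mul)
  moreover have "?f \<in> hom K K"
    using m unfolding hom_def carr
    by (auto simp: K_def mod_simps algebra_simps)
  ultimately have f: "?f \<in> carrier (AutoGroup K)" by (simp add: AutoGroup_def auto_def carr)
  have carrA: "carrier (AutoGroup K) \<subseteq> Bij ?M" by (auto simp: AutoGroup_def auto_def carr)
  have multA: "s \<otimes>\<^bsub>AutoGroup K\<^esub> t = compose ?M s t" if "s \<in> Bij ?M" "t \<in> Bij ?M" for s t
    using that by (simp add: AutoGroup_def BijGroup_def carr)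
  have pow: "?f [^]\<^bsub>AutoGroup K\<^esub> i = (\<lambda>x\<in>?M. (int r ^ i * x) mod int m)" for i :: nat
  proof (induction i)
    case 0
    show ?case by (auto simp: AutoGroup_def BijGroup_def carr fun_eq_iff restrict_def)
  next
    case (Suc i)
    have "?f [^]\<^bsub>AutoGroup K\<^esub> Suc i = compose ?M (\<lambda>x\<in>?M. (int r ^ i * x) mod int m) ?f"
      unfolding Aut.nat_pow_Suc Suc by (rule multA[OF pow_Bij f_Bij])
    also have "\<dots> = (\<lambda>x\<in>?M. (int r ^ Suc i * x) mod int m)"
      using m by (auto simp: compose_def fun_eq_iff restrict_def mod_simps ac_simps)
    finally show ?case .
  qed
  have f_eq: "(\<lambda>x\<in>carrier K. x [^]\<^bsub>K\<^esub> r) = ?f"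
    unfolding carr using carr by (intro restrict_ext) (simp add: K_def)
  have finA: "finite (carrier (AutoGroup K))" using carrA finite_Bij[of ?M] by (rule finite_subset) simp
  have gen: "carrier (subgroup_generated (AutoGroup K) {?f}) = {?f [^]\<^bsub>AutoGroup K\<^esub> i |i. i \<in> (UNIV :: nat set)}"
    using f by (simp add: carrier_subgroup_generated Aut.generate_pow_on_finite_carrier[OF finA])
  show "carrier (power_extension K r) = ?M \<times> {\<lambda>x\<in>?M. (int r ^ i * x) mod int m |i. True}"
    unfolding power_extension_def semidirect_product_def partial_object.select_convs f_eq
    unfolding gen carr pow by simp
  show "(k, s) \<otimes>\<^bsub>power_extension K r\<^esub> (l, t) = ((k + s l) mod int m, compose ?M s t)"
    if "s \<in> Bij ?M" "t \<in> Bij ?M" for k l s t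
    using multA[OF that] by (simp add: power_extension_def semidirect_product_def K_def)
qed

lemma faithful_by_power_extension:
  assumes m: "m > 0" and r: "coprime (int r) (int m)"
  shows "faithful_by (power_extension (integer_mod_group m) r) {0..<int m} (semidirect_action (integer_mod_group m))"
proof -
  let ?M = "{0..<int m}" and ?P = "power_extension (integer_mod_group m) r"
    and ?act = "semidirect_action (integer_mod_group m)"
  let ?f = "\<lambda>i. \<lambda>x\<in>?M. (int r ^ i * x) mod int m"
  note carr = power_extension_carrier(1)[OF m r] and mult = power_extension_carrier(2)[OF m r]
    and Bij = power_extension_carrier(3)[OF m r]
  have carrK: "carrier (integer_mod_group m) = ?M" using m by (simp add: carrier_integer_mod_group)
  have act: "?act (k, s) x = (k + s x) mod int m" if "x \<in> ?M" for k s x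
    using that by (simp add: semidirect_action_def carrK)
  have comp: "compose ?M (?f i) (?f j) = ?f (i + j)" for i j
    using m by (auto simp: compose_def fun_eq_iff restrict_def mod_simps power_add ac_simps)
  show ?thesis unfolding faithful_by_def
  proof (intro conjI ballI impI)
    fix g assume "g \<in> carrier ?P"
    then obtain k i where g: "g = (k, ?f i)" "k \<in> ?M" using carr by auto
    show "?act g ` ?M \<subseteq> ?M" using m by (auto simp: g act)
    fix h assume "h \<in> carrier ?P"
    then obtain l j where h: "h = (l, ?f j)" "l \<in> ?M" using carr by auto
    have gh: "g \<otimes>\<^bsub>?P\<^esub> h = ((k + ?f i l) mod int m, ?f (i + j))"
      unfolding g(1) h(1) mult[OF Bij Bij] comp ..
    show "g \<otimes>\<^bsub>?P\<^esub> h \<in> carrier ?P" unfolding gh carr using m by auto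
    show "?act (g \<otimes>\<^bsub>?P\<^esub> h) x =
        ?act g (?act h x)" if x: "x \<in> ?M" for x
    proof -
      have in_M: "(l + ?f j x) mod int m \<in> ?M" using m by simp
      have "?act g (?act h x) =
          (k + int r ^ i * (l + int r ^ j * x)) mod int m"
        unfolding h(1) act[OF x] g(1) act[OF in_M] using x in_M by (simp add: mod_simps)
      also have "\<dots> = ?act (g \<otimes>\<^bsub>?P\<^esub> h) x"
        unfolding gh act[OF x] using x h(2) by (simp add: mod_simps power_add algebra_simps)
      finally show ?thesis ..
    qed
    assume eq: "\<forall>x\<in>?M. ?act g x = ?act h x"
    have *: "(k + int r ^ i * x) mod int m = (l + int r ^ j * x) mod int m" if "x \<in> ?M" for x
      using bspec[OF eq that] that by (simp add: g h act mod_simps)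
    \<comment> \<open>Evaluation at 0 isolates the translation component; cancelling it identifies
      the automorphisms.\<close>
    have kl: "k = l" using *[of 0] m g(2) h(2) by simp
    have "?f i = ?f j"
    proof (rule restrict_ext)
      fix x assume "x \<in> ?M"
      then have "[k + int r ^ i * x = k + int r ^ j * x] (mod int m)" using * kl by (simp add: cong_def)
      then show "(int r ^ i * x) mod int m = (int r ^ j * x) mod int m"
        by (simp add: cong_add_lcancel) (simp add: cong_def)
    qed
    then show "g = h" by (simp add: g h kl)
  qed
qed

text \<open>Modulo \<open>p ^ a\<close> the powers of \<open>r = 1 + q\<close> are
  \<open>1 + i * q\<close>, where \<open>q = p ^ (a - 1)\<close>. A multiplier
  \<open>1 + q * w\<close> is thus the power of \<open>r\<close> with exponent
  \<open>w mod p\<close>, and the extension contains every multiplier congruent to 1 modulo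
  \<open>q\<close>.\<close>

lemma power_extension_isomorphic:
  fixes p a :: nat and V :: "'a set"
  assumes p: "prime p" and a: "a \<ge> 2"
    and C: "cyclic_coords V e (p ^ a)"
  defines "G \<equiv> affine_group V e {s. [s = 1] (mod int p ^ (a - 1))}" and "K \<equiv> integer_mod_group (p ^ a)"
  shows "action_isomorphic (perm_group V G) V (\<lambda>g. g)
    (power_extension K (p ^ (a - 1) + 1)) (carrier K) (semidirect_action K)"
proof -
  let ?m = "p ^ a" and ?r = "p ^ (a - 1) + 1" and ?q = "int p ^ (a - 1)"
  let ?M = "{0..<int ?m}"
  let ?f = "\<lambda>i. \<lambda>x\<in>?M. (int ?r ^ i * x) mod int ?m"
  interpret C: cyclic_coords V e ?m by fact
  note cop = coprime_unipotent[OF _ a]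
  have r1: "[int ?r = 1] (mod ?q)" by (simp add: cong_iff_dvd_diff)
  note r = cop[OF r1]
  have carrK: "carrier K = ?M" using C.m_pos by (simp add: K_def carrier_integer_mod_group)
  have m: "int ?m = ?q * int p" using a by (simp flip: power_Suc2)
  have r_pow: "[int ?r ^ i = 1 + int i * ?q] (mod int ?m)" for i
  proof -
    have "int p dvd ?q" using a by (simp add: dvd_power)
    then have "int ?m dvd ?q * ?q" unfolding m by (intro mult_dvd_mono) auto
    from unipotent_power_cong[OF this, of 1 i] show ?thesis by (simp add: ac_simps)
  qed
  obtain c where c: "bij_betw c V ?M" "\<And>x. c (e x) = x mod int ?m"
    using coordinate_change[OF C cyclic_coords_int[OF C.m_pos]] by blast
  have carrP: "carrier (power_extension K ?r) = ?M \<times> {?f i |i. True}"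
    unfolding K_def by (rule power_extension_carrier(1)[OF C.m_pos r])
  have mem: "(b mod int ?m, ?f i) \<in> carrier (power_extension K ?r)" for b i
    unfolding carrP using pos_mod_bound[of "int ?m" b] pos_mod_sign[of "int ?m" b] C.m_pos
    by (intro SigmaI CollectI exI[of _ i] conjI TrueI refl) (simp del: of_nat_power)
  have match: "\<forall>y\<in>V. c (g y) = semidirect_action K (b mod int ?m, ?f i) (c y)"
    if g: "\<forall>x. g (e x) = e (s * x + b)" and s: "[s = int ?r ^ i] (mod int ?m)" for g s b i
  proof
    fix y assume "y \<in> V"
    then obtain x where x: "y = e x" using C.ex_coordinate by blast
    have "x mod int ?m \<in> ?M" using C.m_pos by simp
    then have "semidirect_action K (b mod int ?m, ?f i) (c y) =
        (b + int ?r ^ i * x) mod int ?m"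
      unfolding semidirect_action_def x c(2) carrK by (simp add: K_def mod_simps del: of_nat_power of_nat_add)
    moreover have "[b + s * x = b + int ?r ^ i * x] (mod int ?m)"
      using s by (intro cong_add cong_scalar_right cong_refl)
    ultimately show "c (g y) = semidirect_action K (b mod int ?m, ?f i) (c y)"
      using g by (simp add: x c(2) cong_def add.commute)
  qed
  have one: "1 \<in> {s. [s = 1] (mod ?q)}" by simp
  have mult: "s * t \<in> {s. [s = 1] (mod ?q)}" if "s \<in> {s. [s = 1] (mod ?q)}" "t \<in> {s. [s = 1] (mod ?q)}" for s t
    using cong_mult[of s 1 ?q t 1] that by simp
  show ?thesis unfolding carrK
  proof (rule action_isomorphicI[OF _ _ c(1)])
    show "faithful_by (perm_group V G) V (\<lambda>g. g)"
      unfolding G_def using C.subgroup_affine_group[OF one mult] by (rule faithful_by_perm_group)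
    show "faithful_by (power_extension K ?r) ?M (semidirect_action K)"
      unfolding K_def by (rule faithful_by_power_extension[OF C.m_pos r])
    show "\<exists>h\<in>carrier (power_extension K ?r). \<forall>x\<in>V. c (g x) = semidirect_action K h (c x)"
      if g: "g \<in> carrier (perm_group V G)" for g
    proof -
      obtain s b where s: "[s = 1] (mod ?q)" "\<forall>x. g (e x) = e (s * x + b)"
        using g by (auto simp: G_def affine_group_def)
      obtain w where w: "s = 1 + ?q * w" using s(1) by (metis cong_iff_lin cong_sym)
      have "p > 0" using p by (rule prime_gt_0_nat)
      have "[int ?r ^ nat (w mod int p) = 1 + (w mod int p) * ?q] (mod int ?m)"
        using r_pow[of "nat (w mod int p)"] \<open>p > 0\<close> by simp
      moreover have "[1 + (w mod int p) * ?q = s] (mod int ?m)"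
      proof -
        have "w mod int p = w - int p * (w div int p)" by (simp add: minus_mult_div_eq_mod)
        then have "1 + (w mod int p) * ?q - s = int ?m * (- (w div int p))"
          unfolding m w by (simp only:) (simp add: algebra_simps del: of_nat_power)
        then show ?thesis by (simp add: cong_iff_dvd_diff del: of_nat_power)
      qed
      ultimately have "[s = int ?r ^ nat (w mod int p)] (mod int ?m)" by (meson cong_sym cong_trans)
      from match[OF s(2) this] mem show ?thesis by (rule bexI)
    qed
    show "\<exists>g\<in>carrier (perm_group V G). \<forall>x\<in>V. c (g x) = semidirect_action K h (c x)"
      if h: "h \<in> carrier (power_extension K ?r)" for h
    proof -
      obtain b i where h: "h = (b, ?f i)" "b \<in> ?M" using h carrP by auto
      have s: "[int ?r ^ i = 1] (mod ?q)" using cong_pow[OF r1, of i] by simp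
      obtain g where g: "g \<in> G" "\<forall>x. g (e x) = e (int ?r ^ i * x + b)"
        using C.ex_affine_group[of "int ?r ^ i" "{s. [s = 1] (mod ?q)}" b] s cop[OF s] by (auto simp: G_def)
      have "b mod int ?m = b" using h(2) by simp
      then show ?thesis using match[OF g(2) cong_refl] g(1) h(1) by auto
    qed
  qed
qed

lemma AGL1_residue_ring:
  assumes p: "prime p"
  shows "carrier (residue_ring (int p)) = {0..<int p}"
    and "AGL1 (residue_ring (int p)) = affine_group {0..<int p} (\<lambda>x. x mod int p) {s. coprime s (int p)}"
proof -
  let ?F = "residue_ring (int p)" and ?M = "{0..<int p}" and ?e = "\<lambda>x. x mod int p"
  interpret residues_prime p ?F by unfold_locales (use p in auto)
  have p1: "p > 1" using p by (rule prime_gt_1_nat)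
  then have p0: "p > 0" by simp
  interpret C: cyclic_coords ?M ?e p using p0 by (rule cyclic_coords_int)
  show carr: "carrier ?F = ?M" by (auto simp: res_carrier_eq)
  have unit: "coprime s (int p) \<longleftrightarrow> s mod int p \<in> Units ?F" for s
  proof -
    have nz: "s mod int p \<noteq> 0" if "coprime s (int p)"
    proof
      assume "s mod int p = 0"
      then have "int p dvd s" by auto
      then have "int p dvd 1" using coprime_common_divisor[OF that, of "int p"] by simp
      then show False using p1 by simp
    qed
    have "int p > 0" using p0 by simp
    then have "0 \<le> s mod int p" by (rule pos_mod_sign)
    then have "s mod int p > 0" if "coprime s (int p)" using nz[OF that] by linarith
    moreover have "s mod int p < int p" using \<open>int p > 0\<close> by (rule pos_mod_bound)
    moreover have "coprime (s mod int p) (int p) \<longleftrightarrow> coprime s (int p)"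
      using p0 by (intro coprime_mod_left_iff) simp
    ultimately show ?thesis unfolding res_units_eq by blast
  qed
  show "AGL1 ?F = affine_group ?M ?e {s. coprime s (int p)}"
  proof (intro equalityI subsetI)
    fix g assume "g \<in> AGL1 ?F"
    then obtain s b where s: "s \<in> Units ?F" "b \<in> ?M" and "g = (\<lambda>x\<in>?M. s \<otimes>\<^bsub>?F\<^esub> x \<oplus>\<^bsub>?F\<^esub> b)"
      unfolding AGL1_def carr by blast
    then have g: "g = (\<lambda>x\<in>?M. (s * x + b) mod int p)" by (simp add: res_mult_eq res_add_eq mod_simps)
    have "coprime s (int p)" using s(1) by (simp add: res_units_eq)
    then obtain h where h: "h \<in> affine_group ?M ?e {s. coprime s (int p)}" "\<forall>x. h (?e x) = ?e (s * x + b)"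
      using C.ex_affine_group[of s "{s. coprime s (int p)}" b] by auto
    have "h x = g x" if "x \<in> ?M" for x using spec[OF h(2), of x] that by (simp add: g)
    then have "h = g" using h(1)
      by (intro extensionalityI[of h ?M]) (auto simp: affine_group_def Bij_def g)
    then show "g \<in> affine_group ?M ?e {s. coprime s (int p)}" using h(1) by simp
  next
    fix g assume "g \<in> affine_group ?M ?e {s. coprime s (int p)}"
    then obtain s b where g: "g \<in> Bij ?M" "coprime s (int p)" "\<forall>x. g (?e x) = ?e (s * x + b)"
      by (auto simp: affine_group_def)
    have "g x = ?e s \<otimes>\<^bsub>?F\<^esub> x \<oplus>\<^bsub>?F\<^esub> ?e b" if "x \<in> ?M" for x
      using spec[OF g(3), of x] that by (simp add: res_mult_eq res_add_eq mod_simps)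
    then have "g = (\<lambda>x\<in>?M. ?e s \<otimes>\<^bsub>?F\<^esub> x \<oplus>\<^bsub>?F\<^esub> ?e b)"
      using g(1) by (intro extensionalityI[of g ?M]) (auto simp: Bij_def)
    moreover have "?e s \<in> Units ?F" using g(2) unit by simp
    moreover have "?e b \<in> carrier ?F" using p0 by (simp add: carr)
    ultimately show "g \<in> AGL1 ?F" unfolding AGL1_def carr[symmetric] by blast
  qed
qed

section \<open>Groups with a regular normal cyclic subgroup\<close>

text \<open>For a generator \<open>g0\<close> of \<open>N\<close> and a base point
  \<open>x0\<close>, the point numbered \<open>k\<close> is the image of \<open>x0\<close> under the
  \<open>k\<close>-th power of \<open>g0\<close>. Regularity makes the period exactly
  \<open>n\<close>. Normality makes the conjugate of \<open>g0\<close> by \<open>g\<close> a power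
  of \<open>g0\<close>, and its exponent is the multiplier \<open>s\<close> of
  \<open>g\<close>.\<close>

lemma ex_affine_coordinates:
  fixes V :: "'a set"
  assumes G: "subgroup G (BijGroup V)" and N: "normal N (perm_group V G)"
    and cyc: "cyclic_group (perm_group V N)" and order: "Coset.order (perm_group V N) = n"
    and fin: "finite V" and card: "card V = n" and reg: "regular_perm_group V N"
  shows "\<exists>e. cyclic_coords V e n \<and> (\<forall>g\<in>G. \<exists>s b. \<forall>x. g (e x) = e (s * x + b)) \<and>
    (\<forall>b. \<exists>g\<in>G. \<forall>x. g (e x) = e (x + b))"
proof -
  let ?P = "perm_group V N"
  have subN: "subgroup N (BijGroup V)"
    and trans: "x \<in> V \<Longrightarrow> y \<in> V \<Longrightarrow> \<exists>g\<in>N. g x = y" for x y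
    using reg transitive_action.unique_orbit[of ?P V "\<lambda>g. g"]
    by (auto simp: regular_perm_group_def transitive_perm_group_def)
  have stab: "g = \<one>\<^bsub>?P\<^esub>" if "x \<in> V" "g \<in> N" "g x = x" for g x
    using reg that by (auto simp: regular_perm_group_def stabilizer_def)
  interpret group ?P using subN by (rule group_perm_group)
  have N_Bij: "N \<subseteq> Bij V" by (rule subgroup_subset_Bij[OF subN])
  obtain g0 where g0: "g0 \<in> N" "subgroup_generated ?P {g0} = ?P" using cyc by (auto simp: cyclic_group_def)
  then have g0c: "g0 \<in> carrier ?P" by simp
  have ord: "ord g0 = n" using cyclic_order_is_ord[OF g0c] g0(2) order by simp
  have "finite N" using finite_subset[OF N_Bij finite_Bij[OF fin]] .
  then have n: "n > 0" using order order_gt_0_iff_finite by simp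
  have N_eq: "N = range (\<lambda>k::int. g0 [^]\<^bsub>?P\<^esub> k)"
    using carrier_subgroup_generated_by_singleton[OF g0c] g0(2) by simp
  have G_Bij: "G \<subseteq> Bij V" by (rule subgroup_subset_Bij[OF G])
  have NG: "N \<subseteq> G" using normal_imp_subgroup[OF N] subgroup.subset by fastforce
  have "V \<noteq> {}" using n card by auto
  then obtain x0 where x0: "x0 \<in> V" by blast
  define e where "e k = (g0 [^]\<^bsub>?P\<^esub> k) x0" for k :: int
  have pow_N: "g0 [^]\<^bsub>?P\<^esub> k \<in> N" for k :: int using N_eq by blast
  have e_in: "e k \<in> V" for k unfolding e_def by (rule BijD[OF subsetD[OF N_Bij pow_N] x0])
  have shift: "(g0 [^]\<^bsub>?P\<^esub> k) (e l) = e (k + l)" for k l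
    using int_pow_mult[OF g0c, of k l] mult_perm_group[OF subN pow_N pow_N x0, of k l] by (simp add: e_def)
  have e_eq: "e x = e y \<longleftrightarrow> [x = y] (mod int n)" for x y
  proof
    assume "[x = y] (mod int n)"
    then have "g0 [^]\<^bsub>?P\<^esub> x = g0 [^]\<^bsub>?P\<^esub> y"
      using int_pow_eq[OF g0c] ord by (simp add: cong_iff_dvd_diff dvd_diff_commute)
    then show "e x = e y" by (simp add: e_def)
  next
    assume eq: "e x = e y"
    have "e (x - y) = e 0" using shift[of "- y" x] shift[of "- y" y] eq by simp
    then have "(g0 [^]\<^bsub>?P\<^esub> (x - y)) x0 = x0" using x0 by (simp add: e_def)
    then have "g0 [^]\<^bsub>?P\<^esub> (x - y) = \<one>\<^bsub>?P\<^esub>" using stab[OF x0 pow_N] by simp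
    then show "[x = y] (mod int n)"
      using int_pow_eq_id[OF g0c] ord by (simp add: cong_iff_dvd_diff)
  qed
  have "V \<subseteq> range e"
  proof
    fix y assume "y \<in> V"
    then obtain g where g: "g \<in> N" "g x0 = y" using trans x0 by blast
    then obtain k :: int where "g = g0 [^]\<^bsub>?P\<^esub> k" using N_eq by blast
    then have "y = e k" using g(2) by (simp add: e_def)
    then show "y \<in> range e" by simp
  qed
  then have range_e: "range e = V" using e_in by blast
  have coords: "cyclic_coords V e n" using n range_e e_eq by unfold_locales
  have "\<exists>s b. \<forall>x. g (e x) = e (s * x + b)" if g: "g \<in> G" for g
  proof -
    interpret G: group "perm_group V G" using G by (rule group_perm_group)
    have gc: "g \<in> carrier (perm_group V G)" "g0 \<in> carrier (perm_group V G)" using g g0(1) NG by auto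
    let ?h = "g \<otimes>\<^bsub>perm_group V G\<^esub> g0 \<otimes>\<^bsub>perm_group V G\<^esub> inv\<^bsub>perm_group V G\<^esub> g"
    have hN: "?h \<in> N" using normal.inv_op_closed2[OF N gc(1)] g0(1) by simp
    then obtain s :: int where s: "?h = g0 [^]\<^bsub>?P\<^esub> s" using N_eq by blast
    obtain b where b: "g (e 0) = e b"
      using G_Bij g e_in range_e by (metis BijD rangeE subsetD)
    have gc': "g0 [^]\<^bsub>?P\<^esub> s \<in> G" using pow_N NG by blast
    have inter: "g (g0 y) = (g0 [^]\<^bsub>?P\<^esub> s) (g y)" if y: "y \<in> V" for y
    proof -
      have "?h \<otimes>\<^bsub>perm_group V G\<^esub> g = g \<otimes>\<^bsub>perm_group V G\<^esub> g0"
        using gc by (simp add: G.m_assoc del: carrier_perm_group one_perm_group)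
      then have "(g \<otimes>\<^bsub>perm_group V G\<^esub> g0) y = (g0 [^]\<^bsub>?P\<^esub> s \<otimes>\<^bsub>perm_group V G\<^esub> g) y"
        unfolding s by simp
      then show ?thesis
        using mult_perm_group[OF G g _ y, of g0] mult_perm_group[OF G gc' g y] g0(1) NG by auto
    qed
    have nat: "g (e (int k)) = e (s * int k + b)" for k
    proof (induction k)
      case (Suc k)
      have "g0 (e (int k)) = e (int (Suc k))" using shift[of 1 "int k"] g0c by simp
      then have "g (e (int (Suc k))) = (g0 [^]\<^bsub>?P\<^esub> s) (g (e (int k)))" using inter[OF e_in] by metis
      also have "\<dots> = e (s * int (Suc k) + b)" unfolding Suc shift by (simp add: algebra_simps)
      finally show ?case .
    qed (simp add: b)
    have "g (e x) = e (s * x + b)" for x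
    proof -
      have x: "[x = int (nat (x mod int n))] (mod int n)" using n by simp
      then have "[s * x + b = s * int (nat (x mod int n)) + b] (mod int n)"
        by (intro cong_add cong_scalar_left cong_refl)
      then show ?thesis using nat[of "nat (x mod int n)"] x e_eq by metis
    qed
    then show ?thesis by blast
  qed
  moreover have "\<exists>g\<in>G. \<forall>x. g (e x) = e (x + b)" for b
    using pow_N[of b] NG shift[of b] by (intro bexI[of _ "g0 [^]\<^bsub>?P\<^esub> b"]) (auto simp: add.commute)
  ultimately show ?thesis using coords by blast
qed


text \<open>\<open>A\<close> collects the multipliers of the elements of \<open>G\<close> fixing
  \<open>e 0\<close>. Since \<open>G\<close> contains all translations, every affine map in
  \<open>G\<close> can be corrected to one of these.\<close>

lemma ex_affine_group_representation:
  fixes V :: "'a set"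
  assumes G: "subgroup G (BijGroup V)" and N: "normal N (perm_group V G)"
    and "cyclic_group (perm_group V N)" "Coset.order (perm_group V N) = n"
    and "finite V" "card V = n" "regular_perm_group V N"
  shows "\<exists>e A. cyclic_coords V e n \<and> G = affine_group V e A \<and> 1 \<in> A \<and>
    (\<forall>s\<in>A. \<forall>t\<in>A. s * t \<in> A) \<and> (\<forall>s\<in>A. coprime s (int n))"
proof -
  obtain e where C: "cyclic_coords V e n"
    and aff: "\<And>g. g \<in> G \<Longrightarrow> \<exists>s b. \<forall>x. g (e x) = e (s * x + b)"
    and tr: "\<And>b. \<exists>g\<in>G. \<forall>x. g (e x) = e (x + b)"
    using ex_affine_coordinates[OF assms] by blast
  interpret C: cyclic_coords V e n by fact
  have GB: "G \<subseteq> Bij V" by (rule subgroup_subset_Bij[OF G])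
  have comp: "compose V g h \<in> G" if "g \<in> G" "h \<in> G" for g h
    using subgroup.m_closed[OF G that] that GB by (simp add: BijGroup_def subset_iff)
  have compe: "compose V g h (e x) = g (h (e x))" for g h x by (simp add: compose_eq C.e_in)
  define A where "A = {s. \<exists>g\<in>G. \<forall>x. g (e x) = e (s * x)}"
  have cop: "coprime s (int n)" if "s \<in> A" for s
    using that GB C.coprime_multiplier[of _ s 0] by (auto simp: A_def)
  have one: "1 \<in> A" using tr[of 0] by (simp add: A_def)
  have mult: "s * t \<in> A" if st: "s \<in> A" "t \<in> A" for s t
  proof -
    obtain g h where "g \<in> G" "\<forall>x. g (e x) = e (s * x)" "h \<in> G" "\<forall>x. h (e x) = e (t * x)"
      using st by (auto simp: A_def)
    then have "compose V g h \<in> G" "\<forall>x. compose V g h (e x) = e (s * t * x)"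
      using comp by (simp_all add: compe mult.assoc)
    then show ?thesis by (auto simp: A_def)
  qed
  have "G = affine_group V e A"
  proof (intro equalityI subsetI)
    fix g assume g: "g \<in> G"
    obtain s b where s: "\<forall>x. g (e x) = e (s * x + b)" using aff[OF g] by blast
    obtain h where h: "h \<in> G" "\<forall>x. h (e x) = e (x + (- b))" using tr by blast
    have "\<forall>x. compose V h g (e x) = e (s * x)" using s h(2) by (simp add: compe)
    then have "s \<in> A" using comp[OF h(1) g] by (auto simp: A_def)
    then show "g \<in> affine_group V e A" using s g GB by (auto simp: affine_group_def)
  next
    fix g assume "g \<in> affine_group V e A"
    then obtain s b where g: "g \<in> Bij V" "s \<in> A" "\<forall>x. g (e x) = e (s * x + b)"
      by (auto simp: affine_group_def)
    then obtain g' where g': "g' \<in> G" "\<forall>x. g' (e x) = e (s * x)" by (auto simp: A_def)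
    obtain h where h: "h \<in> G" "\<forall>x. h (e x) = e (x + b)" using tr by blast
    have "compose V h g' \<in> G" by (rule comp[OF h(1) g'(1)])
    moreover have "g = compose V h g'"
      using g(1,3) g'(2) h(2) calculation GB by (intro C.Bij_eqI) (auto simp: compe)
    ultimately show "g \<in> G" by simp
  qed
  then show ?thesis using C one mult cop by blast
qed

text \<open>Cauchy's theorem, phrased for iterates of a permutation; it comes from Sylow's theorem
  with exponent 1.\<close>

lemma ex_perm_of_prime_order:
  assumes S: "subgroup S (BijGroup V)" and fin: "finite V"
    and r: "prime r" "r dvd Coset.order (perm_group V S)"
  shows "\<exists>g\<in>S. (\<forall>x\<in>V. (g ^^ r) x = x) \<and> (\<exists>x\<in>V. g x \<noteq> x)"
proof -
  let ?P = "perm_group V S"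
  interpret group ?P using S by (rule group_perm_group)
  have finS: "finite S" using subgroup_subset_Bij[OF S] finite_Bij[OF fin] by (rule finite_subset)
  obtain k where "Coset.order ?P = r ^ 1 * k" using r(2) by auto
  then obtain T where T: "subgroup T ?P" "card T = r"
    using sylow_thm[OF r(1) is_group] finS by fastforce
  have "\<not> T \<subseteq> {\<one>\<^bsub>?P\<^esub>}"
  proof
    assume "T \<subseteq> {\<one>\<^bsub>?P\<^esub>}"
    then have "card T \<le> 1" using card_mono[of "{\<one>\<^bsub>?P\<^esub>}" T] by simp
    then show False using T(2) prime_gt_1_nat[OF r(1)] by simp
  qed
  then obtain g where g: "g \<in> T" "g \<noteq> \<one>\<^bsub>?P\<^esub>" by blast
  have gS: "g \<in> S" using g(1) subgroup.subset[OF T(1)] by auto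
  interpret T: group "?P\<lparr>carrier := T\<rparr>" using T(1) by (rule subgroup.subgroup_is_group) (rule is_group)
  have "g [^]\<^bsub>?P\<^esub> r = \<one>\<^bsub>?P\<^esub>"
    using T.pow_order_eq_1[of g] g(1) T(2) by (simp add: Coset.order_def nat_pow_consistent[symmetric])
  then have "(g ^^ r) x = x" if "x \<in> V" for x
    using nat_pow_perm_group[OF S gS that, of r] that by simp
  moreover have "\<exists>x\<in>V. g x \<noteq> x"
  proof (rule ccontr)
    assume "\<not> (\<exists>x\<in>V. g x \<noteq> x)"
    then have "g = (\<lambda>x\<in>V. x)"
      using gS subgroup_subset_Bij[OF S] by (intro extensionalityI[of g V]) (auto simp: Bij_def)
    then show False using g(2) by simp
  qed
  ultimately show ?thesis using gS by blast
qed

context cyclic_coords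
begin

lemma transitive_affine_group:
  assumes one: "1 \<in> A" and mult: "\<And>s t. s \<in> A \<Longrightarrow> t \<in> A \<Longrightarrow> s * t \<in> A"
  shows "transitive_perm_group V (affine_group V e A)"
  unfolding transitive_perm_group_def
proof
  let ?S = "affine_group V e A"
  show sub: "subgroup ?S (BijGroup V)" by (rule subgroup_affine_group[OF one mult])
  have "group_hom (perm_group V ?S) (BijGroup V) (\<lambda>g. g)"
  proof (intro group_hom.intro group_hom_axioms.intro)
    show "(\<lambda>g. g) \<in> hom (perm_group V ?S) (BijGroup V)"
      using subgroup.subset[OF sub] by (auto simp: hom_def perm_group_def)
  qed (rule group_perm_group[OF sub], rule group_BijGroup)
  moreover have "\<exists>g\<in>carrier (perm_group V ?S). g x = y" if xy: "x \<in> V" "y \<in> V" for x y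
  proof -
    obtain u v where "x = e u" "y = e v" using xy ex_coordinate by metis
    moreover obtain g where "g \<in> ?S" "\<forall>x. g (e x) = e (1 * x + (v - u))"
      using ex_affine_group[OF one, of "v - u"] by auto
    ultimately show ?thesis by (intro bexI[of _ g]) auto
  qed
  ultimately show "transitive_action (perm_group V ?S) V (\<lambda>g. g)"
    by (intro transitive_action.intro group_action.intro transitive_action_axioms.intro)
qed

lemma cyclic_affine_group:
  assumes one: "1 \<in> A" and mult: "\<And>s t. s \<in> A \<Longrightarrow> t \<in> A \<Longrightarrow> s * t \<in> A"
    and triv: "\<And>s. s \<in> A \<Longrightarrow> [s = 1] (mod int m)"
  shows "cyclic_group (perm_group V (affine_group V e A))"
proof -
  let ?S = "affine_group V e A" and ?P = "perm_group V (affine_group V e A)"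
  have sub: "subgroup ?S (BijGroup V)" by (rule subgroup_affine_group[OF one mult])
  interpret group ?P using sub by (rule group_perm_group)
  obtain c where c: "c \<in> ?S" "\<And>x. c (e x) = e (1 * x + 1)" using ex_affine_group[OF one, of 1] by auto
  have pow: "(c [^]\<^bsub>?P\<^esub> k) (e x) = e (x + int k)" for k :: nat and x
  proof -
    have "(c ^^ k) (e x) = e (x + int k)" by (induction k) (simp_all add: c(2) algebra_simps)
    then show ?thesis using nat_pow_perm_group[OF sub c(1) e_in] by simp
  qed
  have "g \<in> range (\<lambda>k::int. c [^]\<^bsub>?P\<^esub> k)" if g: "g \<in> ?S" for g
  proof -
    obtain s b where s: "s \<in> A" "\<forall>x. g (e x) = e (s * x + b)" using g by (auto simp: affine_group_def)
    let ?k = "nat (b mod int m)"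
    have pS: "c [^]\<^bsub>?P\<^esub> ?k \<in> ?S" using nat_pow_closed[of c ?k] c(1) by simp
    have "g (e x) = (c [^]\<^bsub>?P\<^esub> ?k) (e x)" for x
    proof -
      have "[s * x + b = 1 * x + int ?k] (mod int m)"
        using triv[OF s(1)] m_pos by (intro cong_add cong_scalar_right) (simp_all add: cong_sym_eq)
      then show ?thesis using s(2) by (simp add: pow e_eq_iff)
    qed
    then have "g = c [^]\<^bsub>?P\<^esub> int ?k"
      unfolding int_pow_int using g pS by (intro Bij_eqI) (auto simp: affine_group_def)
    then show ?thesis by blast
  qed
  moreover have "c [^]\<^bsub>?P\<^esub> k \<in> ?S" for k :: int using int_pow_closed[of c k] c(1) by simp
  ultimately have "carrier ?P = range (\<lambda>k::int. c [^]\<^bsub>?P\<^esub> k)" by auto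
  then show ?thesis unfolding cyclic_group using c(1) by auto
qed

text \<open>The map \<open>x \<mapsto> s x\<close> lies in the group, and its iterates carry the
  point \<open>e 1\<close> through the powers of \<open>s\<close>.\<close>

lemma multiplier_power_order:
  assumes A: "1 \<in> A" "\<And>s t. s \<in> A \<Longrightarrow> t \<in> A \<Longrightarrow> s * t \<in> A"
    and s: "s \<in> A" "coprime s (int m)"
  shows "[s ^ Coset.order (perm_group V (affine_group V e A)) = 1] (mod int m)"
proof -
  let ?o = "Coset.order (perm_group V (affine_group V e A))"
  obtain g where g: "g \<in> affine_group V e A" "\<And>x. g (e x) = e (s * x + 0)"
    using ex_affine_group[OF s, of 0] by blast
  have "(g ^^ ?o) (e 1) = e 1"
    using funpow_order_perm_group[OF subgroup_affine_group[OF A] g(1) e_in] .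
  then have "[(affine s 0 ^^ ?o) 1 = 1] (mod int m)" by (simp add: funpow_affine[OF g(2)] e_eq_iff)
  moreover have "[(affine s 0 ^^ ?o) 1 = s ^ ?o * 1] (mod int m)" by (rule funpow_affine_linear) simp
  ultimately show ?thesis by (metis cong_sym cong_trans mult.right_neutral)
qed

text \<open>A translation has order dividing \<open>m\<close>, so an element of any other prime order has a nontrivial multiplier.\<close>

lemma ex_multiplier_of_prime_order:
  assumes A: "1 \<in> A" "\<And>s t. s \<in> A \<Longrightarrow> t \<in> A \<Longrightarrow> s * t \<in> A"
    and r: "prime r" "coprime r m" "r dvd Coset.order (perm_group V (affine_group V e A))"
  shows "\<exists>s\<in>A. [s ^ r = 1] (mod int m) \<and> \<not> [s = 1] (mod int m)"
proof -
  obtain g where g: "g \<in> affine_group V e A" "\<forall>x\<in>V. (g ^^ r) x = x" "\<exists>x\<in>V. g x \<noteq> x"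
    using ex_perm_of_prime_order[OF subgroup_affine_group[OF A] finite_space r(1,3)] by blast
  obtain s b where s: "s \<in> A" "\<And>x. g (e x) = e (s * x + b)" using g(1) by (auto simp: affine_group_def)
  have fix_r: "[(affine s b ^^ r) x = x] (mod int m)" for x
    using bspec[OF g(2) e_in[of x]] by (simp add: funpow_affine[OF s(2)] e_eq_iff)
  \<comment> \<open>Differences of two orbits eliminate the translation part, so the period
    \<open>r\<close> of \<open>g\<close> is inherited by the multiplier.\<close>
  have lin: "(affine s b ^^ j) x - (affine s b ^^ j) 0 = s ^ j * x" for j x
  proof (induction j)
    case (Suc j)
    have "(affine s b ^^ Suc j) x - (affine s b ^^ Suc j) 0 =
        s * ((affine s b ^^ j) x - (affine s b ^^ j) 0)"
      by (simp add: affine_def algebra_simps)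
    then show ?case by (simp add: Suc)
  qed simp
  have "[s ^ r = 1] (mod int m)"
    using cong_diff[OF fix_r[of 1] fix_r[of 0]] lin[of r 1] by simp
  moreover have "\<not> [s = 1] (mod int m)"
  proof
    assume s1: "[s = 1] (mod int m)"
    have "[(affine s b ^^ r) 0 = 0 + int r * b] (mod int m)" using s1 by (rule funpow_affine_translation)
    then have "[int r * b = 0] (mod int m)" using fix_r[of 0] by (metis add_0 cong_sym cong_trans)
    then have "int m dvd int r * b" by (simp add: cong_0_iff)
    moreover have "coprime (int m) (int r)" using r(2) by (simp add: coprime_commute)
    ultimately have "int m dvd b" by (simp add: coprime_dvd_mult_right_iff)
    then have "[s * x + b = 1 * x + 0] (mod int m)" for x
      using s1 by (intro cong_add cong_scalar_right) (simp_all add: cong_0_iff)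
    then have "g (e x) = e x" for x by (simp add: s(2) e_eq_iff)
    then show False using g(3) ex_coordinate by metis
  qed
  ultimately show ?thesis using s(1) by blast
qed

end

text \<open>Units modulo \<open>p ^ a\<close> that are 1 modulo \<open>p ^ (a - 1)\<close> form a
  group of prime order \<open>p\<close>, so the residues of \<open>A\<close> are trivial or exhaust
  it. The equality concerns affine groups because \<open>A\<close> itself is a set of
  integers.\<close>

lemma affine_group_prime_power_cases:
  fixes p a :: nat
  assumes C: "cyclic_coords V e (p ^ a)" and p: "prime p" and a: "a \<ge> 2"
    and one: "1 \<in> A" and mult: "\<And>s t. s \<in> A \<Longrightarrow> t \<in> A \<Longrightarrow> s * t \<in> A"
    and A: "\<And>s. s \<in> A \<Longrightarrow> [s = 1] (mod int p ^ (a - 1))"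
  shows "cyclic_group (perm_group V (affine_group V e A)) \<or>
    affine_group V e A = affine_group V e {s. [s = 1] (mod int p ^ (a - 1))}"
proof (cases "\<forall>s\<in>A. [s = 1] (mod int (p ^ a))")
  case True
  then show ?thesis using cyclic_coords.cyclic_affine_group[OF C one mult] by blast
next
  case False
  let ?q = "int p ^ (a - 1)"
  interpret cyclic_coords V e "p ^ a" by fact
  have m: "int (p ^ a) = ?q * int p" using a by (simp flip: power_Suc2)
  have qq: "int (p ^ a) dvd ?q * ?q" using a by (simp add: le_imp_power_dvd flip: power_add)
  obtain s where s: "s \<in> A" "\<not> [s = 1] (mod int (p ^ a))" using False by blast
  obtain w where w: "s = 1 + ?q * w" using A[OF s(1)] by (metis cong_iff_lin cong_sym)
  have "\<not> int p dvd w"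
  proof
    assume "int p dvd w"
    then have "int (p ^ a) dvd ?q * w" unfolding m by (intro mult_dvd_mono) auto
    then show False using s(2) by (simp add: w cong_iff_dvd_diff)
  qed
  then have w_cop: "coprime w (int p)"
    using prime_imp_coprime[of "int p" w] p by (simp add: coprime_commute)
  have pow: "s ^ i \<in> A" for i by (induction i) (use one mult s(1) in auto)
  have "g \<in> affine_group V e A" if g: "g \<in> affine_group V e {s. [s = 1] (mod ?q)}" for g
  proof -
    obtain t b where t: "g \<in> Bij V" "[t = 1] (mod ?q)" "\<forall>x. g (e x) = e (t * x + b)"
      using g by (auto simp: affine_group_def)
    obtain u where u: "t = 1 + ?q * u" using t(2) by (metis cong_iff_lin cong_sym)
    obtain i where i: "[w * int i = u] (mod int p)"
      using ex_nat_multiple_cong[OF w_cop] p prime_gt_0_nat by (metis of_nat_0_less_iff)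
    have "?q * int p dvd ?q * (u - w * int i)"
      using i by (intro mult_dvd_mono) (simp_all add: cong_iff_dvd_diff dvd_diff_commute)
    then have "[t = 1 + ?q * (int i * w)] (mod int (p ^ a))"
      unfolding m by (simp add: u cong_iff_dvd_diff algebra_simps)
    then have "[t = s ^ i] (mod int (p ^ a))"
      using unipotent_power_cong[OF qq, of w i] unfolding w by (meson cong_sym cong_trans)
    then have "[t * x + b = s ^ i * x + b] (mod int (p ^ a))" for x
      by (intro cong_add cong_scalar_right cong_refl)
    then have "\<forall>x. g (e x) = e (s ^ i * x + b)" using t(3) by (simp add: e_eq_iff)
    then show ?thesis using t(1) pow unfolding affine_group_def by blast
  qed
  moreover have "affine_group V e A \<subseteq> affine_group V e {s. [s = 1] (mod ?q)}"
    using A unfolding affine_group_def by blast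
  ultimately show ?thesis by blast
qed

section \<open>Prime power factors\<close>

text \<open>One set \<open>A\<close> serves all factors: the factor at \<open>i\<close> sees it
  modulo \<open>M i\<close>. Coprime degrees glue translation parts, coprime orders glue
  multipliers.\<close>

locale coordinate_product = cyclic_coords V e n
  for V :: "'a set" and e n +
  fixes I :: "'i set" and M :: "'i \<Rightarrow> nat" and D :: "'i \<Rightarrow> 'b set" and ec :: "'i \<Rightarrow> int \<Rightarrow> 'b"
    and A :: "int set"
  assumes finite_I: "finite I" and prod_M: "n = (\<Prod>i\<in>I. M i)"
    and coprime_M: "i \<in> I \<Longrightarrow> j \<in> I \<Longrightarrow> i \<noteq> j \<Longrightarrow> coprime (M i) (M j)"
    and coords: "i \<in> I \<Longrightarrow> cyclic_coords (D i) (ec i) (M i)"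
    and one: "1 \<in> A" and mult: "s \<in> A \<Longrightarrow> t \<in> A \<Longrightarrow> s * t \<in> A"
    and coprime_A: "s \<in> A \<Longrightarrow> coprime s (int n)"
    and coprime_orders: "i \<in> I \<Longrightarrow> j \<in> I \<Longrightarrow> i \<noteq> j \<Longrightarrow>
      coprime (Coset.order (perm_group (D i) (affine_group (D i) (ec i) A)))
        (Coset.order (perm_group (D j) (affine_group (D j) (ec j) A)))"
begin

abbreviation "H i \<equiv> affine_group (D i) (ec i) A"

lemma M_dvd: "i \<in> I \<Longrightarrow> M i dvd n"
  unfolding prod_M using finite_I by (rule dvd_prodI)

lemma coprime_A_M: "s \<in> A \<Longrightarrow> i \<in> I \<Longrightarrow> coprime s (int (M i))"
  using coprime_A M_dvd by (meson coprime_divisors dvd_refl of_nat_dvd_iff)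

lemma cong_iff: "[x = y] (mod int n) \<longleftrightarrow> (\<forall>i\<in>I. [x = y] (mod int (M i)))"
proof
  assume "[x = y] (mod int n)"
  then show "\<forall>i\<in>I. [x = y] (mod int (M i))" using M_dvd by (meson cong_dvd_modulus of_nat_dvd_iff)
next
  assume "\<forall>i\<in>I. [x = y] (mod int (M i))"
  then have "[x = y] (mod (\<Prod>i\<in>I. int (M i)))"
    using coprime_M by (intro cong_cong_prod_coprime) auto
  then show "[x = y] (mod int n)" by (simp add: prod_M)
qed

lemma ex_simultaneous_cong: "\<exists>b. \<forall>i\<in>I. [b = f i] (mod int (M i))"
proof -
  obtain k where k: "\<forall>i\<in>I. [k = nat (f i mod int (M i))] (mod M i)"
    using chinese_remainder_nat[OF finite_I, of M "\<lambda>i. nat (f i mod int (M i))"] coprime_M by blast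
  have "[int k = f i] (mod int (M i))" if i: "i \<in> I" for i
  proof -
    have "int (M i) > 0" using cyclic_coords.m_pos[OF coords[OF i]] by simp
    moreover have "[int k = int (nat (f i mod int (M i)))] (mod int (M i))"
      using k i by (simp only: cong_int_iff)
    ultimately show ?thesis by simp
  qed
  then show ?thesis by blast
qed

text \<open>The coprimality of the orders provides exponents that annihilate all components but one.\<close>

lemma ex_simultaneous_multiplier:
  assumes f: "\<And>i. i \<in> I \<Longrightarrow> f i \<in> A"
  shows "\<exists>s\<in>A. \<forall>i\<in>I. [s = f i] (mod int (M i))"
proof -
  let ?o = "\<lambda>i. Coset.order (perm_group (D i) (H i))"
  have ann: "[s ^ ?o i = 1] (mod int (M i))" if "s \<in> A" "i \<in> I" for s i
    using cyclic_coords.multiplier_power_order[OF coords[OF that(2)] one mult that(1)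
        coprime_A_M[OF that]] by blast
  have "\<exists>k. \<forall>j\<in>I. [k = (if j = i then 1 else 0)] (mod ?o j)" for i
    using chinese_remainder_nat[OF finite_I, of ?o "\<lambda>j. if j = i then 1 else 0"] coprime_orders by blast
  then obtain k where k: "\<And>i j. j \<in> I \<Longrightarrow> [k i = (if j = i then 1 else 0)] (mod ?o j)" by metis
  have pow_cong: "[s ^ u = s ^ v] (mod int (M j))" if "s \<in> A" "j \<in> I" "[u = v] (mod ?o j)" for s u v j
  proof -
    have *: "[s ^ u = s ^ (u mod ?o j)] (mod int (M j))" for u
    proof -
      have "s ^ u = (s ^ ?o j) ^ (u div ?o j) * s ^ (u mod ?o j)"
        by (simp flip: power_mult power_add)
      moreover have "[(s ^ ?o j) ^ (u div ?o j) * s ^ (u mod ?o j) = 1 ^ (u div ?o j) * s ^ (u mod ?o j)] (mod int (M j))"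
        using ann[OF that(1,2)] by (intro cong_mult cong_pow cong_refl)
      ultimately show ?thesis by simp
    qed
    have "u mod ?o j = v mod ?o j" using that(3) by (simp add: cong_def)
    then show ?thesis using *[of u] *[of v] by (metis cong_sym cong_trans)
  qed
  have powA: "s ^ u \<in> A" if "s \<in> A" for s u by (induction u) (use that one mult in auto)
  have "(\<Prod>i\<in>F. f i ^ k i) \<in> A" if "F \<subseteq> I" for F
    using finite_subset[OF that finite_I] that
    by (induction F rule: finite_induct) (use one mult powA f in auto)
  then have "(\<Prod>i\<in>I. f i ^ k i) \<in> A" by simp
  moreover have "[(\<Prod>i\<in>I. f i ^ k i) = f j] (mod int (M j))" if j: "j \<in> I" for j
  proof -
    have "[f i ^ k i = (if j = i then f j else 1)] (mod int (M j))" if i: "i \<in> I" for i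
      using pow_cong[OF f[OF i] j k[OF j], of i] by (cases "j = i") simp_all
    then have "[(\<Prod>i\<in>I. f i ^ k i) = (\<Prod>i\<in>I. if j = i then f j else 1)] (mod int (M j))"
      by (rule cong_prod)
    then show ?thesis using finite_I j by simp
  qed
  ultimately show ?thesis by blast
qed

lemma product_isomorphic:
  "action_isomorphic (perm_group V (affine_group V e A)) V (\<lambda>g. g)
    (product_group I (\<lambda>i. perm_group (D i) (H i))) (PiE I D) (product_action I D)"
proof -
  define b where "b y = (\<lambda>i\<in>I. ec i (inv_into UNIV e y))" for y
  have b: "b (e x) = (\<lambda>i\<in>I. ec i x)" for x
  proof -
    have "e (inv_into UNIV e (e x)) = e x" by (simp add: f_inv_into_f)
    then have "[inv_into UNIV e (e x) = x] (mod int n)" by (simp add: e_eq_iff)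
    then have "\<forall>i\<in>I. [inv_into UNIV e (e x) = x] (mod int (M i))" by (simp add: cong_iff)
    then show ?thesis unfolding b_def
      by (intro restrict_ext) (simp add: cyclic_coords.e_eq_iff[OF coords])
  qed
  have b_in: "b (e x) \<in> PiE I D" for x
    using cyclic_coords.e_in[OF coords] by (auto simp: b)
  have "inj_on b V"
  proof (rule inj_onI)
    fix y z assume "y \<in> V" "z \<in> V" "b y = b z"
    then obtain u v where uv: "y = e u" "z = e v" "b (e u) = b (e v)" using ex_coordinate by blast
    have "ec i u = ec i v" if "i \<in> I" for i using fun_cong[OF uv(3), of i] that by (simp add: b)
    then have "\<forall>i\<in>I. [u = v] (mod int (M i))" by (simp add: cyclic_coords.e_eq_iff[OF coords])
    then show "y = z" using uv by (simp add: e_eq_iff cong_iff)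
  qed
  moreover have "b ` V = PiE I D"
  \<comment> \<open>Surjectivity is obtained by counting, both sides having \<open>n\<close>
    elements.\<close>
  proof (rule card_subset_eq)
    show "finite (PiE I D)"
      using finite_I cyclic_coords.finite_space[OF coords] by (intro finite_PiE)
    show "b ` V \<subseteq> PiE I D" using ex_coordinate b_in by blast
    have "card (b ` V) = n" using card_image[OF \<open>inj_on b V\<close>] card_space by simp
    also have "n = card (PiE I D)"
      using finite_I cyclic_coords.card_space[OF coords] by (simp add: card_PiE prod_M)
    finally show "card (b ` V) = card (PiE I D)" .
  qed
  ultimately have bij: "bij_betw b V (PiE I D)" by (simp add: bij_betw_def)
  have match: "\<forall>y\<in>V. b (g y) = product_action I D h (b y)"
    if g: "\<forall>x. g (e x) = e (s * x + c)"
      and h: "\<And>i x. i \<in> I \<Longrightarrow> h i (ec i x) = ec i (s * x + c)" for g h s c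
  proof
    fix y assume "y \<in> V"
    then obtain x where x: "y = e x" using ex_coordinate by blast
    show "b (g y) = product_action I D h (b y)"
      using b_in[of x] g h by (auto simp: product_action_def x b fun_eq_iff)
  qed
  have sub: "subgroup (H i) (BijGroup (D i))" if "i \<in> I" for i
    using cyclic_coords.subgroup_affine_group[OF coords[OF that] one mult] .
  show ?thesis
  proof (rule action_isomorphicI[OF _ _ bij])
    show "faithful_by (perm_group V (affine_group V e A)) V (\<lambda>g. g)"
      using subgroup_affine_group[OF one mult] by (rule faithful_by_perm_group)
    have "faithful_by (product_group I (\<lambda>i. perm_group (D i) (H i))) (PiE I D)
        (\<lambda>g. product_action I D (\<lambda>i. (\<lambda>i g. g) i (g i)))"
    proof (rule faithful_by_product)
      show "faithful_by (perm_group (D i) (H i)) (D i) ((\<lambda>i g. g) i)" if "i \<in> I" for i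
        using faithful_by_perm_group[OF sub[OF that]] .
      show "D i \<noteq> {}" if "i \<in> I" for i
        using cyclic_coords.e_in[OF coords[OF that]] by blast
    qed
    then show "faithful_by (product_group I (\<lambda>i. perm_group (D i) (H i))) (PiE I D) (product_action I D)"
      by simp
    show "\<exists>h\<in>carrier (product_group I (\<lambda>i. perm_group (D i) (H i))). \<forall>y\<in>V. b (g y) = product_action I D h (b y)"
      if g: "g \<in> carrier (perm_group V (affine_group V e A))" for g
    proof -
      obtain s c where s: "s \<in> A" "\<forall>x. g (e x) = e (s * x + c)" using g by (auto simp: affine_group_def)
      have "\<exists>h\<in>H i. \<forall>x. h (ec i x) = ec i (s * x + c)" if "i \<in> I" for i
        using cyclic_coords.ex_affine_group[OF coords[OF that] s(1) coprime_A_M[OF s(1) that]] .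
      then obtain h where h: "\<And>i. i \<in> I \<Longrightarrow> h i \<in> H i \<and> (\<forall>x. h i (ec i x) = ec i (s * x + c))" by metis
      have "restrict h I \<in> carrier (product_group I (\<lambda>i. perm_group (D i) (H i)))" using h by auto
      moreover have "\<forall>y\<in>V. b (g y) = product_action I D (restrict h I) (b y)"
        using h by (intro match[OF s(2)]) simp
      ultimately show ?thesis by blast
    qed
    show "\<exists>g\<in>carrier (perm_group V (affine_group V e A)). \<forall>y\<in>V. b (g y) = product_action I D h (b y)"
      if "h \<in> carrier (product_group I (\<lambda>i. perm_group (D i) (H i)))" for h
    proof -
      have "\<exists>s c. s \<in> A \<and> (\<forall>x. h i (ec i x) = ec i (s * x + c))" if "i \<in> I" for i
      proof -
        have "h i \<in> H i" using \<open>h \<in> _\<close> that by auto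
        then show ?thesis by (auto simp: affine_group_def)
      qed
      then obtain f d where f: "\<And>i. i \<in> I \<Longrightarrow> f i \<in> A \<and> (\<forall>x. h i (ec i x) = ec i (f i * x + d i))" by metis
      obtain s where s: "s \<in> A" "\<forall>i\<in>I. [s = f i] (mod int (M i))"
        using ex_simultaneous_multiplier[of f] f by blast
      obtain c where c: "\<forall>i\<in>I. [c = d i] (mod int (M i))" using ex_simultaneous_cong by blast
      obtain g where g: "g \<in> affine_group V e A" "\<forall>x. g (e x) = e (s * x + c)"
        using ex_affine_group[OF s(1) coprime_A[OF s(1)]] by blast
      have "h i (ec i x) = ec i (s * x + c)" if i: "i \<in> I" for i x
      proof -
        have "[f i * x + d i = s * x + c] (mod int (M i))"
          using s(2) c i by (intro cong_add cong_scalar_right) (auto simp: cong_sym_eq)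
        then show ?thesis using f[OF i] by (simp add: cyclic_coords.e_eq_iff[OF coords[OF i]])
      qed
      then have "\<forall>y\<in>V. b (g y) = product_action I D h (b y)" by (rule match[OF g(2)])
      then show ?thesis using g(1) by auto
    qed
  qed
qed

end

text \<open>A noncyclic factor is moved along its isomorphism to the concrete affine model, where
  the joins have been computed; a cyclic one of exponent above 1 may instead be treated
  directly.\<close>

lemma orbit_join_closed_of_factor:
  fixes D :: "'a set" and p a :: nat
  assumes p: "prime p" and a: "a > 0" and card: "card D = p ^ a"
    and H: "transitive_perm_group D H"
    and large: "a > 1 \<Longrightarrow> cyclic_group (perm_group D H) \<or>
      action_isomorphic (perm_group D H) D (\<lambda>h. h)
        (power_extension (integer_mod_group (p ^ a)) (p ^ (a - 1) + 1)) (carrier (integer_mod_group (p ^ a)))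
        (semidirect_action (integer_mod_group (p ^ a)))"
    and small: "a = 1 \<Longrightarrow> \<exists>S. subgroup S (perm_group (carrier (residue_ring (int p))) (AGL1 (residue_ring (int p)))) \<and>
      action_isomorphic (perm_group D H) D (\<lambda>h. h)
        (perm_group (carrier (residue_ring (int p))) S) (carrier (residue_ring (int p))) (\<lambda>h. h)"
  shows "orbit_join_closed D H"
proof -
  have p0: "p > 0" using p by (rule prime_gt_0_nat)
  then have "card D > 0" using card by simp
  then have fin: "finite D" by (rule card_ge_0_finite)
  have H: "subgroup H (BijGroup D)" using H by (simp add: transitive_perm_group_def)
  have img: "h ` D \<subseteq> D" if "h \<in> carrier (perm_group D H)" for h
    using that subgroup_subset_Bij[OF H] by (auto dest: BijD)
  consider "a = 1" | "a \<ge> 2" using a by linarith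
  then show ?thesis
  proof cases
    case 1
    let ?F = "residue_ring (int p)" and ?M = "{0..<int p}" and ?e = "\<lambda>x. x mod int p"
    interpret C: cyclic_coords ?M ?e p using p0 by (rule cyclic_coords_int)
    note F = AGL1_residue_ring[OF p]
    obtain S where S: "subgroup S (perm_group ?M (AGL1 ?F))"
      and iso: "action_isomorphic (perm_group D H) D (\<lambda>h. h) (perm_group ?M S) ?M (\<lambda>h. h)"
      using small[OF 1] F(1) by auto
    have "subgroup (AGL1 ?F) (BijGroup ?M)"
      unfolding F(2) by (rule C.subgroup_affine_group) auto
    then have "subgroup S (BijGroup ?M)"
      using S group.incl_subgroup[OF group_BijGroup] unfolding perm_group_def by blast
    moreover have "S \<subseteq> affine_group ?M ?e UNIV"
    proof -
      have "S \<subseteq> AGL1 ?F" using subgroup.subset[OF S] by simp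
      then show ?thesis unfolding F(2) affine_group_def by blast
    qed
    ultimately have "orbit_join_closed ?M S" by (rule C.orbit_join_closed_prime[OF p])
    then show ?thesis using orbit_join_closed_iso_iff[OF iso img] by simp
  next
    case 2
    let ?K = "integer_mod_group (p ^ a)" and ?r = "p ^ (a - 1) + 1" and ?M = "{0..<int (p ^ a)}"
      and ?e = "\<lambda>x. x mod int (p ^ a)"
    consider "cyclic_group (perm_group D H)"
      | "action_isomorphic (perm_group D H) D (\<lambda>h. h) (power_extension ?K ?r) (carrier ?K) (semidirect_action ?K)"
      using large 2 by auto
    then show ?thesis
    proof cases
      case 1
      then show ?thesis using orbit_join_closed_cyclic[OF fin H] by blast
    next
      case iso: 2
      have pa: "p ^ a > 0" using p0 by simp
      interpret prime_power_coords ?M ?e "p ^ a" p a "int p ^ (a - 1)"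
        using cyclic_coords_int[OF pa] p \<open>a \<ge> 2\<close>
        unfolding prime_power_coords_def prime_power_coords_axioms_def by blast
      have "action_isomorphic (perm_group ?M G) ?M (\<lambda>g. g) (power_extension ?K ?r) (carrier ?K) (semidirect_action ?K)"
        by (rule power_extension_isomorphic[OF p \<open>a \<ge> 2\<close>]) unfold_locales
      moreover have "g ` ?M \<subseteq> ?M" if "g \<in> carrier (perm_group ?M G)" for g
        using that by (auto simp: affine_group_def dest: BijD)
      ultimately have "orbit_join_closed (carrier ?K) (semidirect_action ?K ` carrier (power_extension ?K ?r))"
        using orbit_join_closed_iso_iff[of "perm_group ?M G" ?M "\<lambda>g. g"] orbit_join_closed_prime_power
        by simp
      then show ?thesis using orbit_join_closed_iso_iff[OF iso img] by simp
    qed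
  qed
qed

text \<open>A common prime divisor \<open>r\<close> of two factor orders is refuted by cases. If
  \<open>r\<close> is \<open>p\<close> or \<open>q\<close>, the multiplier at the other prime has
  order a prime factor of \<open>n\<close>, against \<open>order_coprime_cofactor\<close>; else
  \<open>orders_coprime\<close> applies. Reduction to a prime modulus keeps the multiplier
  nontrivial by \<open>cong_1_prime_power_lift\<close>.\<close>

lemma (in join_closed_multipliers) multiplier_orders_coprime:
  assumes p: "prime (p::nat)" "int p dvd n" and q: "prime q" "int q dvd n" "p \<noteq> q"
    and r: "prime r"
    and sp: "r \<noteq> p \<Longrightarrow> \<exists>s\<in>A. [s ^ r = 1] (mod int (p ^ a)) \<and> \<not> [s = 1] (mod int (p ^ a))"
    and sq: "r \<noteq> q \<Longrightarrow> \<exists>s\<in>A. [s ^ r = 1] (mod int (q ^ b)) \<and> \<not> [s = 1] (mod int (q ^ b))"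
    and ab: "a > 0" "b > 0"
  shows False
proof -
  have reduce: "\<exists>s\<in>A. [s ^ r = 1] (mod int l) \<and> \<not> [s = 1] (mod int l)"
    if l: "prime l" "r \<noteq> l" "c > 0"
      and s: "\<exists>s\<in>A. [s ^ r = 1] (mod int (l ^ c)) \<and> \<not> [s = 1] (mod int (l ^ c))" for l c :: nat
  proof -
    obtain s where s: "s \<in> A" "[s ^ r = 1] (mod int l ^ c)" "\<not> [s = 1] (mod int l ^ c)" using s by auto
    have "\<not> [s = 1] (mod int l)" using cong_1_prime_power_lift[OF l(1) r l(2) _ s(2)] s(3) by blast
    moreover have "[s ^ r = 1] (mod int l)"
      using s(2) by (rule cong_dvd_modulus) (use l(3) in \<open>simp add: dvd_power\<close>)
    ultimately show ?thesis using s(1) by blast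
  qed
  have pp: "prime (int p)" and qq: "prime (int q)" using p q by auto
  show False
  proof (cases "r = p")
    case True
    then have "r \<noteq> q" using q(3) by simp
    then obtain s where "s \<in> A" "[s ^ r = 1] (mod int q)" "\<not> [s = 1] (mod int q)"
      using reduce[OF q(1) _ ab(2) sq] by blast
    then show False using order_coprime_cofactor[OF qq q(2) r, of s] p(2) True q(3) by auto
  next
    case False
    obtain s where s: "s \<in> A" "[s ^ r = 1] (mod int p)" "\<not> [s = 1] (mod int p)"
      using reduce[OF p(1) False ab(1) sp[OF False]] by blast
    show False
    proof (cases "r = q")
      case True
      then show False using order_coprime_cofactor[OF pp p(2) r, of s] q(2,3) s by auto
    next
      case False
      obtain s' where "s' \<in> A" "[s' ^ r = 1] (mod int q)" "\<not> [s' = 1] (mod int q)"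
        using reduce[OF q(1) False ab(2) sq[OF False]] by blast
      then show False using orders_coprime[OF pp p(2) qq q(2) _ r s] q(3) by auto
    qed
  qed
qed

theorem theorem5:
  fixes \<Omega> :: "'a set" and G N :: "('a \<Rightarrow> 'a) set" and n :: nat
  assumes "finite \<Omega>" and "card \<Omega> = n"
    and "subgroup G (BijGroup \<Omega>)"
    and "normal N (perm_group \<Omega> G)"
    and "cyclic_group (perm_group \<Omega> N)"
    and "Coset.order (perm_group \<Omega> N) = n"
    and "regular_perm_group \<Omega> N"
  shows "join_coherent \<Omega> G \<longleftrightarrow>
    (\<exists>(D :: nat \<Rightarrow> nat set) (H :: nat \<Rightarrow> (nat \<Rightarrow> nat) set).
      (\<forall>p\<in>prime_factors n.
         card (D p) = p ^ multiplicity p n \<and> transitive_perm_group (D p) (H p)) \<and>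
      (\<forall>p\<in>prime_factors n. multiplicity p n > 1 \<longrightarrow>
         cyclic_group (perm_group (D p) (H p)) \<or>
         (let K = integer_mod_group (p ^ multiplicity p n);
              r = p ^ (multiplicity p n - 1) + 1
          in action_isomorphic (perm_group (D p) (H p)) (D p) (\<lambda>h. h)
               (power_extension K r) (carrier K) (semidirect_action K))) \<and>
      (\<forall>p\<in>prime_factors n. multiplicity p n = 1 \<longrightarrow>
         (let F = residue_ring (int p)
          in \<exists>S. subgroup S (perm_group (carrier F) (AGL1 F)) \<and>
               action_isomorphic (perm_group (D p) (H p)) (D p) (\<lambda>h. h)
                 (perm_group (carrier F) S) (carrier F) (\<lambda>h. h))) \<and>
      (\<forall>p\<in>prime_factors n. \<forall>q\<in>prime_factors n. p \<noteq> q \<longrightarrow>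
         coprime (Coset.order (perm_group (D p) (H p)))
                 (Coset.order (perm_group (D q) (H q)))) \<and>
      action_isomorphic (perm_group \<Omega> G) \<Omega> (\<lambda>g. g)
        (product_group (prime_factors n) (\<lambda>p. perm_group (D p) (H p)))
        (Pi\<^sub>E (prime_factors n) D)
        (product_action (prime_factors n) D))"
  (is "_ \<longleftrightarrow> (\<exists>D H. ?card D H \<and> ?large D H \<and> ?small D H \<and> ?coprime D H \<and> ?iso D H)")
proof -
  let ?P = "prime_factors n"
  obtain e A where C: "cyclic_coords \<Omega> e n" and G: "G = affine_group \<Omega> e A" and one: "1 \<in> A"
    and mult: "\<And>s t. s \<in> A \<Longrightarrow> t \<in> A \<Longrightarrow> s * t \<in> A" and cop: "\<And>s. s \<in> A \<Longrightarrow> coprime s (int n)"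
    using ex_affine_group_representation[OF assms(3,4,5,6,1,2,7)] by blast
  interpret C: cyclic_coords \<Omega> e n by fact
  have G_Bij: "G \<subseteq> Bij \<Omega>" using assms(3) by (rule subgroup_subset_Bij)
  then have G_img: "g ` \<Omega> \<subseteq> \<Omega>" if "g \<in> carrier (perm_group \<Omega> G)" for g
    using that by (auto dest: BijD)
  have jc: "join_coherent \<Omega> G \<longleftrightarrow> orbit_join_closed \<Omega> G"
    by (rule join_coherent_iff_orbit_join_closed[OF assms(1) G_Bij])
  have prime: "prime p" if "p \<in> ?P" for p
    using that by (rule in_prime_factors_imp_prime)
  have dvd: "p dvd n" if "p \<in> ?P" for p using that by (rule in_prime_factors_imp_dvd)
  have pos: "multiplicity p n > 0" if "p \<in> ?P" for p
    using that by (simp add: prime_factors_multiplicity)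
  show ?thesis
  proof
    assume "\<exists>D H. ?card D H \<and> ?large D H \<and> ?small D H \<and> ?coprime D H \<and> ?iso D H"
    then obtain D :: "nat \<Rightarrow> nat set" and H where card: "?card D H" and large: "?large D H"
      and small: "?small D H" and coprime: "?coprime D H" and iso: "?iso D H" by blast
    have "orbit_join_closed (D p) (H p)" if p: "p \<in> ?P" for p
    proof (rule orbit_join_closed_of_factor[OF prime[OF p] pos[OF p]])
      show "card (D p) = p ^ multiplicity p n" "transitive_perm_group (D p) (H p)"
        using bspec[OF card p] by simp_all
    qed (use bspec[OF large p] bspec[OF small p] in \<open>simp_all add: Let_def\<close>)
    moreover have "coprime_perm_groups ?P D H"
      using card coprime unfolding coprime_perm_groups_def transitive_perm_group_def by auto
    ultimately have "orbit_join_closed (Pi\<^sub>E ?P D) (product_action ?P D ` Pi\<^sub>E ?P H)"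
      using coprime_perm_groups.orbit_join_closed_product by blast
    then have "orbit_join_closed \<Omega> G"
      using orbit_join_closed_iso_iff[OF iso G_img] by simp
    then show "join_coherent \<Omega> G" using jc by blast
  next
    assume "join_coherent \<Omega> G"
    then have "orbit_join_closed \<Omega> (affine_group \<Omega> e A)" using jc G by simp
    then interpret J: join_closed_multipliers "int n" A by (intro C.join_closed_multipliers one cop)
    \<comment> \<open>The factor at \<open>p\<close> is \<open>G\<close> read modulo
      \<open>M p\<close>: the same multipliers act on the residues modulo
      \<open>M p\<close>.\<close>
    define M where "M p = p ^ multiplicity p n" for p
    define D where "D p = {..<M p}" for p
    define ec where "ec p x = nat (x mod int (M p))" for p and x :: int
    define H where "H p = affine_group (D p) (ec p) A" for p
    have coords: "cyclic_coords (D p) (ec p) (M p)" if "p \<in> ?P" for p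
      unfolding D_def ec_def
      by (rule cyclic_coords_nat) (use prime[OF that] prime_gt_0_nat in \<open>simp add: M_def\<close>)
    have M_dvd: "int (M p) dvd int n" for p by (simp only: M_def of_nat_dvd_iff multiplicity_dvd)
    have sub: "subgroup (H p) (BijGroup (D p))" if "p \<in> ?P" for p
      unfolding H_def using cyclic_coords.subgroup_affine_group[OF coords[OF that] one mult] .
    have card: "?card D H"
      using cyclic_coords.card_space[OF coords] cyclic_coords.transitive_affine_group[OF coords one mult]
      by (simp add: M_def H_def)
    have large: "?large D H"
      unfolding Let_def
    proof (intro ballI impI)
      fix p assume p: "p \<in> ?P" and a: "multiplicity p n > 1"
      let ?a = "multiplicity p n"
      have a2: "?a \<ge> 2" using a by simp
      have Cp: "cyclic_coords (D p) (ec p) (p ^ ?a)" using coords[OF p] by (simp add: M_def)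
      have "[s = 1] (mod int p ^ (?a - 1))" if "s \<in> A" for s
        using M_dvd[of p] prime[OF p] a that
        by (intro J.cong_1_mod_prime_power[of _ ?a]) (simp_all add: M_def)
      then have "cyclic_group (perm_group (D p) (H p)) \<or>
          H p = affine_group (D p) (ec p) {s. [s = 1] (mod int p ^ (?a - 1))}"
        unfolding H_def by (intro affine_group_prime_power_cases[OF Cp prime[OF p] a2 one mult])
      then show "cyclic_group (perm_group (D p) (H p)) \<or>
          action_isomorphic (perm_group (D p) (H p)) (D p) (\<lambda>h. h)
            (power_extension (integer_mod_group (p ^ ?a)) (p ^ (?a - 1) + 1))
            (carrier (integer_mod_group (p ^ ?a))) (semidirect_action (integer_mod_group (p ^ ?a)))"
        using power_extension_isomorphic[OF prime[OF p] a2 Cp] by auto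
    qed
    have small: "?small D H"
      unfolding Let_def
    proof (intro ballI impI)
      fix p assume p: "p \<in> ?P" and a: "multiplicity p n = 1"
      let ?F = "residue_ring (int p)" and ?S = "affine_group {0..<int p} (\<lambda>x. x mod int p) A"
      have p0: "p > 0" using prime[OF p] by (rule prime_gt_0_nat)
      have Cp: "cyclic_coords (D p) (ec p) p" using coords[OF p] a by (simp add: M_def)
      interpret Z: cyclic_coords "{0..<int p}" "\<lambda>x. x mod int p" p
        using p0 by (rule cyclic_coords_int)
      note F = AGL1_residue_ring[OF prime[OF p]]
      have "s \<in> {s. coprime s (int p)}" if "s \<in> A" for s
        using coprime_divisors[OF dvd_refl _ cop[OF that], of "int p"] dvd[OF p] by simp
      then have "?S \<subseteq> AGL1 ?F" unfolding F(2) affine_group_def by blast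
      moreover have "subgroup ?S (BijGroup {0..<int p})" by (rule Z.subgroup_affine_group[OF one mult])
      moreover have "subgroup (AGL1 ?F) (BijGroup {0..<int p})"
        unfolding F(2) by (rule Z.subgroup_affine_group) auto
      ultimately have "subgroup ?S (perm_group (carrier ?F) (AGL1 ?F))"
        unfolding F(1) perm_group_def using group.subgroup_incl[OF group_BijGroup] by blast
      moreover have "action_isomorphic (perm_group (D p) (H p)) (D p) (\<lambda>h. h)
          (perm_group (carrier ?F) ?S) (carrier ?F) (\<lambda>h. h)"
        unfolding F(1) H_def by (rule affine_group_isomorphic[OF Cp Z.cyclic_coords_axioms one mult])
      ultimately show "\<exists>S. subgroup S (perm_group (carrier ?F) (AGL1 ?F)) \<and>
          action_isomorphic (perm_group (D p) (H p)) (D p) (\<lambda>h. h)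
            (perm_group (carrier ?F) S) (carrier ?F) (\<lambda>h. h)"
        by blast
    qed
    have coprime: "?coprime D H"
    proof (intro ballI impI)
      fix p q assume p: "p \<in> ?P" and q: "q \<in> ?P" and "p \<noteq> q"
      let ?o = "\<lambda>p. Coset.order (perm_group (D p) (H p))"
      \<comment> \<open>The case \<open>r = l\<close> is left out because translations account for
        the divisor \<open>l\<close> of the order; any other prime divisor must come from a
        multiplier.\<close>
      have ex: "\<exists>s\<in>A. [s ^ r = 1] (mod int (l ^ multiplicity l n)) \<and> \<not> [s = 1] (mod int (l ^ multiplicity l n))"
        if "l \<in> ?P" "prime r" "r dvd ?o l" "r \<noteq> l" for l r
      proof -
        have "coprime r (M l)" using primes_coprime[OF that(2) prime[OF that(1)] that(4)] by (simp add: M_def)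
        then show ?thesis
          using cyclic_coords.ex_multiplier_of_prime_order[OF coords[OF that(1)] one mult that(2)] that(3)
          by (simp add: M_def H_def)
      qed
      show "coprime (?o p) (?o q)"
      proof (rule ccontr)
        assume "\<not> coprime (?o p) (?o q)"
        then have "gcd (?o p) (?o q) \<noteq> 1" by (simp only: coprime_iff_gcd_eq_1 not_False_eq_True)
        then obtain r where r: "prime r" "r dvd gcd (?o p) (?o q)"
          using prime_factor_nat by blast
        then have rp: "r dvd ?o p" and rq: "r dvd ?o q" by auto
        show False
        proof (rule J.multiplier_orders_coprime[OF prime[OF p] _ prime[OF q] _ \<open>p \<noteq> q\<close> r(1) _ _ pos[OF p] pos[OF q]])
          show "int p dvd int n" "int q dvd int n" using dvd p q by simp_all
        qed (use ex[OF p r(1) rp] ex[OF q r(1) rq] in blast)+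
      qed
    qed
    have "coordinate_product \<Omega> e n ?P M D ec A"
    proof (intro coordinate_product.intro coordinate_product_axioms.intro C)
      show "n = (\<Prod>p\<in>?P. M p)" unfolding M_def using C.m_pos by (rule prime_factorization_nat)
      show "coprime (M p) (M q)" if "p \<in> ?P" "q \<in> ?P" "p \<noteq> q" for p q
        using primes_coprime[OF prime[OF that(1)] prime[OF that(2)] that(3)] by (simp add: M_def)
    qed (use coords one mult cop coprime H_def in auto)
    then have iso: "?iso D H" unfolding G H_def by (rule coordinate_product.product_isomorphic)
    show "\<exists>D H. ?card D H \<and> ?large D H \<and> ?small D H \<and> ?coprime D H \<and> ?iso D H"
      by (intro exI[of _ D] exI[of _ H] conjI card large small coprime iso)
  qed
qed

end
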